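(* Let $(X_t)_{t\ge0}$ be an adapted non-negative càdlàg process, $(A_t)_{t\ge0}$ a predictable non-decreasing càdlàg process with $A_0=0$, $(H_t)_{t\ge0}$ an adapted non-negative non-decreasing càdlàg process, $(M_t)_{t\ge0}$ a càdlàg local martingale with $M_0=0$, and $\eta:[0,\infty)\to[0,\infty)$ a continuous non-decreasing concave function with $\eta(x)>0$ for all $x>0$, such that for all $t\ge0$ $$X_t\le\int_{(0,t]}\eta(X_{s^-})\,\mathrm{d}A_s+M_t+H_t\qquad\mathbb{P}\text{-a.s.}$$ Then for all $t\ge0$, $R>0$, $w>0$, $u>0$ (almost surely): - if $H$ is predictable, $$\mathbb{P}[X^*_t>u\mid\mathcal{F}_0]\le\frac{G^{-1}\big(G(\mathbb{E}[H_t\wedge w\mid\mathcal{F}_0])+R\big)}{u}+\mathbb{P}[H_t\ge w\mid\mathcal{F}_0]+\mathbb{P}[A_t>R\mid\mathcal{F}_0];$$ - if $\mathbb{E}[H_t]<\infty$, $$\mathbb{P}[X^*_t>u\mid\mathcal{F}_0]\le\frac{G^{-1}\big(G(\mathbb{E}[H_t\mid\mathcal{F}_0])+R\big)}{u}+\mathbb{P}[A_t>R\mid\mathcal{F}_0].$$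
   Context: All processes are defined on a filtered probability space $(\Omega,\mathcal{F},\mathbb{P},(\mathcal{F}_t)_{t\ge0})$ satisfying the usual conditions. $X^*_t=\sup_{0\le s\le t}X_s$. $G(x)=\int_c^x\frac{\mathrm{d}u}{\eta(u)}$ for $x\in[0,\infty)$, with an arbitrary fixed constant $c>0$. $G$ is increasing with $G(0)\in[-\infty,0)$; $G^{-1}:\mathrm{range}(G)\cap(-\infty,\infty)\to[0,\infty)$ is its inverse. If $G(0)=-\infty$, one sets $G^{-1}(G(0)+a)=0$ for $a\in(-\infty,\infty)$. *)

theory Defs
  imports "HOL-Probability.Probability"
begin

text \<open>Processes are functions \<open>real \<Rightarrow> 'a \<Rightarrow> real\<close> of which only the times \<open>t \<ge> 0\<close> matter; every
  path property is required of all \<open>\<omega> \<in> space P\<close>.\<close>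

text \<open>The axiom \<open>null_sets_F0\<close> contains the completeness of \<open>P\<close> itself.\<close>

locale usual_filtered_prob_space = prob_space P
  for P :: "'a measure" +
  fixes F :: "real \<Rightarrow> 'a measure"
  assumes subalgebra_F: "\<And>t. 0 \<le> t \<Longrightarrow> subalgebra P (F t)"
    and mono_F: "\<And>s t. 0 \<le> s \<Longrightarrow> s \<le> t \<Longrightarrow> sets (F s) \<subseteq> sets (F t)"
    and right_continuous_F: "\<And>t. 0 \<le> t \<Longrightarrow> sets (F t) = (\<Inter>s\<in>{t<..}. sets (F s))"
    and null_sets_F0: "\<And>N A. N \<in> null_sets P \<Longrightarrow> A \<subseteq> N \<Longrightarrow> A \<in> sets (F 0)"

definition adapted_process :: "(real \<Rightarrow> 'a measure) \<Rightarrow> (real \<Rightarrow> 'a \<Rightarrow> real) \<Rightarrow> bool" where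
  "adapted_process F X \<longleftrightarrow> (\<forall>t\<ge>0. X t \<in> borel_measurable (F t))"

definition cadlag_process :: "'a measure \<Rightarrow> (real \<Rightarrow> 'a \<Rightarrow> real) \<Rightarrow> bool" where
  "cadlag_process P X \<longleftrightarrow> (\<forall>\<omega>\<in>space P.
     (\<forall>t\<ge>0. continuous (at_right t) (\<lambda>s. X s \<omega>)) \<and>
     (\<forall>t>0. \<exists>l. ((\<lambda>s. X s \<omega>) \<longlongrightarrow> l) (at_left t)))"

definition nonneg_process :: "'a measure \<Rightarrow> (real \<Rightarrow> 'a \<Rightarrow> real) \<Rightarrow> bool" where
  "nonneg_process P X \<longleftrightarrow> (\<forall>\<omega>\<in>space P. \<forall>t\<ge>0. 0 \<le> X t \<omega>)"

definition nondecreasing_process :: "'a measure \<Rightarrow> (real \<Rightarrow> 'a \<Rightarrow> real) \<Rightarrow> bool" where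
  "nondecreasing_process P X \<longleftrightarrow> (\<forall>\<omega>\<in>space P. mono_on {0..} (\<lambda>t. X t \<omega>))"

definition predictable_sigma :: "'a measure \<Rightarrow> (real \<Rightarrow> 'a measure) \<Rightarrow> (real \<times> 'a) measure" where
  "predictable_sigma P F = sigma ({0..} \<times> space P)
     ({{0} \<times> B | B. B \<in> sets (F 0)} \<union>
      {{s<..t} \<times> B | s t B. 0 \<le> s \<and> s \<le> t \<and> B \<in> sets (F s)})"

definition predictable_process ::
    "'a measure \<Rightarrow> (real \<Rightarrow> 'a measure) \<Rightarrow> (real \<Rightarrow> 'a \<Rightarrow> real) \<Rightarrow> bool" where
  "predictable_process P F X \<longleftrightarrow> (\<lambda>(t, \<omega>). X t \<omega>) \<in> borel_measurable (predictable_sigma P F)"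

definition martingale_process ::
    "'a measure \<Rightarrow> (real \<Rightarrow> 'a measure) \<Rightarrow> (real \<Rightarrow> 'a \<Rightarrow> real) \<Rightarrow> bool" where
  "martingale_process P F X \<longleftrightarrow> adapted_process F X \<and> (\<forall>t\<ge>0. integrable P (X t)) \<and>
     (\<forall>s t. 0 \<le> s \<longrightarrow> s \<le> t \<longrightarrow> (AE \<omega> in P. real_cond_exp P (F s) (X t) \<omega> = X s \<omega>))"

text \<open>The library's \<open>stopping_time\<close> takes its values in the index type of the filtration; here the
  index is real and the value \<open>\<infinity>\<close> has to be allowed.\<close>

definition ext_stopping_time ::
    "'a measure \<Rightarrow> (real \<Rightarrow> 'a measure) \<Rightarrow> ('a \<Rightarrow> ereal) \<Rightarrow> bool" where
  "ext_stopping_time P F \<tau> \<longleftrightarrow> (\<forall>\<omega>\<in>space P. 0 \<le> \<tau> \<omega>) \<and>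
     (\<forall>t\<ge>0. {\<omega>\<in>space P. \<tau> \<omega> \<le> ereal t} \<in> sets (F t))"

definition stopped_process :: "('a \<Rightarrow> ereal) \<Rightarrow> (real \<Rightarrow> 'a \<Rightarrow> real) \<Rightarrow> real \<Rightarrow> 'a \<Rightarrow> real" where
  "stopped_process \<tau> X t \<omega> = X (real_of_ereal (min (ereal t) (\<tau> \<omega>))) \<omega>"

definition local_martingale ::
    "'a measure \<Rightarrow> (real \<Rightarrow> 'a measure) \<Rightarrow> (real \<Rightarrow> 'a \<Rightarrow> real) \<Rightarrow> bool" where
  "local_martingale P F X \<longleftrightarrow> adapted_process F X \<and>
     (\<exists>\<tau>::nat \<Rightarrow> 'a \<Rightarrow> ereal.
        (\<forall>n. ext_stopping_time P F (\<tau> n)) \<and>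
        (AE \<omega> in P. incseq (\<lambda>n. \<tau> n \<omega>) \<and> (\<lambda>n. \<tau> n \<omega>) \<longlonglongrightarrow> \<infinity>) \<and>
        (\<forall>n. martingale_process P F (stopped_process (\<tau> n) (\<lambda>t \<omega>. X t \<omega> - X 0 \<omega>))))"

text \<open>For cadlag paths the supremum is over a non-empty bounded set, so the real \<open>SUP\<close> is the
  true one.\<close>

definition running_sup :: "(real \<Rightarrow> 'a \<Rightarrow> real) \<Rightarrow> real \<Rightarrow> 'a \<Rightarrow> real" where
  "running_sup X t \<omega> = (SUP s\<in>{0..t}. X s \<omega>)"

definition left_limit :: "(real \<Rightarrow> 'a \<Rightarrow> real) \<Rightarrow> real \<Rightarrow> 'a \<Rightarrow> real" where
  "left_limit X s \<omega> = Lim (at_left s) (\<lambda>r. X r \<omega>)"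

text \<open>Pathwise Lebesgue--Stieltjes integral over \<open>(0,t]\<close>. The path of \<open>A\<close> is extended to negative
  times by its value at \<open>0\<close>, because \<open>interval_measure\<close> needs a monotone right-continuous function
  on all of \<open>real\<close>.\<close>

definition stieltjes_integral ::
    "(real \<Rightarrow> 'a \<Rightarrow> real) \<Rightarrow> (real \<Rightarrow> 'a \<Rightarrow> real) \<Rightarrow> real \<Rightarrow> 'a \<Rightarrow> real" where
  "stieltjes_integral Y A t \<omega> =
     (LINT s:{0<..t}|interval_measure (\<lambda>s. A (max 0 s) \<omega>). Y s \<omega>)"

definition cond_probability :: "'a measure \<Rightarrow> 'a measure \<Rightarrow> ('a \<Rightarrow> bool) \<Rightarrow> 'a \<Rightarrow> real" where
  "cond_probability P F0 Q = real_cond_exp P F0 (indicat_real {\<omega>\<in>space P. Q \<omega>})"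

text \<open>\<open>bihari_G \<eta> c x\<close> is the integral of \<open>1 / \<eta>\<close> from \<open>c\<close> to \<open>x\<close>, for \<open>x \<ge> 0\<close>. It is extended real
  since it may be \<open>-\<infinity>\<close> at \<open>x = 0\<close>. The convention \<open>1 / 0 = 0\<close> can only affect the
  integrand at the single point \<open>0\<close>.\<close>

definition bihari_G :: "(real \<Rightarrow> real) \<Rightarrow> real \<Rightarrow> real \<Rightarrow> ereal" where
  "bihari_G \<eta> c x =
     (if c \<le> x then enn2ereal (\<integral>\<^sup>+u\<in>{c..x}. ennreal (1 / \<eta> u) \<partial>lborel)
      else - enn2ereal (\<integral>\<^sup>+u\<in>{x..c}. ennreal (1 / \<eta> u) \<partial>lborel))"

text \<open>The first branch is the convention \<open>G\<^sup>-\<^sup>1 (G 0 + a) = 0\<close> for real \<open>a\<close> in the case \<open>G 0 = -\<infinity>\<close>.\<close>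

definition bihari_G_inv :: "(real \<Rightarrow> real) \<Rightarrow> real \<Rightarrow> ereal \<Rightarrow> real" where
  "bihari_G_inv \<eta> c y = (if y = -\<infinity> then 0 else the_inv_into {0..} (bihari_G \<eta> c) y)"

end

theory Submission
  imports Defs
begin

text \<open>Let \<open>\<tau>\<close> be the first time at which \<open>X\<close> exceeds \<open>u\<close> (cut at \<open>t\<close> and localised for \<open>M\<close>) and \<open>\<sigma>\<^sub>a\<close> the first
  time at which \<open>A\<close> reaches \<open>a\<close>. The substitution \<open>s = \<sigma>\<^sub>a\<close> turns the Stieltjes integral into an integral
  over \<open>a\<close>. Since \<open>A\<close> is predictable, \<open>\<sigma>\<^sub>b\<close> can be announced, so a martingale evaluated at \<open>\<tau>\<close> if
  \<open>\<tau> < \<sigma>\<^sub>b\<close>, and just before \<open>\<sigma>\<^sub>b\<close> otherwise, keeps its expectation. Taking expectations on an event \<open>C\<close> of \<open>F 0\<close>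
  on which the conditional expectation of \<open>H\<close> is at most \<open>r\<close>, one gets for \<open>f b = E[X(\<sigma>\<^sub>b-); \<sigma>\<^sub>b \<le> \<tau> | C]\<close>
  the deterministic inequality \<open>f b \<le> r + (\<integral>a\<in>{0..b}. E[\<eta> (X(\<sigma>\<^sub>a-)); \<sigma>\<^sub>a \<le> \<tau> | C])\<close>, to which Jensen's inequality
  and the classical Bihari--LaSalle argument apply. The same bound controls \<open>E[X \<tau>; \<tau> < \<sigma>\<^sub>b | C]\<close>, and
  \<open>X \<tau> \<ge> u\<close> as soon as the supremum exceeds \<open>u\<close>. If \<open>H\<close> is predictable, one also stops before \<open>H\<close>
  reaches \<open>w\<close>.\<close>

section \<open>Paths with left limits\<close>

text \<open>Stopping strictly before \<open>\<sigma>\<^sub>b\<close> is forced by the jumps of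
  \<open>A\<close>: at \<open>\<sigma>\<^sub>b\<close> itself the integral may already exceed what
  \<open>b\<close> allows. At an arbitrary random time this would cost the martingale its mean,
  because its jump there is dropped. The announcing times come from inner regularity: predictable
  sets are approximated from inside, along the graph of \<open>\<sigma>\<^sub>b\<close> and up to
  small probability, by countable intersections of sets known slightly in advance. Stopping when
  \<open>X\<close> passes \<open>u\<close> keeps the left limits at most \<open>u\<close>, although
  \<open>X\<close> itself may jump above \<open>u\<close>. Hence \<open>\<eta>\<close> of the left
  limits is bounded, and Fubini and the tangent argument require no moment of \<open>X\<close>.
  Conditioning is replaced by integration over events of \<open>F 0\<close> with slightly enlarged
  deterministic data, \<open>r\<close> above the conditional mean and \<open>b\<close> above
  \<open>R\<close>. Then \<open>A t \<le> R\<close> gives the strict \<open>A t < b\<close>, and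
  \<open>r > 0\<close> keeps the deterministic comparison away from a possible value -\<infinity> of
  \<open>G 0\<close>.\<close>

lemma cadlag_tendsto_right:
  assumes "cadlag_process P X" "\<omega> \<in> space P" "0 \<le> t"
  shows "((\<lambda>s. X s \<omega>) \<longlongrightarrow> X t \<omega>) (at_right t)"
  using assms unfolding cadlag_process_def continuous_within by blast

lemma cadlag_tendsto_left:
  assumes "cadlag_process P X" "\<omega> \<in> space P" "0 < t"
  shows "((\<lambda>s. X s \<omega>) \<longlongrightarrow> left_limit X t \<omega>) (at_left t)"
proof -
  obtain l where l: "((\<lambda>s. X s \<omega>) \<longlongrightarrow> l) (at_left t)"
    using assms unfolding cadlag_process_def by blast
  then show ?thesis
    unfolding left_limit_def by (simp add: tendsto_Lim)
qed

lemma LIMSEQ_from_right: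
  fixes x :: "nat \<Rightarrow> real"
  assumes "(f \<longlongrightarrow> l) (at_right t)" "\<And>n. t < x n" "x \<longlonglongrightarrow> t"
  shows "(\<lambda>n. f (x n)) \<longlonglongrightarrow> l"
proof -
  have "filterlim x (at_right t) sequentially"
    using assms(2,3) by (auto simp: filterlim_at eventually_sequentially)
  then show ?thesis using assms(1) by (rule filterlim_compose[rotated])
qed

lemma LIMSEQ_from_left:
  fixes x :: "nat \<Rightarrow> real"
  assumes "(f \<longlongrightarrow> l) (at_left t)" "\<And>n. x n < t" "x \<longlonglongrightarrow> t"
  shows "(\<lambda>n. f (x n)) \<longlonglongrightarrow> l"
proof -
  have "filterlim x (at_left t) sequentially"
    using assms(2,3) by (auto simp: filterlim_at eventually_sequentially)
  then show ?thesis using assms(1) by (rule filterlim_compose[rotated])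
qed

text \<open>Compactness through the bisection principle \<open>Bolzano\<close>: upper bounds on
  adjacent intervals combine, and around each point the one-sided limits bound the path.\<close>

lemma cadlag_bdd_above:
  assumes cadlag: "cadlag_process P X" "\<omega> \<in> space P" and "0 \<le> t"
  shows "bdd_above ((\<lambda>s. X s \<omega>) ` {0..t})"
proof -
  define bnd where "bnd a b \<longleftrightarrow> (\<exists>K. \<forall>s. a \<le> s \<and> s \<le> b \<longrightarrow> 0 \<le> s \<longrightarrow> X s \<omega> \<le> K)" for a b
  have "bnd 0 t"
  proof (rule Bolzano)
    show "0 \<le> t" by fact
  next
    fix a b c
    assume "bnd a b" and "bnd b c"
    then obtain K L where "\<And>s. a \<le> s \<and> s \<le> b \<Longrightarrow> 0 \<le> s \<Longrightarrow> X s \<omega> \<le> K"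
      and "\<And>s. b \<le> s \<and> s \<le> c \<Longrightarrow> 0 \<le> s \<Longrightarrow> X s \<omega> \<le> L" unfolding bnd_def by metis
    then have "\<forall>s. a \<le> s \<and> s \<le> c \<longrightarrow> 0 \<le> s \<longrightarrow> X s \<omega> \<le> max K L"
      by (metis linear max.coboundedI1 max.coboundedI2)
    then show "bnd a c" unfolding bnd_def ..
  next
    fix x assume x: "0 \<le> x" "x \<le> t"
    have "\<forall>\<^sub>F s in at_right x. X s \<omega> < X x \<omega> + 1"
      using cadlag_tendsto_right[OF cadlag x(1)] by (rule order_tendstoD) simp
    then obtain r where r: "x < r" "\<And>s. x < s \<Longrightarrow> s < r \<Longrightarrow> X s \<omega> < X x \<omega> + 1"
      unfolding eventually_at_right_field by blast
    \<comment> \<open>At time 0 there is no left limit, but also no \<open>s\<close> with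
      \<open>0 \<le> s < 0\<close>, so any bound serves.\<close>
    have "\<exists>l<x. \<exists>K. \<forall>s. l < s \<and> s < x \<longrightarrow> 0 \<le> s \<longrightarrow> X s \<omega> \<le> K"
    proof (cases "x = 0")
      case True
      then show ?thesis by (intro exI[of _ "-1"] conjI exI[of _ 0]) auto
    next
      case False
      with x have "0 < x" by simp
      have "\<forall>\<^sub>F s in at_left x. X s \<omega> < left_limit X x \<omega> + 1"
        using cadlag_tendsto_left[OF cadlag \<open>0 < x\<close>] by (rule order_tendstoD) simp
      then obtain l where "l < x" "\<And>s. l < s \<Longrightarrow> s < x \<Longrightarrow> X s \<omega> < left_limit X x \<omega> + 1"
        unfolding eventually_at_left_field by blast
      then show ?thesis by (meson less_imp_le)
    qed
    then obtain l K where l: "l < x" "\<And>s. l < s \<and> s < x \<Longrightarrow> 0 \<le> s \<Longrightarrow> X s \<omega> \<le> K" by blast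
    let ?K = "max K (X x \<omega> + 1)"
    have "\<forall>a b. a \<le> x \<and> x \<le> b \<and> b - a < min (r - x) (x - l) \<longrightarrow>
        (\<forall>s. a \<le> s \<and> s \<le> b \<longrightarrow> 0 \<le> s \<longrightarrow> X s \<omega> \<le> ?K)"
    proof (intro allI impI)
      fix a b s assume *: "a \<le> x \<and> x \<le> b \<and> b - a < min (r - x) (x - l)" "a \<le> s \<and> s \<le> b" "0 \<le> s"
      consider "s < x" | "s = x" | "x < s" by linarith
      then show "X s \<omega> \<le> ?K"
      proof cases
        case 1
        then show ?thesis using l(2)[of s] * by (auto simp: le_max_iff_disj)
      next
        case 3
        then show ?thesis using r(2)[of s] * by (auto simp: le_max_iff_disj)
      qed (simp add: le_max_iff_disj)
    qed
    moreover have "0 < min (r - x) (x - l)" using r l by simp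
    ultimately show "\<exists>d>0. \<forall>a b. a \<le> x \<and> x \<le> b \<and> b - a < d \<longrightarrow> bnd a b" unfolding bnd_def by blast
  qed
  then obtain K where "\<And>s. 0 \<le> s \<and> s \<le> t \<Longrightarrow> X s \<omega> \<le> K" unfolding bnd_def by blast
  then show ?thesis by (intro bdd_aboveI2[of _ _ K]) auto
qed

section \<open>Rounding times to a mesh, and joint measurability of paths\<close>

text \<open>For \<open>s \<ge> 0\<close>, the first point of the mesh 1/(n+1) strictly to the right
  of \<open>s\<close>. Strictness matches one-sided limits, and it lets events of the form
  \<open>T < s\<close> decide the rounded time.\<close>

definition grid_up :: "nat \<Rightarrow> real \<Rightarrow> real" where
  "grid_up n s = (real (nat \<lfloor>s * real (Suc n)\<rfloor>) + 1) / real (Suc n)"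

text \<open>For \<open>s > 0\<close>, the last mesh point strictly to the left of \<open>s\<close>;
  it is never negative.\<close>

definition grid_down :: "nat \<Rightarrow> real \<Rightarrow> real" where
  "grid_down n s = (real (nat \<lceil>s * real (Suc n)\<rceil>) - 1) / real (Suc n)"

lemma grid_up_bounds:
  assumes "0 \<le> s"
  shows "s < grid_up n s" "grid_up n s \<le> s + 1 / real (Suc n)"
proof -
  have "0 \<le> s * real (Suc n)" using assms by simp
  then have "real (nat \<lfloor>s * real (Suc n)\<rfloor>) = of_int \<lfloor>s * real (Suc n)\<rfloor>" by simp
  then have "s * real (Suc n) < real (nat \<lfloor>s * real (Suc n)\<rfloor>) + 1"
    "real (nat \<lfloor>s * real (Suc n)\<rfloor>) \<le> s * real (Suc n)"
    by linarith+
  then show "s < grid_up n s" "grid_up n s \<le> s + 1 / real (Suc n)"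
    unfolding grid_up_def by (simp_all add: field_simps del: of_nat_Suc)
qed

lemma grid_down_bounds:
  assumes "0 < s"
  shows "grid_down n s < s" "s - 1 / real (Suc n) \<le> grid_down n s" "0 \<le> grid_down n s"
proof -
  have pos: "0 < s * real (Suc n)" using assms by simp
  then have "real (nat \<lceil>s * real (Suc n)\<rceil>) = of_int \<lceil>s * real (Suc n)\<rceil>" "1 \<le> \<lceil>s * real (Suc n)\<rceil>"
    by simp_all
  then have "real (nat \<lceil>s * real (Suc n)\<rceil>) - 1 < s * real (Suc n)"
    "s * real (Suc n) \<le> real (nat \<lceil>s * real (Suc n)\<rceil>)" "1 \<le> real (nat \<lceil>s * real (Suc n)\<rceil>)"
    by linarith+
  then show "grid_down n s < s" "s - 1 / real (Suc n) \<le> grid_down n s" "0 \<le> grid_down n s"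
    unfolding grid_down_def by (simp_all add: field_simps del: of_nat_Suc)
qed

lemma LIMSEQ_add_inverse_Suc: "(\<lambda>n. s + 1 / real (Suc n)) \<longlonglongrightarrow> s"
  using tendsto_add[OF tendsto_const[of s] LIMSEQ_inverse_real_of_nat] by (simp add: inverse_eq_divide)

lemma LIMSEQ_diff_inverse_Suc: "(\<lambda>n. s - 1 / real (Suc n)) \<longlonglongrightarrow> s"
  using tendsto_diff[OF tendsto_const[of s] LIMSEQ_inverse_real_of_nat] by (simp add: inverse_eq_divide)

lemma grid_up_LIMSEQ:
  assumes "0 \<le> s"
  shows "(\<lambda>n. grid_up n s) \<longlonglongrightarrow> s"
  by (rule tendsto_sandwich[OF _ _ tendsto_const[of s] LIMSEQ_add_inverse_Suc[of s]])
     (use grid_up_bounds[OF assms] in \<open>auto intro!: always_eventually less_imp_le simp del: of_nat_Suc\<close>)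

lemma grid_down_LIMSEQ:
  assumes "0 < s"
  shows "(\<lambda>n. grid_down n s) \<longlonglongrightarrow> s"
  by (rule tendsto_sandwich[OF _ _ LIMSEQ_diff_inverse_Suc[of s] tendsto_const[of s]])
     (use grid_down_bounds[OF assms] in \<open>auto intro!: always_eventually less_imp_le simp del: of_nat_Suc\<close>)

text \<open>Right-continuity makes the process the limit of its values at \<open>grid_up\<close>.
  These use only countably many times, so each approximation is a countable gluing of measurable
  functions.\<close>

lemma cadlag_joint_measurable:
  assumes meas: "\<And>s. 0 \<le> s \<Longrightarrow> X s \<in> borel_measurable P" and cadlag: "cadlag_process P X"
  shows "(\<lambda>(s, \<omega>). X (max 0 s) \<omega>) \<in> borel_measurable (borel \<Otimes>\<^sub>M P)"
proof (rule borel_measurable_LIMSEQ_real)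
  show "(\<lambda>(s, \<omega>). X (grid_up n (max 0 s)) \<omega>) \<in> borel_measurable (borel \<Otimes>\<^sub>M P)" for n
  proof -
    have "(\<lambda>p. (\<lambda>i p. X ((real i + 1) / real (Suc n)) (snd p)) (nat \<lfloor>max 0 (fst p) * real (Suc n)\<rfloor>) p)
        \<in> borel_measurable (borel \<Otimes>\<^sub>M P)"
    proof (rule measurable_compose_countable[where g = "\<lambda>p. nat \<lfloor>max 0 (fst p) * real (Suc n)\<rfloor>"
          and f = "\<lambda>i p. X ((real i + 1) / real (Suc n)) (snd p)"])
      fix i
      have [measurable]: "X ((real i + 1) / real (Suc n)) \<in> borel_measurable P"
        by (rule meas) simp
      show "(\<lambda>p. X ((real i + 1) / real (Suc n)) (snd p)) \<in> borel_measurable (borel \<Otimes>\<^sub>M P)"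
        by measurable
    next
      show "(\<lambda>p. nat \<lfloor>max 0 (fst p) * real (Suc n)\<rfloor>) \<in> borel \<Otimes>\<^sub>M P \<rightarrow>\<^sub>M count_space UNIV"
        by measurable
    qed
    then show ?thesis by (simp add: case_prod_beta grid_up_def)
  qed
next
  fix p assume p: "p \<in> space (borel \<Otimes>\<^sub>M P :: (real \<times> 'a) measure)"
  then have "snd p \<in> space P" by (auto simp: space_pair_measure)
  then have "(\<lambda>n. X (grid_up n (max 0 (fst p))) (snd p)) \<longlonglongrightarrow> X (max 0 (fst p)) (snd p)"
    by (intro LIMSEQ_from_right[OF cadlag_tendsto_right[OF cadlag]] grid_up_bounds grid_up_LIMSEQ) auto
  then show "(\<lambda>n. (\<lambda>(s, \<omega>). X (grid_up n (max 0 s)) \<omega>) p) \<longlonglongrightarrow> (\<lambda>(s, \<omega>). X (max 0 s) \<omega>) p"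
    by (simp add: case_prod_beta)
qed

text \<open>The same approximation from the left, through \<open>grid_down\<close>. The value 0 at
  times that are not positive is a placeholder, as no left limit is prescribed there.\<close>

lemma left_limit_joint_measurable:
  assumes meas: "\<And>s. 0 \<le> s \<Longrightarrow> X s \<in> borel_measurable P" and cadlag: "cadlag_process P X"
  shows "(\<lambda>(s, \<omega>). if 0 < s then left_limit X s \<omega> else 0) \<in> borel_measurable (borel \<Otimes>\<^sub>M P)"
proof (rule borel_measurable_LIMSEQ_real)
  note [measurable] = cadlag_joint_measurable[OF assms]
  show "(\<lambda>(s, \<omega>). if 0 < s then X (max 0 (grid_down n s)) \<omega> else 0) \<in> borel_measurable (borel \<Otimes>\<^sub>M P)" for n
  proof -
    have [measurable]: "grid_down n \<in> borel_measurable borel"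
      unfolding grid_down_def by measurable
    have "(\<lambda>p. case (grid_down n (fst p), snd p) of (s, \<omega>) \<Rightarrow> X (max 0 s) \<omega>) \<in> borel_measurable (borel \<Otimes>\<^sub>M P)"
      by measurable
    then have [measurable]: "(\<lambda>p. X (max 0 (grid_down n (fst p))) (snd p)) \<in> borel_measurable (borel \<Otimes>\<^sub>M P)"
      by simp
    show ?thesis unfolding case_prod_beta by measurable
  qed
next
  fix p assume p: "p \<in> space (borel \<Otimes>\<^sub>M P :: (real \<times> 'a) measure)"
  then have \<omega>: "snd p \<in> space P" by (auto simp: space_pair_measure)
  show "(\<lambda>n. (\<lambda>(s, \<omega>). if 0 < s then X (max 0 (grid_down n s)) \<omega> else 0) p) \<longlonglongrightarrow>
      (\<lambda>(s, \<omega>). if 0 < s then left_limit X s \<omega> else 0) p"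
  proof (cases "0 < fst p")
    case True
    have "(\<lambda>n. X (grid_down n (fst p)) (snd p)) \<longlonglongrightarrow> left_limit X (fst p) (snd p)"
      by (intro LIMSEQ_from_left[OF cadlag_tendsto_left[OF cadlag \<omega> True]] grid_down_bounds
          grid_down_LIMSEQ True)
    with True show ?thesis using grid_down_bounds(3)[OF True] by (simp add: case_prod_beta max_absorb2)
  qed (simp add: case_prod_beta)
qed

lemma cadlag_at_time_measurable:
  assumes "\<And>s. 0 \<le> s \<Longrightarrow> X s \<in> borel_measurable P" and "cadlag_process P X"
    and [measurable]: "T \<in> borel_measurable P" and T: "\<And>\<omega>. \<omega> \<in> space P \<Longrightarrow> 0 \<le> T \<omega>"
  shows "(\<lambda>\<omega>. X (T \<omega>) \<omega>) \<in> borel_measurable P"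
proof -
  note [measurable] = cadlag_joint_measurable[OF assms(1,2)]
  have "(\<lambda>\<omega>. case (T \<omega>, \<omega>) of (s, \<omega>) \<Rightarrow> X (max 0 s) \<omega>) \<in> borel_measurable P"
    by measurable
  then show ?thesis
    by (rule measurable_cong[THEN iffD1, rotated]) (simp add: T max_absorb2)
qed

lemma left_limit_at_time_measurable:
  assumes "\<And>s. 0 \<le> s \<Longrightarrow> X s \<in> borel_measurable P" and "cadlag_process P X"
    and [measurable]: "T \<in> borel_measurable P" and T: "\<And>\<omega>. \<omega> \<in> space P \<Longrightarrow> 0 < T \<omega>"
  shows "(\<lambda>\<omega>. left_limit X (T \<omega>) \<omega>) \<in> borel_measurable P"
proof -
  note [measurable] = left_limit_joint_measurable[OF assms(1,2)]
  have "(\<lambda>\<omega>. case (T \<omega>, \<omega>) of (s, \<omega>) \<Rightarrow> if 0 < s then left_limit X s \<omega> else 0) \<in> borel_measurable P"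
    by measurable
  then show ?thesis
    by (rule measurable_cong[THEN iffD1, rotated]) (simp add: T)
qed

lemma left_limit_le:
  assumes "cadlag_process P X" "\<omega> \<in> space P" "0 < s" "\<And>r. 0 \<le> r \<Longrightarrow> r < s \<Longrightarrow> X r \<omega> \<le> K"
  shows "left_limit X s \<omega> \<le> K"
proof (rule tendsto_upperbound[OF cadlag_tendsto_left[OF assms(1-3)]])
  show "\<forall>\<^sub>F r in at_left s. X r \<omega> \<le> K"
    unfolding eventually_at_left_field using assms(3,4) by (intro exI[of _ 0]) auto
qed simp

lemma left_limit_ge:
  assumes "cadlag_process P X" "\<omega> \<in> space P" "0 < s" "\<And>r. 0 \<le> r \<Longrightarrow> r < s \<Longrightarrow> K \<le> X r \<omega>"
  shows "K \<le> left_limit X s \<omega>"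
proof (rule tendsto_lowerbound[OF cadlag_tendsto_left[OF assms(1-3)]])
  show "\<forall>\<^sub>F r in at_left s. K \<le> X r \<omega>"
    unfolding eventually_at_left_field using assms(3,4) by (intro exI[of _ 0]) auto
qed simp

section \<open>Uniform integrability of sampled martingales\<close>

context usual_filtered_prob_space
begin

lemma space_F: "0 \<le> t \<Longrightarrow> space (F t) = space P"
  using subalgebra_F unfolding subalgebra_def by blast

lemma sets_F_subset: "0 \<le> t \<Longrightarrow> A \<in> sets (F t) \<Longrightarrow> A \<in> sets P"
  using subalgebra_F unfolding subalgebra_def by blast

lemma sets_F_mono: "0 \<le> s \<Longrightarrow> s \<le> t \<Longrightarrow> A \<in> sets (F s) \<Longrightarrow> A \<in> sets (F t)"
  using mono_F by blast

lemma sigma_finite_subalgebra_F: "0 \<le> t \<Longrightarrow> sigma_finite_subalgebra P (F t)"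
  by (intro finite_measure_subalgebra_is_sigma_finite)
     (simp add: finite_measure_subalgebra_def finite_measure_subalgebra_axioms_def subalgebra_F
        finite_measure_axioms)

lemma adapted_measurable:
  assumes "adapted_process F X" "0 \<le> t"
  shows "X t \<in> borel_measurable P"
  using assms subalgebra_F measurable_from_subalg unfolding adapted_process_def by blast

lemma martingale_set_integral:
  assumes N: "martingale_process P F N" and "0 \<le> s" "s \<le> t" and C: "C \<in> sets (F s)"
  shows "(\<integral>\<omega>\<in>C. N s \<omega> \<partial>P) = (\<integral>\<omega>\<in>C. N t \<omega> \<partial>P)"
proof -
  interpret sigma_finite_subalgebra P "F s" by (rule sigma_finite_subalgebra_F) fact
  have int: "integrable P (N t)" "integrable P (N s)"
    using assms unfolding martingale_process_def by auto
  have CP: "C \<in> sets P" using sets_F_subset \<open>0 \<le> s\<close> C by blast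
  have "(\<integral>\<omega>\<in>C. N t \<omega> \<partial>P) = (\<integral>\<omega>\<in>C. real_cond_exp P (F s) (N t) \<omega> \<partial>P)"
    using int(1) C by (rule real_cond_exp_intA)
  also have "\<dots> = (\<integral>\<omega>\<in>C. N s \<omega> \<partial>P)"
    unfolding set_lebesgue_integral_def
  proof (rule integral_cong_AE)
    show "AE \<omega> in P. indicator C \<omega> *\<^sub>R real_cond_exp P (F s) (N t) \<omega> = indicator C \<omega> *\<^sub>R N s \<omega>"
    proof -
      have "AE \<omega> in P. real_cond_exp P (F s) (N t) \<omega> = N s \<omega>"
        using N assms(2,3) unfolding martingale_process_def by blast
      then show ?thesis by eventually_elim simp
    qed
  qed (use CP int borel_measurable_cond_exp2 in auto)
  finally show ?thesis ..
qed

text \<open>The submartingale inequality for the convex function (\<bar>x\<bar> - K)+ by hand: on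
  \<open>U\<close> and on \<open>L\<close>, both known at time \<open>s\<close>, the excess of
  \<open>N s\<close> is affine in \<open>N s\<close>, and integrals of affine expressions are
  preserved up to \<open>t\<close>. There they are at most the excess of \<open>N t\<close>.\<close>

lemma martingale_excess_mono:
  assumes N: "martingale_process P F N" and st: "0 \<le> s" "s \<le> t" and C: "C \<in> sets (F s)" and "0 \<le> K"
  shows "(\<integral>\<^sup>+\<omega>\<in>C. ennreal (\<bar>N s \<omega>\<bar> - K) \<partial>P) \<le> (\<integral>\<^sup>+\<omega>\<in>C. ennreal (\<bar>N t \<omega>\<bar> - K) \<partial>P)"
proof -
  have int: "integrable P (N t)" "integrable P (N s)"
    using assms unfolding martingale_process_def by auto
  have [measurable]: "N s \<in> borel_measurable (F s)"
    using N st unfolding martingale_process_def adapted_process_def by auto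
  define U L where "U = C \<inter> {\<omega>\<in>space (F s). K < N s \<omega>}" and "L = C \<inter> {\<omega>\<in>space (F s). N s \<omega> < - K}"
  have UL: "U \<in> sets (F s)" "L \<in> sets (F s)" unfolding U_def L_def using C by measurable
  have [measurable]: "U \<in> sets P" "L \<in> sets P" "C \<in> sets P"
    using sets_F_subset st(1) UL C by auto
  have space: "space (F s) = space P" by (rule space_F) fact
  have CP: "C \<subseteq> space P" using \<open>C \<in> sets P\<close> by (rule sets.sets_into_space)
  have expand: "(\<integral>\<omega>. indicator U \<omega> * (f \<omega> - K) + indicator L \<omega> * (- f \<omega> - K) \<partial>P)
      = (\<integral>\<omega>. indicator U \<omega> * f \<omega> \<partial>P) - (\<integral>\<omega>. indicator U \<omega> * K \<partial>P)
        - (\<integral>\<omega>. indicator L \<omega> * f \<omega> \<partial>P) - (\<integral>\<omega>. indicator L \<omega> * K \<partial>P)"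
    if f: "integrable P f" for f :: "'a \<Rightarrow> real"
  proof -
    have "(\<lambda>\<omega>. indicator U \<omega> * (f \<omega> - K) + indicator L \<omega> * (- f \<omega> - K))
        = (\<lambda>\<omega>. indicator U \<omega> * f \<omega> - indicator U \<omega> * K - indicator L \<omega> * f \<omega> - indicator L \<omega> * K)"
      by (simp add: algebra_simps)
    moreover have "integrable P (\<lambda>\<omega>. indicator B \<omega> * f \<omega>)" "integrable P (\<lambda>\<omega>. indicator B \<omega> * K)"
      if "B \<in> sets P" for B
      using that f by (auto intro!: integrable_mult_indicator[where 'b=real, simplified] simp del: integrable_mult_left_iff integrable_mult_right_iff)
    ultimately show ?thesis
      using \<open>U \<in> sets P\<close> \<open>L \<in> sets P\<close> by (simp del: integral_mult_left_zero integral_mult_left)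
  qed
  have int_UL: "integrable P (\<lambda>\<omega>. indicator U \<omega> * (f \<omega> - K) + indicator L \<omega> * (- f \<omega> - K))"
    if "integrable P f" for f :: "'a \<Rightarrow> real"
    using that by (intro Bochner_Integration.integrable_add integrable_mult_indicator[where 'b=real, simplified]) auto
  have eq: "(\<integral>\<omega>. indicator U \<omega> * (N s \<omega> - K) + indicator L \<omega> * (- N s \<omega> - K) \<partial>P)
      = (\<integral>\<omega>. indicator U \<omega> * (N t \<omega> - K) + indicator L \<omega> * (- N t \<omega> - K) \<partial>P)"
    using martingale_set_integral[OF N st UL(1)] martingale_set_integral[OF N st UL(2)]
    unfolding expand[OF int(1)] expand[OF int(2)] set_lebesgue_integral_def by simp
  have "(\<integral>\<^sup>+\<omega>\<in>C. ennreal (\<bar>N s \<omega>\<bar> - K) \<partial>P)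
      = (\<integral>\<^sup>+\<omega>. ennreal (indicator U \<omega> * (N s \<omega> - K) + indicator L \<omega> * (- N s \<omega> - K)) \<partial>P)"
    using \<open>0 \<le> K\<close> CP space
    by (intro nn_integral_cong) (auto simp: U_def L_def indicator_def ennreal_neg)
  also have "\<dots> = ennreal (\<integral>\<omega>. indicator U \<omega> * (N s \<omega> - K) + indicator L \<omega> * (- N s \<omega> - K) \<partial>P)"
    using \<open>0 \<le> K\<close> by (intro nn_integral_eq_integral int_UL int) (auto simp: U_def L_def indicator_def)
  also have "\<dots> = ennreal (\<integral>\<omega>. indicator U \<omega> * (N t \<omega> - K) + indicator L \<omega> * (- N t \<omega> - K) \<partial>P)"
    unfolding eq ..
  also have "\<dots> \<le> ennreal (\<integral>\<omega>. indicator C \<omega> * max 0 (\<bar>N t \<omega>\<bar> - K) \<partial>P)"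
  proof (intro ennreal_leI integral_mono int_UL int)
    show "integrable P (\<lambda>\<omega>. indicator C \<omega> * max 0 (\<bar>N t \<omega>\<bar> - K))"
      using int by (intro integrable_mult_indicator[where 'b=real, simplified]) auto
  qed (use \<open>0 \<le> K\<close> in \<open>auto simp: U_def L_def indicator_def\<close>)
  also have "\<dots> = (\<integral>\<^sup>+\<omega>. ennreal (indicator C \<omega> * max 0 (\<bar>N t \<omega>\<bar> - K)) \<partial>P)"
    using int
    by (intro nn_integral_eq_integral[symmetric] integrable_mult_indicator[where 'b=real, simplified]) auto
  also have "\<dots> = (\<integral>\<^sup>+\<omega>\<in>C. ennreal (\<bar>N t \<omega>\<bar> - K) \<partial>P)"
    by (intro nn_integral_cong) (auto simp: indicator_def ennreal_neg max_def)
  finally show ?thesis .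
qed

text \<open>Domination of all the excesses \<open>E(\<bar>Z\<bar> - K)\<^sup>+\<close> by those of one integrable variable is uniform
  integrability in a form which Fatou's lemma passes on to almost sure limits.\<close>

definition sampled :: "('a \<Rightarrow> real) \<Rightarrow> ('a \<Rightarrow> real) \<Rightarrow> bool" where
  "sampled Y Z \<longleftrightarrow> Z \<in> borel_measurable P \<and>
     (\<forall>K\<ge>0. (\<integral>\<^sup>+\<omega>. ennreal (\<bar>Z \<omega>\<bar> - K) \<partial>P) \<le> (\<integral>\<^sup>+\<omega>. ennreal (\<bar>Y \<omega>\<bar> - K) \<partial>P)) \<and>
     (\<forall>C\<in>sets (F 0). (\<integral>\<omega>\<in>C. Z \<omega> \<partial>P) = (\<integral>\<omega>\<in>C. Y \<omega> \<partial>P))"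

lemma sampled_integrable:
  assumes "sampled Y Z" "integrable P Y"
  shows "integrable P Z"
proof (rule integrableI_bounded)
  show "Z \<in> borel_measurable P" using assms unfolding sampled_def by blast
  have "(\<integral>\<^sup>+\<omega>. ennreal (\<bar>Z \<omega>\<bar> - 0) \<partial>P) \<le> (\<integral>\<^sup>+\<omega>. ennreal (\<bar>Y \<omega>\<bar> - 0) \<partial>P)"
    using assms unfolding sampled_def by blast
  also have "\<dots> < \<infinity>" using assms(2) by (simp add: integrable_iff_bounded)
  finally show "(\<integral>\<^sup>+\<omega>. ennreal (norm (Z \<omega>)) \<partial>P) < \<infinity>" by simp
qed

lemma excess_LIMSEQ_0:
  assumes "integrable P Y"
  shows "(\<lambda>k. \<integral>\<omega>. max 0 (\<bar>Y \<omega>\<bar> - real k) \<partial>P) \<longlonglongrightarrow> 0"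
proof -
  have [measurable]: "Y \<in> borel_measurable P" using assms by auto
  have "(\<lambda>k. \<integral>\<omega>. max 0 (\<bar>Y \<omega>\<bar> - real k) \<partial>P) \<longlonglongrightarrow> (\<integral>\<omega>. 0 \<partial>P)"
  proof (rule integral_dominated_convergence[where w="\<lambda>\<omega>. \<bar>Y \<omega>\<bar>"])
    show "AE \<omega> in P. (\<lambda>k. max 0 (\<bar>Y \<omega>\<bar> - real k)) \<longlonglongrightarrow> 0"
    proof (intro AE_I2 tendsto_eventually)
      fix \<omega>
      obtain k where "\<bar>Y \<omega>\<bar> \<le> real k" using real_arch_simple by blast
      then show "\<forall>\<^sub>F k in sequentially. max 0 (\<bar>Y \<omega>\<bar> - real k) = 0"
        by (intro eventually_sequentiallyI[of k]) auto
    qed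
  qed (use assms in auto)
  then show ?thesis by simp
qed

text \<open>Fatou's lemma transfers the excess bounds. For the integrals over \<open>C\<close>,
  values are clamped to [-k, k]: the clamping error is exactly the excess over \<open>k\<close>,
  hence at most \<open>\<rho> k\<close> uniformly in \<open>n\<close>, and the clamped variables
  converge boundedly.\<close>

lemma sampled_limit:
  assumes Y: "integrable P Y" and Zn: "\<And>n. sampled Y (Zn n)" and Z[measurable]: "Z \<in> borel_measurable P"
    and lim: "AE \<omega> in P. (\<lambda>n. Zn n \<omega>) \<longlonglongrightarrow> Z \<omega>"
  shows "sampled Y Z"
  unfolding sampled_def
proof (intro conjI ballI allI impI)
  have Zn_meas[measurable]: "Zn n \<in> borel_measurable P" for n using Zn unfolding sampled_def by blast
  show excess: "(\<integral>\<^sup>+\<omega>. ennreal (\<bar>Z \<omega>\<bar> - K) \<partial>P) \<le> (\<integral>\<^sup>+\<omega>. ennreal (\<bar>Y \<omega>\<bar> - K) \<partial>P)" if "0 \<le> K" for K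
  proof -
    have "(\<integral>\<^sup>+\<omega>. ennreal (\<bar>Z \<omega>\<bar> - K) \<partial>P) = (\<integral>\<^sup>+\<omega>. liminf (\<lambda>n. ennreal (\<bar>Zn n \<omega>\<bar> - K)) \<partial>P)"
    proof (rule nn_integral_cong_AE)
      show "AE \<omega> in P. ennreal (\<bar>Z \<omega>\<bar> - K) = liminf (\<lambda>n. ennreal (\<bar>Zn n \<omega>\<bar> - K))"
        using lim
      proof eventually_elim
        case (elim \<omega>)
        then have "(\<lambda>n. ennreal (\<bar>Zn n \<omega>\<bar> - K)) \<longlonglongrightarrow> ennreal (\<bar>Z \<omega>\<bar> - K)"
          by (intro tendsto_ennrealI tendsto_intros)
        then show ?case by (simp add: lim_imp_Liminf)
      qed
    qed
    also have "\<dots> \<le> liminf (\<lambda>n. \<integral>\<^sup>+\<omega>. ennreal (\<bar>Zn n \<omega>\<bar> - K) \<partial>P)"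
      by (rule nn_integral_liminf) measurable
    also have "\<dots> \<le> liminf (\<lambda>n. \<integral>\<^sup>+\<omega>. ennreal (\<bar>Y \<omega>\<bar> - K) \<partial>P)"
      using Zn \<open>0 \<le> K\<close> unfolding sampled_def by (intro Liminf_mono always_eventually) blast
    also have "\<dots> = (\<integral>\<^sup>+\<omega>. ennreal (\<bar>Y \<omega>\<bar> - K) \<partial>P)" by (simp add: Liminf_const)
    finally show ?thesis .
  qed
  have intZn: "integrable P (Zn n)" for n using Zn Y by (rule sampled_integrable)
  have intZ: "integrable P Z"
  proof (rule integrableI_bounded)
    have "(\<integral>\<^sup>+\<omega>. ennreal (\<bar>Z \<omega>\<bar> - 0) \<partial>P) \<le> (\<integral>\<^sup>+\<omega>. ennreal (\<bar>Y \<omega>\<bar> - 0) \<partial>P)" by (rule excess) simp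
    also have "\<dots> < \<infinity>" using Y by (simp add: integrable_iff_bounded)
    finally show "(\<integral>\<^sup>+\<omega>. ennreal (norm (Z \<omega>)) \<partial>P) < \<infinity>" by simp
  qed fact
  fix C assume C: "C \<in> sets (F 0)"
  then have [measurable]: "C \<in> sets P" using sets_F_subset by auto
  define c where "c = (\<integral>\<omega>\<in>C. Y \<omega> \<partial>P)"
  have c: "(\<integral>\<omega>\<in>C. Zn n \<omega> \<partial>P) = c" for n using Zn C unfolding sampled_def c_def by blast
  define \<rho> where "\<rho> k = (\<integral>\<omega>. max 0 (\<bar>Y \<omega>\<bar> - real k) \<partial>P)" for k :: nat
  define cl where "cl k x = max (- real k) (min (real k) x)" for k :: nat and x :: real
  have \<rho>: "(\<integral>\<omega>. max 0 (\<bar>V \<omega>\<bar> - real k) \<partial>P) \<le> \<rho> k"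
    if V: "integrable P V" and le: "(\<integral>\<^sup>+\<omega>. ennreal (\<bar>V \<omega>\<bar> - real k) \<partial>P) \<le> (\<integral>\<^sup>+\<omega>. ennreal (\<bar>Y \<omega>\<bar> - real k) \<partial>P)"
    for V :: "'a \<Rightarrow> real" and k
  proof -
    have *: "(\<integral>\<^sup>+\<omega>. ennreal (\<bar>W \<omega>\<bar> - real k) \<partial>P) = ennreal (\<integral>\<omega>. max 0 (\<bar>W \<omega>\<bar> - real k) \<partial>P)"
      if "integrable P W" for W :: "'a \<Rightarrow> real"
    proof -
      have "(\<integral>\<^sup>+\<omega>. ennreal (\<bar>W \<omega>\<bar> - real k) \<partial>P) = (\<integral>\<^sup>+\<omega>. ennreal (max 0 (\<bar>W \<omega>\<bar> - real k)) \<partial>P)"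
        by (intro nn_integral_cong) (auto simp: max_def ennreal_neg)
      also have "\<dots> = ennreal (\<integral>\<omega>. max 0 (\<bar>W \<omega>\<bar> - real k) \<partial>P)"
        using that by (intro nn_integral_eq_integral) auto
      finally show ?thesis .
    qed
    have "0 \<le> (\<integral>\<omega>. max 0 (\<bar>Y \<omega>\<bar> - real k) \<partial>P)" by (intro integral_nonneg_AE) auto
    then show ?thesis using le unfolding *[OF V] *[OF Y] \<rho>_def by simp
  qed
  have trunc: "\<bar>(\<integral>\<omega>\<in>C. V \<omega> \<partial>P) - (\<integral>\<omega>\<in>C. cl k (V \<omega>) \<partial>P)\<bar> \<le> \<rho> k"
    if V: "integrable P V" and le: "(\<integral>\<^sup>+\<omega>. ennreal (\<bar>V \<omega>\<bar> - real k) \<partial>P) \<le> (\<integral>\<^sup>+\<omega>. ennreal (\<bar>Y \<omega>\<bar> - real k) \<partial>P)"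
    for V :: "'a \<Rightarrow> real" and k
  proof -
    have [measurable]: "V \<in> borel_measurable P" using V by auto
    have intcl: "integrable P (\<lambda>\<omega>. cl k (V \<omega>))"
      by (rule integrable_const_bound[where B="real k"]) (auto simp: cl_def)
    have "(\<integral>\<omega>\<in>C. V \<omega> \<partial>P) - (\<integral>\<omega>\<in>C. cl k (V \<omega>) \<partial>P)
        = (\<integral>\<omega>. indicator C \<omega> * (V \<omega> - cl k (V \<omega>)) \<partial>P)"
      using V intcl unfolding set_lebesgue_integral_def
      by (simp add: right_diff_distrib integrable_mult_indicator[where 'b=real, simplified])
    also have "\<bar>\<dots>\<bar> \<le> (\<integral>\<omega>. \<bar>indicator C \<omega> * (V \<omega> - cl k (V \<omega>))\<bar> \<partial>P)"
      by (rule integral_abs_bound)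
    also have "\<dots> \<le> (\<integral>\<omega>. max 0 (\<bar>V \<omega>\<bar> - real k) \<partial>P)"
      using V intcl
      by (intro integral_mono integrable_abs integrable_mult_indicator[where 'b=real, simplified])
         (auto simp: indicator_def cl_def)
    also have "\<dots> \<le> \<rho> k" using that by (rule \<rho>)
    finally show ?thesis .
  qed
  \<comment> \<open>One error \<open>\<rho> k\<close> is paid for clamping \<open>Z\<close>, one for
    clamping \<open>Zn n\<close>; the difference of the clamped integrals vanishes as
    \<open>n\<close> grows.\<close>
  have "\<bar>(\<integral>\<omega>\<in>C. Z \<omega> \<partial>P) - c\<bar> \<le> 2 * \<rho> k" for k
  proof (rule LIMSEQ_le_const)
    have "(\<lambda>n. \<integral>\<omega>\<in>C. cl k (Zn n \<omega>) \<partial>P) \<longlonglongrightarrow> (\<integral>\<omega>\<in>C. cl k (Z \<omega>) \<partial>P)"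
      unfolding set_lebesgue_integral_def
    proof (rule integral_dominated_convergence[where w="\<lambda>_. real k"])
      show "AE \<omega> in P. (\<lambda>n. indicator C \<omega> *\<^sub>R cl k (Zn n \<omega>)) \<longlonglongrightarrow> indicator C \<omega> *\<^sub>R cl k (Z \<omega>)"
        using lim by eventually_elim (auto simp: cl_def intro!: tendsto_intros)
    qed (auto simp: cl_def indicator_def)
    then have "(\<lambda>n. 2 * \<rho> k + \<bar>(\<integral>\<omega>\<in>C. cl k (Z \<omega>) \<partial>P) - (\<integral>\<omega>\<in>C. cl k (Zn n \<omega>) \<partial>P)\<bar>)
        \<longlonglongrightarrow> 2 * \<rho> k + \<bar>(\<integral>\<omega>\<in>C. cl k (Z \<omega>) \<partial>P) - (\<integral>\<omega>\<in>C. cl k (Z \<omega>) \<partial>P)\<bar>"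
      by (intro tendsto_intros)
    then show "(\<lambda>n. 2 * \<rho> k + \<bar>(\<integral>\<omega>\<in>C. cl k (Z \<omega>) \<partial>P) - (\<integral>\<omega>\<in>C. cl k (Zn n \<omega>) \<partial>P)\<bar>) \<longlonglongrightarrow> 2 * \<rho> k"
      by simp
    have "\<bar>(\<integral>\<omega>\<in>C. Z \<omega> \<partial>P) - c\<bar>
        \<le> 2 * \<rho> k + \<bar>(\<integral>\<omega>\<in>C. cl k (Z \<omega>) \<partial>P) - (\<integral>\<omega>\<in>C. cl k (Zn n \<omega>) \<partial>P)\<bar>" for n
    proof -
      have "(\<integral>\<^sup>+\<omega>. ennreal (\<bar>Zn n \<omega>\<bar> - real k) \<partial>P) \<le> (\<integral>\<^sup>+\<omega>. ennreal (\<bar>Y \<omega>\<bar> - real k) \<partial>P)"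
        using Zn unfolding sampled_def by auto
      from trunc[OF intZn this] trunc[OF intZ excess, of k] show ?thesis
        unfolding c by simp
    qed
    then show "\<exists>N. \<forall>n\<ge>N. \<bar>(\<integral>\<omega>\<in>C. Z \<omega> \<partial>P) - c\<bar>
        \<le> 2 * \<rho> k + \<bar>(\<integral>\<omega>\<in>C. cl k (Z \<omega>) \<partial>P) - (\<integral>\<omega>\<in>C. cl k (Zn n \<omega>) \<partial>P)\<bar>" by blast
  qed
  moreover have "(\<lambda>k. 2 * \<rho> k) \<longlonglongrightarrow> 0"
    using tendsto_mult_right_zero[OF excess_LIMSEQ_0[OF Y]] unfolding \<rho>_def .
  ultimately have "\<bar>(\<integral>\<omega>\<in>C. Z \<omega> \<partial>P) - c\<bar> \<le> 0"
    by (intro LIMSEQ_le_const[where X="\<lambda>k. 2 * \<rho> k"]) auto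
  then show "(\<integral>\<omega>\<in>C. Z \<omega> \<partial>P) = (\<integral>\<omega>\<in>C. Y \<omega> \<partial>P)" unfolding c_def by simp
qed fact

text \<open>On the piece \<open>Q k\<close> the sampling time is the constant \<open>v k\<close>,
  and the piece is known at that time, so the martingale property between \<open>v k\<close> and
  \<open>t\<close> applies piece by piece, to the excesses as well as to the integrals over
  \<open>C\<close>.\<close>

lemma sampled_finitely_valued:
  fixes q :: "'a \<Rightarrow> nat"
  assumes N: "martingale_process P F N"
    and q: "\<And>\<omega>. \<omega> \<in> space P \<Longrightarrow> q \<omega> \<le> m"
    and level: "\<And>k. k \<le> m \<Longrightarrow> {\<omega>\<in>space P. q \<omega> = k} \<in> sets (F (v k))"
    and v: "\<And>k. k \<le> m \<Longrightarrow> 0 \<le> v k \<and> v k \<le> t"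
  shows "sampled (N t) (\<lambda>\<omega>. N (v (q \<omega>)) \<omega>)"
proof -
  define Q where "Q k = {\<omega>\<in>space P. q \<omega> = k}" for k
  have Q: "Q k \<in> sets (F (v k))" if "k \<le> m" for k using level that unfolding Q_def by blast
  have QP: "Q k \<in> sets P" if "k \<le> m" for k using sets_F_subset Q v that by blast
  have int: "integrable P (N s)" if "0 \<le> s" for s using N that unfolding martingale_process_def by auto
  have [measurable]: "N s \<in> borel_measurable P" if "0 \<le> s" for s using int[OF that] by auto
  have "0 \<le> t" using v[of 0] by simp
  note [measurable] = \<open>\<And>s. 0 \<le> s \<Longrightarrow> N s \<in> borel_measurable P\<close>[OF this]
  have decomp: "N (v (q \<omega>)) \<omega> = (\<Sum>k\<le>m. indicator (Q k) \<omega> * N (v k) \<omega>)"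
    and one: "(\<Sum>k\<le>m. indicator (Q k) \<omega> :: real) = 1"
    if \<omega>: "\<omega> \<in> space P" for \<omega>
  proof -
    have "(\<Sum>k\<le>m. indicator (Q k) \<omega> * N (v k) \<omega>) = (\<Sum>k\<le>m. if k = q \<omega> then N (v k) \<omega> else 0)"
      using \<omega> by (intro sum.cong) (auto simp: Q_def indicator_def)
    then show "N (v (q \<omega>)) \<omega> = (\<Sum>k\<le>m. indicator (Q k) \<omega> * N (v k) \<omega>)"
      using q[OF \<omega>] by simp
    have "(\<Sum>k\<le>m. indicator (Q k) \<omega> :: real) = (\<Sum>k\<le>m. if k = q \<omega> then 1 else 0)"
      using \<omega> by (intro sum.cong) (auto simp: Q_def indicator_def)
    then show "(\<Sum>k\<le>m. indicator (Q k) \<omega> :: real) = 1"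
      using q[OF \<omega>] by simp
  qed
  show ?thesis
    unfolding sampled_def
  proof (intro conjI allI impI ballI)
    have "(\<lambda>\<omega>. \<Sum>k\<le>m. indicator (Q k) \<omega> * N (v k) \<omega>) \<in> borel_measurable P"
      using v QP int by (intro borel_measurable_sum borel_measurable_times borel_measurable_indicator) auto
    then show "(\<lambda>\<omega>. N (v (q \<omega>)) \<omega>) \<in> borel_measurable P"
      by (rule measurable_cong[THEN iffD1, rotated]) (simp add: decomp)
  next
    fix K :: real assume K: "0 \<le> K"
    have sum_split: "(\<Sum>k\<le>m. ennreal (\<bar>f k\<bar> - K) * indicator (Q k) \<omega>) = ennreal (\<bar>f (q \<omega>)\<bar> - K)"
      if \<omega>: "\<omega> \<in> space P" for \<omega> and f :: "nat \<Rightarrow> real"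
    proof -
      have "(\<Sum>k\<le>m. ennreal (\<bar>f k\<bar> - K) * indicator (Q k) \<omega>)
          = (\<Sum>k\<le>m. if k = q \<omega> then ennreal (\<bar>f k\<bar> - K) else 0)"
        using \<omega> by (intro sum.cong) (auto simp: Q_def indicator_def)
      then show ?thesis using q[OF \<omega>] by simp
    qed
    have "(\<integral>\<^sup>+\<omega>. ennreal (\<bar>N (v (q \<omega>)) \<omega>\<bar> - K) \<partial>P)
        = (\<integral>\<^sup>+\<omega>. (\<Sum>k\<le>m. ennreal (\<bar>N (v k) \<omega>\<bar> - K) * indicator (Q k) \<omega>) \<partial>P)"
      by (intro nn_integral_cong sum_split[symmetric])
    also have "\<dots> = (\<Sum>k\<le>m. \<integral>\<^sup>+\<omega>\<in>Q k. ennreal (\<bar>N (v k) \<omega>\<bar> - K) \<partial>P)"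
      using v QP int by (intro nn_integral_sum) auto
    also have "\<dots> \<le> (\<Sum>k\<le>m. \<integral>\<^sup>+\<omega>\<in>Q k. ennreal (\<bar>N t \<omega>\<bar> - K) \<partial>P)"
      using v Q K by (intro sum_mono martingale_excess_mono[OF N]) auto
    also have "\<dots> = (\<integral>\<^sup>+\<omega>. (\<Sum>k\<le>m. ennreal (\<bar>N t \<omega>\<bar> - K) * indicator (Q k) \<omega>) \<partial>P)"
      using QP by (intro nn_integral_sum[symmetric]) auto
    also have "\<dots> = (\<integral>\<^sup>+\<omega>. ennreal (\<bar>N t \<omega>\<bar> - K) \<partial>P)"
      by (intro nn_integral_cong sum_split)
    finally show "(\<integral>\<^sup>+\<omega>. ennreal (\<bar>N (v (q \<omega>)) \<omega>\<bar> - K) \<partial>P) \<le> (\<integral>\<^sup>+\<omega>. ennreal (\<bar>N t \<omega>\<bar> - K) \<partial>P)" .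
  next
    fix C assume C: "C \<in> sets (F 0)"
    have CQ: "C \<inter> Q k \<in> sets (F (v k))" if "k \<le> m" for k
      using Q[OF that] sets_F_mono[of 0 "v k" C] v[OF that] C by auto
    then have CQP: "C \<inter> Q k \<in> sets P" if "k \<le> m" for k using sets_F_subset v that by blast
    have "(\<integral>\<omega>\<in>C. N (v (q \<omega>)) \<omega> \<partial>P) = (\<integral>\<omega>. (\<Sum>k\<le>m. indicator (C \<inter> Q k) \<omega> * N (v k) \<omega>) \<partial>P)"
      unfolding set_lebesgue_integral_def
      by (intro Bochner_Integration.integral_cong) (auto simp: decomp sum_distrib_left indicator_inter_arith mult.assoc conj_ac)
    also have "\<dots> = (\<Sum>k\<le>m. \<integral>\<omega>\<in>C \<inter> Q k. N (v k) \<omega> \<partial>P)"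
      unfolding set_lebesgue_integral_def using v CQP int
      by (subst Bochner_Integration.integral_sum)
         (auto intro!: integrable_mult_indicator[where 'b=real, simplified])
    also have "\<dots> = (\<Sum>k\<le>m. \<integral>\<omega>\<in>C \<inter> Q k. N t \<omega> \<partial>P)"
      using v CQ by (intro sum.cong martingale_set_integral[OF N]) auto
    also have "\<dots> = (\<integral>\<omega>. (\<Sum>k\<le>m. indicator (C \<inter> Q k) \<omega> * N t \<omega>) \<partial>P)"
      unfolding set_lebesgue_integral_def using v CQP int \<open>0 \<le> t\<close>
      by (subst Bochner_Integration.integral_sum)
         (auto intro!: integrable_mult_indicator[where 'b=real, simplified])
    also have "\<dots> = (\<integral>\<omega>\<in>C. N t \<omega> \<partial>P)"
      unfolding set_lebesgue_integral_def
      by (intro Bochner_Integration.integral_cong)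
         (auto simp: indicator_inter_arith mult.assoc sum_distrib_left[symmetric] sum_distrib_right[symmetric] one)
    finally show "(\<integral>\<omega>\<in>C. N (v (q \<omega>)) \<omega> \<partial>P) = (\<integral>\<omega>\<in>C. N t \<omega> \<partial>P)" .
  qed
qed

end

section \<open>Optional times and foreseeable sets\<close>

context usual_filtered_prob_space
begin

text \<open>Real-valued stopping times in strict form; by right-continuity of the filtration this is
  the usual notion. The strict form is what first entrances into open sets and the rounding by
  \<open>grid_up\<close> provide and consume.\<close>

definition opt_time :: "('a \<Rightarrow> real) \<Rightarrow> bool" where
  "opt_time T \<longleftrightarrow> (\<forall>\<omega>\<in>space P. 0 \<le> T \<omega>) \<and> (\<forall>s>0. {\<omega>\<in>space P. T \<omega> < s} \<in> sets (F s))"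

lemma opt_time_nonneg: "opt_time T \<Longrightarrow> \<omega> \<in> space P \<Longrightarrow> 0 \<le> T \<omega>"
  unfolding opt_time_def by blast

lemma opt_time_measurable:
  assumes "opt_time T"
  shows "T \<in> borel_measurable P"
  unfolding borel_measurable_iff_less
proof
  fix s
  show "{\<omega> \<in> space P. T \<omega> < s} \<in> sets P"
  proof (cases "0 < s")
    case True
    then have "{\<omega> \<in> space P. T \<omega> < s} \<in> sets (F s)" using assms unfolding opt_time_def by blast
    then show ?thesis by (rule sets_F_subset[OF less_imp_le[OF True]])
  next
    case False
    then have "{\<omega> \<in> space P. T \<omega> < s} = {}" using opt_time_nonneg[OF assms] by force
    then show ?thesis by (simp only: sets.empty_sets)
  qed
qed

lemma opt_time_min:
  assumes "opt_time S" "opt_time T"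
  shows "opt_time (\<lambda>\<omega>. min (S \<omega>) (T \<omega>))"
proof -
  have "{\<omega> \<in> space P. min (S \<omega>) (T \<omega>) < s} = {\<omega> \<in> space P. S \<omega> < s} \<union> {\<omega> \<in> space P. T \<omega> < s}" for s
    by auto
  then show ?thesis using assms unfolding opt_time_def by auto
qed

text \<open>Optional stopping by rounding \<open>T\<close> up to finitely many mesh points and
  letting the mesh shrink. Rounding moves the time by at most 1, which is why the dominating
  variable is taken at \<open>t + 1\<close>.\<close>

lemma sampled_opt_time:
  assumes N: "martingale_process P F N" and cadlag: "cadlag_process P N"
    and T: "opt_time T" and Tt: "\<And>\<omega>. \<omega> \<in> space P \<Longrightarrow> T \<omega> \<le> t" and "0 \<le> t"
  shows "sampled (N (t + 1)) (\<lambda>\<omega>. N (T \<omega>) \<omega>)"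
proof (rule sampled_limit)
  have meas: "N s \<in> borel_measurable P" if "0 \<le> s" for s
    using N adapted_measurable that unfolding martingale_process_def by blast
  show "integrable P (N (t + 1))" using N \<open>0 \<le> t\<close> unfolding martingale_process_def by simp
  show "(\<lambda>\<omega>. N (T \<omega>) \<omega>) \<in> borel_measurable P"
    by (rule cadlag_at_time_measurable[OF meas cadlag opt_time_measurable[OF T] opt_time_nonneg[OF T]])
  show "AE \<omega> in P. (\<lambda>n. N (grid_up n (T \<omega>)) \<omega>) \<longlonglongrightarrow> N (T \<omega>) \<omega>"
    using opt_time_nonneg[OF T]
    by (intro AE_I2 LIMSEQ_from_right[OF cadlag_tendsto_right[OF cadlag]] grid_up_bounds grid_up_LIMSEQ) auto
  fix n
  let ?c = "real (Suc n)"
  have "sampled (N (t + 1)) (\<lambda>\<omega>. N ((\<lambda>k. (real k + 1) / ?c) (nat \<lfloor>T \<omega> * ?c\<rfloor>)) \<omega>)"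
  proof (rule sampled_finitely_valued[OF N, where m="nat \<lfloor>t * ?c\<rfloor>"])
    show "nat \<lfloor>T \<omega> * ?c\<rfloor> \<le> nat \<lfloor>t * ?c\<rfloor>" if "\<omega> \<in> space P" for \<omega>
      using Tt[OF that] by (intro nat_mono floor_mono mult_right_mono) auto
  next
    fix k assume "k \<le> nat \<lfloor>t * ?c\<rfloor>"
    then have "(real k + 1) / ?c \<le> grid_up n t"
      unfolding grid_up_def by (intro divide_right_mono) auto
    also have "\<dots> \<le> t + 1 / ?c" by (rule grid_up_bounds) fact
    also have "\<dots> \<le> t + 1" by simp
    finally show "0 \<le> (real k + 1) / ?c \<and> (real k + 1) / ?c \<le> t + 1" by simp
  next
    fix k
    let ?s = "(real k + 1) / ?c" and ?r = "real k / ?c"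
    have lt: "{\<omega>\<in>space P. T \<omega> < ?s} \<in> sets (F ?s)" using T unfolding opt_time_def by simp
    have le: "{\<omega>\<in>space P. T \<omega> < ?r} \<in> sets (F ?s)"
    proof (cases "k = 0")
      case True
      then have "{\<omega>\<in>space P. T \<omega> < ?r} = {}" using opt_time_nonneg[OF T] by force
      then show ?thesis by (simp only: sets.empty_sets)
    next
      case False
      then have "{\<omega>\<in>space P. T \<omega> < ?r} \<in> sets (F ?r)" using T unfolding opt_time_def by simp
      then show ?thesis by (rule sets_F_mono[rotated 2]) (auto simp: divide_right_mono)
    qed
    \<comment> \<open>The rounded time is \<open>?s\<close> exactly if
      \<open>?r \<le> T \<omega> < ?s\<close>, and this is decided at time
      \<open>?s\<close>.\<close>
    have "{\<omega>\<in>space P. nat \<lfloor>T \<omega> * ?c\<rfloor> = k} = {\<omega>\<in>space P. T \<omega> < ?s} - {\<omega>\<in>space P. T \<omega> < ?r}"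
    proof -
      have "nat \<lfloor>T \<omega> * ?c\<rfloor> = k \<longleftrightarrow> T \<omega> < ?s \<and> \<not> T \<omega> < ?r" if \<omega>: "\<omega> \<in> space P" for \<omega>
      proof -
        have "0 \<le> T \<omega> * ?c" using opt_time_nonneg[OF T \<omega>] by simp
        then have "nat \<lfloor>T \<omega> * ?c\<rfloor> = k \<longleftrightarrow> \<lfloor>T \<omega> * ?c\<rfloor> = int k"
          by (metis nat_int zero_le_floor int_nat_eq)
        also have "\<dots> \<longleftrightarrow> real k \<le> T \<omega> * ?c \<and> T \<omega> * ?c < real k + 1"
          by (simp only: floor_eq_iff) simp
        also have "\<dots> \<longleftrightarrow> T \<omega> < ?s \<and> \<not> T \<omega> < ?r"
          by (simp add: pos_less_divide_eq pos_divide_le_eq not_less del: of_nat_Suc) blast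
        finally show ?thesis .
      qed
      then show ?thesis by auto
    qed
    then show "{\<omega>\<in>space P. nat \<lfloor>T \<omega> * ?c\<rfloor> = k} \<in> sets (F ?s)" using lt le by simp
  qed
  then show "sampled (N (t + 1)) (\<lambda>\<omega>. N (grid_up n (T \<omega>)) \<omega>)" unfolding grid_up_def .
qed

text \<open>Unions of finitely many cells \<open>{a..b} \<times> B\<close> whose base \<open>B\<close> is already known a little before
  time \<open>a\<close>: their debuts are foreseeable.\<close>

inductive_set foreseeable :: "(real \<times> 'a) set set" where
  empty: "{} \<in> foreseeable"
| cell: "0 < d \<Longrightarrow> d \<le> a \<Longrightarrow> B \<in> sets (F (a - d)) \<Longrightarrow> {a..b} \<times> B \<in> foreseeable"
| Un: "E \<in> foreseeable \<Longrightarrow> E' \<in> foreseeable \<Longrightarrow> E \<union> E' \<in> foreseeable"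

text \<open>Two cells meet in a cell that starts at the later starting time; the smaller of the two
  leads is a valid lead for it.\<close>

lemma foreseeable_Int:
  assumes "E \<in> foreseeable" "E' \<in> foreseeable"
  shows "E \<inter> E' \<in> foreseeable"
  using assms(1)
proof induction
  case empty
  show ?case by (simp add: foreseeable.empty)
next
  case (Un E1 E2)
  then show ?case by (simp add: Int_Un_distrib2 foreseeable.Un)
next
  case (cell d a B b)
  note E = cell
  from assms(2) show ?case
  proof induction
    case empty
    show ?case by (simp add: foreseeable.empty)
  next
    case (Un E1 E2)
    then show ?case by (simp add: Int_Un_distrib foreseeable.Un)
  next
    case (cell d' a' B' b')
    have "{a..b} \<times> B \<inter> {a'..b'} \<times> B' = {max a a'..min b b'} \<times> (B \<inter> B')" by auto
    moreover have "{max a a'..min b b'} \<times> (B \<inter> B') \<in> foreseeable"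
    proof (rule foreseeable.cell[of "min d d'"])
      have "B \<in> sets (F (max a a' - min d d'))" "B' \<in> sets (F (max a a' - min d d'))"
        by (rule sets_F_mono[OF _ _ E(3)], use E in simp, simp add: max_def min_def)
           (rule sets_F_mono[OF _ _ cell(3)], use cell in simp, simp add: max_def min_def)
      then show "B \<inter> B' \<in> sets (F (max a a' - min d d'))" by blast
    qed (use E cell in auto)
    ultimately show ?case by simp
  qed
qed

lemma foreseeable_INT:
  assumes "\<And>i::nat. E i \<in> foreseeable"
  shows "(\<Inter>i\<le>n. E i) \<in> foreseeable"
proof (induction n)
  case (Suc n)
  then show ?case using foreseeable_Int[OF assms[of "Suc n"]] by (simp add: atMost_Suc)
qed (simp add: assms)

text \<open>Closedness makes debuts attained and keeps limits of debuts inside the set.\<close>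

lemma foreseeable_section_closed:
  assumes "E \<in> foreseeable"
  shows "closed {s. (s, \<omega>) \<in> E}"
  using assms
proof induction
  case (cell d a B b)
  have "{s. (s, \<omega>) \<in> {a..b} \<times> B} = (if \<omega> \<in> B then {a..b} else {})" by auto
  then show ?case by simp
next
  case (Un E E')
  have "{s. (s, \<omega>) \<in> E \<union> E'} = {s. (s, \<omega>) \<in> E} \<union> {s. (s, \<omega>) \<in> E'}" by auto
  then show ?case using Un by (simp add: closed_Un)
qed simp

text \<open>If a cell starting at \<open>a\<close> begins before \<open>s + d\<close> with
  \<open>d \<le> d0\<close>, then \<open>a - d0 \<le> s\<close>, so its base is already known at
  \<open>s\<close>. The clause \<open>d0 \<le> r\<close> ensures that a debut moved forward by the
  lead is still a nonnegative time.\<close>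

lemma foreseeable_lead:
  assumes "E \<in> foreseeable"
  shows "\<exists>d0>0. (\<forall>r \<omega>. (r, \<omega>) \<in> E \<longrightarrow> d0 \<le> r) \<and>
    (\<forall>d s. 0 < d \<longrightarrow> d \<le> d0 \<longrightarrow> 0 < s \<longrightarrow> {\<omega>\<in>space P. \<exists>r<s + d. (r, \<omega>) \<in> E} \<in> sets (F s))"
  using assms
proof induction
  case empty
  show ?case by (intro exI[of _ 1]) simp
next
  case (cell d0 a B b)
  show ?case
  proof (intro exI[of _ d0] conjI allI impI)
    fix d s :: real assume d: "0 < d" "d \<le> d0" "0 < s"
    have B: "B \<subseteq> space P" using cell by (metis diff_ge_0_iff_ge sets.sets_into_space space_F)
    show "{\<omega>\<in>space P. \<exists>r<s + d. (r, \<omega>) \<in> {a..b} \<times> B} \<in> sets (F s)"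
    proof (cases "a \<le> b \<and> a < s + d")
      case True
      then have "{\<omega>\<in>space P. \<exists>r<s + d. (r, \<omega>) \<in> {a..b} \<times> B} = B" using B by force
      moreover have "B \<in> sets (F s)"
        using cell d True by (intro sets_F_mono[of "a - d0" s B]) auto
      ultimately show ?thesis by simp
    next
      case False
      then have "{\<omega>\<in>space P. \<exists>r<s + d. (r, \<omega>) \<in> {a..b} \<times> B} = {}" by auto
      then show ?thesis by (simp only: sets.empty_sets)
    qed
  qed (use cell in auto)
next
  case (Un E E')
  then obtain e e' where
    e: "e > 0" "\<And>r \<omega>. (r, \<omega>) \<in> E \<Longrightarrow> e \<le> r"
      "\<And>d s. 0 < d \<Longrightarrow> d \<le> e \<Longrightarrow> 0 < s \<Longrightarrow> {\<omega>\<in>space P. \<exists>r<s + d. (r, \<omega>) \<in> E} \<in> sets (F s)"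
    and e': "e' > 0" "\<And>r \<omega>. (r, \<omega>) \<in> E' \<Longrightarrow> e' \<le> r"
      "\<And>d s. 0 < d \<Longrightarrow> d \<le> e' \<Longrightarrow> 0 < s \<Longrightarrow> {\<omega>\<in>space P. \<exists>r<s + d. (r, \<omega>) \<in> E'} \<in> sets (F s)"
    by blast
  show ?case
  proof (intro exI[of _ "min e e'"] conjI allI impI)
    fix d s :: real assume d: "0 < d" "d \<le> min e e'" "0 < s"
    have "{\<omega>\<in>space P. \<exists>r<s + d. (r, \<omega>) \<in> E \<union> E'}
        = {\<omega>\<in>space P. \<exists>r<s + d. (r, \<omega>) \<in> E} \<union> {\<omega>\<in>space P. \<exists>r<s + d. (r, \<omega>) \<in> E'}" by auto
    then show "{\<omega>\<in>space P. \<exists>r<s + d. (r, \<omega>) \<in> E \<union> E'} \<in> sets (F s)"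
      using e(3) e'(3) d by simp
  next
    show "0 < min e e'" using e(1) e'(1) by simp
    show "min e e' \<le> r" if "(r, \<omega>) \<in> E \<union> E'" for r \<omega>
      using that e(2) e'(2) by (auto simp: min_le_iff_disj)
  qed
qed

text \<open>The debut of a countable intersection of foreseeable sets is the increasing limit of the debuts
  of the finite intersections, each of which can be anticipated by a small lead time.\<close>

lemma debut_announced:
  assumes E: "\<And>n::nat. E n \<in> foreseeable" and "0 < L"
  obtains S \<sigma> where "\<And>n::nat. opt_time (S n)"
    "\<And>n \<omega>. \<omega> \<in> space P \<Longrightarrow> S n \<omega> < \<sigma> \<omega>" "\<And>\<omega>. \<omega> \<in> space P \<Longrightarrow> (\<lambda>n. S n \<omega>) \<longlonglongrightarrow> \<sigma> \<omega>"
    "\<And>\<omega>. \<omega> \<in> space P \<Longrightarrow> \<sigma> \<omega> \<le> L" "\<And>\<omega>. \<omega> \<in> space P \<Longrightarrow> \<sigma> \<omega> < L \<Longrightarrow> (\<sigma> \<omega>, \<omega>) \<in> (\<Inter>n. E n)"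
    "\<And>\<omega> s. \<omega> \<in> space P \<Longrightarrow> (s, \<omega>) \<in> (\<Inter>n. E n) \<Longrightarrow> \<sigma> \<omega> \<le> s"
proof -
  define G where "G n = (\<Inter>i\<le>n. E i)" for n
  have G: "G n \<in> foreseeable" for n unfolding G_def using E by (rule foreseeable_INT)
  have G_anti: "G n \<subseteq> G m" if "m \<le> n" for m n unfolding G_def using that by auto
  have INT_G: "(\<Inter>n. G n) = (\<Inter>n. E n)" unfolding G_def by auto
  define lead where "lead n d0 \<longleftrightarrow> 0 < d0 \<and> (\<forall>r \<omega>. (r, \<omega>) \<in> G n \<longrightarrow> d0 \<le> r) \<and>
    (\<forall>d s. 0 < d \<longrightarrow> d \<le> d0 \<longrightarrow> 0 < s \<longrightarrow> {\<omega>\<in>space P. \<exists>r<s + d. (r, \<omega>) \<in> G n} \<in> sets (F s))"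
    for n d0
  have "\<forall>n. \<exists>d0. lead n d0" using foreseeable_lead[OF G] unfolding lead_def by blast
  then obtain d0 where lead: "\<And>n. lead n (d0 n)" by metis
  have d0: "\<And>n. 0 < d0 n" "\<And>n r \<omega>. (r, \<omega>) \<in> G n \<Longrightarrow> d0 n \<le> r"
    "\<And>n d s. 0 < d \<Longrightarrow> d \<le> d0 n \<Longrightarrow> 0 < s \<Longrightarrow> {\<omega>\<in>space P. \<exists>r<s + d. (r, \<omega>) \<in> G n} \<in> sets (F s)"
    using lead unfolding lead_def by blast+
  \<comment> \<open>Three requirements: below \<open>d0 n\<close> for measurability, below
    \<open>L\<close> so that \<open>S n\<close> is nonnegative also when the debut is the cutoff
    \<open>L\<close>, and tending to 0 so that \<open>S n\<close> has the same limit as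
    \<open>D n\<close>.\<close>
  define d where "d n = min (min (d0 n) L) (1 / real (Suc n))" for n
  have d: "0 < d n" "d n \<le> d0 n" "d n \<le> L" for n using d0(1)[of n] \<open>0 < L\<close> unfolding d_def by auto
  have d_lim: "d \<longlonglongrightarrow> 0"
  proof (rule tendsto_sandwich[where f="\<lambda>_. 0" and h="\<lambda>n. 1 / real (Suc n)"])
    show "\<forall>\<^sub>F n in sequentially. 0 \<le> d n" using d(1) by (simp add: less_imp_le)
    show "(\<lambda>n. 1 / real (Suc n)) \<longlonglongrightarrow> 0"
      using LIMSEQ_inverse_real_of_nat by (simp add: inverse_eq_divide)
  qed (auto simp: d_def)
  \<comment> \<open>Inserting \<open>L\<close> keeps the section nonempty for paths that never meet
    the set.\<close>
  define sec where "sec n \<omega> = insert L {s. (s, \<omega>) \<in> G n \<and> s \<le> L}" for n \<omega>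
  define D where "D n \<omega> = Inf (sec n \<omega>)" for n \<omega>
  have sec_ge: "d n \<le> s" if s: "s \<in> sec n \<omega>" for n \<omega> s
  proof -
    consider "s = L" | "(s, \<omega>) \<in> G n" using s unfolding sec_def by blast
    then show ?thesis
    proof cases
      case 2
      then show ?thesis using d(2)[of n] d0(2) by force
    qed (simp add: d)
  qed
  have bdd: "bdd_below (sec n \<omega>)" for n \<omega> using sec_ge by (intro bdd_belowI[of _ "d n"]) auto
  have ne: "sec n \<omega> \<noteq> {}" for n \<omega> unfolding sec_def by simp
  have closed: "closed (sec n \<omega>)" for n \<omega>
  proof -
    have "sec n \<omega> = insert L ({s. (s, \<omega>) \<in> G n} \<inter> {..L})" unfolding sec_def by auto
    then show ?thesis using foreseeable_section_closed[OF G] by (simp add: closed_Int)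
  qed
  have D_in: "D n \<omega> \<in> sec n \<omega>" for n \<omega>
    unfolding D_def using ne bdd closed by (rule closed_contains_Inf)
  have D_le: "D n \<omega> \<le> s" if "s \<in> sec n \<omega>" for n \<omega> s
    unfolding D_def using that bdd by (rule cInf_lower)
  have D_L: "D n \<omega> \<le> L" for n \<omega> using D_le unfolding sec_def by blast
  have D_inc: "incseq (\<lambda>n. D n \<omega>)" for \<omega>
  proof (rule incseq_SucI)
    fix n
    have "sec (Suc n) \<omega> \<subseteq> sec n \<omega>" unfolding sec_def using G_anti[of n "Suc n"] by auto
    then show "D n \<omega> \<le> D (Suc n) \<omega>" using D_in D_le by blast
  qed
  have "\<exists>l. (\<lambda>n. D n \<omega>) \<longlonglongrightarrow> l \<and> (\<forall>n. D n \<omega> \<le> l)" for \<omega>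
    using incseq_convergent[OF D_inc, of \<omega> L] D_L by metis
  then obtain \<sigma> where \<sigma>: "\<And>\<omega>. (\<lambda>n. D n \<omega>) \<longlonglongrightarrow> \<sigma> \<omega>" "\<And>n \<omega>. D n \<omega> \<le> \<sigma> \<omega>" by metis
  define S where "S n \<omega> = D n \<omega> - d n" for n \<omega>
  show ?thesis
  proof (rule that[of S \<sigma>])
    show "opt_time (S n)" for n
      unfolding opt_time_def
    proof (intro conjI ballI allI impI)
      show "0 \<le> S n \<omega>" for \<omega> unfolding S_def using sec_ge[OF D_in] by simp
      fix s :: real assume s: "0 < s"
      have "S n \<omega> < s \<longleftrightarrow> L < s + d n \<or> (\<exists>r<s + d n. (r, \<omega>) \<in> G n)" for \<omega>
      proof -
        have "S n \<omega> < s \<longleftrightarrow> D n \<omega> < s + d n" unfolding S_def by auto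
        also have "\<dots> \<longleftrightarrow> (\<exists>r\<in>sec n \<omega>. r < s + d n)" unfolding D_def by (rule cInf_less_iff[OF ne bdd])
        also have "\<dots> \<longleftrightarrow> L < s + d n \<or> (\<exists>r<s + d n. (r, \<omega>) \<in> G n \<and> r \<le> L)"
          unfolding sec_def by auto
        also have "\<dots> \<longleftrightarrow> L < s + d n \<or> (\<exists>r<s + d n. (r, \<omega>) \<in> G n)"
          by (meson le_less_linear less_trans)
        finally show ?thesis .
      qed
      then have "{\<omega>\<in>space P. S n \<omega> < s} =
          (if L < s + d n then space (F s) else {\<omega>\<in>space P. \<exists>r<s + d n. (r, \<omega>) \<in> G n})"
        using space_F s by auto
      then show "{\<omega>\<in>space P. S n \<omega> < s} \<in> sets (F s)"
        using d0(3)[OF d(1) d(2) s] by simp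
    qed
    show "S n \<omega> < \<sigma> \<omega>" for n \<omega> unfolding S_def using \<sigma>(2)[of n \<omega>] d(1)[of n] by linarith
    show "(\<lambda>n. S n \<omega>) \<longlonglongrightarrow> \<sigma> \<omega>" for \<omega>
      unfolding S_def using tendsto_diff[OF \<sigma>(1) d_lim] by simp
    show \<sigma>L: "\<sigma> \<omega> \<le> L" for \<omega> using D_L by (intro LIMSEQ_le_const2[OF \<sigma>(1)]) auto
    show "(\<sigma> \<omega>, \<omega>) \<in> (\<Inter>n. E n)" if "\<sigma> \<omega> < L" for \<omega>
      unfolding INT_G[symmetric]
    proof
      fix m
      have "\<forall>n\<ge>m. D n \<omega> \<in> {s. (s, \<omega>) \<in> G m}"
      proof (intro allI impI)
        fix n assume "m \<le> n"
        have "D n \<omega> < L" using \<sigma>(2)[of n \<omega>] that by linarith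
        then show "D n \<omega> \<in> {s. (s, \<omega>) \<in> G m}"
          using D_in[of n \<omega>] G_anti[OF \<open>m \<le> n\<close>] unfolding sec_def by auto
      qed
      \<comment> \<open>From \<open>m\<close> on all debuts lie in the closed section of
        \<open>G m\<close>, hence so does their limit.\<close>
      then have "\<sigma> \<omega> \<in> {s. (s, \<omega>) \<in> G m}"
        by (intro Lim_in_closed_set[OF foreseeable_section_closed[OF G] _ _ \<sigma>(1)])
           (auto simp: eventually_sequentially)
      then show "(\<sigma> \<omega>, \<omega>) \<in> G m" by simp
    qed
    show "\<sigma> \<omega> \<le> s" if "(s, \<omega>) \<in> (\<Inter>n. E n)" for \<omega> s
    proof (cases "s \<le> L")
      case True
      then have "s \<in> sec n \<omega>" for n using that unfolding INT_G[symmetric] sec_def by auto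
      then show ?thesis using D_le by (intro LIMSEQ_le_const2[OF \<sigma>(1)]) auto
    next
      case False
      then show ?thesis using \<sigma>L[of \<omega>] by linarith
    qed
  qed
qed

end

section \<open>Predictable times\<close>

context usual_filtered_prob_space
begin

text \<open>The approximating set is inside \<open>B\<close> everywhere, but has to catch
  \<open>B\<close> only along the graph of \<sigma>, outside the exceptional event
  \<open>N\<close>.\<close>

definition approx_within ::
    "('a \<Rightarrow> real) \<Rightarrow> (real \<times> 'a) set \<Rightarrow> real \<Rightarrow> (nat \<Rightarrow> (real \<times> 'a) set) \<Rightarrow> 'a set \<Rightarrow> bool" where
  "approx_within \<sigma> B e E N \<longleftrightarrow> range E \<subseteq> foreseeable \<and> (\<Inter>n. E n) \<subseteq> B \<and> N \<in> sets P \<and> prob N \<le> e \<and>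
     (\<forall>\<omega>\<in>space P - N. (\<sigma> \<omega>, \<omega>) \<in> B \<longrightarrow> (\<sigma> \<omega>, \<omega>) \<in> (\<Inter>n. E n))"

text \<open>Inner regularity of \<open>B\<close> for the image of \<open>P\<close> under the graph
  map of \<sigma>, the regular sets being countable intersections of foreseeable sets. It serves as
  a substitute for a section theorem.\<close>

definition inner_approx :: "('a \<Rightarrow> real) \<Rightarrow> (real \<times> 'a) set \<Rightarrow> bool" where
  "inner_approx \<sigma> B \<longleftrightarrow> {\<omega>\<in>space P. (\<sigma> \<omega>, \<omega>) \<in> B} \<in> sets P \<and> (\<forall>e>0. \<exists>E N. approx_within \<sigma> B e E N)"

lemma inner_approxD:
  assumes "inner_approx \<sigma> B" "0 < e"
  obtains E :: "nat \<Rightarrow> (real \<times> 'a) set" and N where "range E \<subseteq> foreseeable" "(\<Inter>n. E n) \<subseteq> B" "N \<in> sets P" "prob N \<le> e"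
    "\<And>\<omega>. \<omega> \<in> space P \<Longrightarrow> \<omega> \<notin> N \<Longrightarrow> (\<sigma> \<omega>, \<omega>) \<in> B \<Longrightarrow> (\<sigma> \<omega>, \<omega>) \<in> (\<Inter>n. E n)"
proof -
  obtain E N where "approx_within \<sigma> B e E N" using assms unfolding inner_approx_def by blast
  then show thesis unfolding approx_within_def by (elim conjE) (rule that[of E N], assumption+, blast)
qed

lemma inner_approx_foreseeable:
  assumes "{\<omega>\<in>space P. (\<sigma> \<omega>, \<omega>) \<in> B} \<in> sets P" "B \<in> foreseeable"
  shows "inner_approx \<sigma> B"
  unfolding inner_approx_def
proof (intro conjI allI impI)
  fix e :: real assume "0 < e"
  with assms(2) show "\<exists>E N. approx_within \<sigma> B e E N"
    unfolding approx_within_def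
    by (intro exI[of _ "\<lambda>_. B"] exI[of _ "{}"]) auto
qed fact

lemma inner_approx_missed:
  assumes "\<And>\<omega>. \<omega> \<in> space P \<Longrightarrow> (\<sigma> \<omega>, \<omega>) \<notin> B"
  shows "inner_approx \<sigma> B"
  unfolding inner_approx_def
proof (intro conjI allI impI)
  have "{\<omega>\<in>space P. (\<sigma> \<omega>, \<omega>) \<in> B} = {}" using assms by auto
  then show "{\<omega>\<in>space P. (\<sigma> \<omega>, \<omega>) \<in> B} \<in> sets P" by (simp only: sets.empty_sets)
  fix e :: real assume "0 < e"
  with assms show "\<exists>E N. approx_within \<sigma> B e E N"
    unfolding approx_within_def
    by (intro exI[of _ "\<lambda>_. {}"] exI[of _ "{}"]) (auto simp: foreseeable.empty)
qed

text \<open>A union of two countable intersections is the intersection of all pairwise unions, which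
  \<open>prod_decode\<close> enumerates. Each part gets half of the error.\<close>

lemma inner_approx_Un:
  assumes "inner_approx \<sigma> B" "inner_approx \<sigma> B'"
  shows "inner_approx \<sigma> (B \<union> B')"
  unfolding inner_approx_def
proof (intro conjI allI impI)
  have "{\<omega>\<in>space P. (\<sigma> \<omega>, \<omega>) \<in> B \<union> B'}
      = {\<omega>\<in>space P. (\<sigma> \<omega>, \<omega>) \<in> B} \<union> {\<omega>\<in>space P. (\<sigma> \<omega>, \<omega>) \<in> B'}" by auto
  moreover have "{\<omega>\<in>space P. (\<sigma> \<omega>, \<omega>) \<in> B} \<in> sets P" "{\<omega>\<in>space P. (\<sigma> \<omega>, \<omega>) \<in> B'} \<in> sets P"
    using assms unfolding inner_approx_def by blast+
  ultimately show "{\<omega>\<in>space P. (\<sigma> \<omega>, \<omega>) \<in> B \<union> B'} \<in> sets P" by simp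
  fix e :: real assume "0 < e"
  then have "0 < e / 2" by simp
  obtain E N where E: "range E \<subseteq> foreseeable" "(\<Inter>n::nat. E n) \<subseteq> B" "N \<in> sets P" "prob N \<le> e / 2"
    "\<And>\<omega>. \<omega> \<in> space P \<Longrightarrow> \<omega> \<notin> N \<Longrightarrow> (\<sigma> \<omega>, \<omega>) \<in> B \<Longrightarrow> (\<sigma> \<omega>, \<omega>) \<in> (\<Inter>n. E n)"
    using inner_approxD[OF assms(1) \<open>0 < e / 2\<close>] by metis
  obtain E' N' where E': "range E' \<subseteq> foreseeable" "(\<Inter>n::nat. E' n) \<subseteq> B'" "N' \<in> sets P" "prob N' \<le> e / 2"
    "\<And>\<omega>. \<omega> \<in> space P \<Longrightarrow> \<omega> \<notin> N' \<Longrightarrow> (\<sigma> \<omega>, \<omega>) \<in> B' \<Longrightarrow> (\<sigma> \<omega>, \<omega>) \<in> (\<Inter>n. E' n)"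
    using inner_approxD[OF assms(2) \<open>0 < e / 2\<close>] by metis
  define K where "K k = E (fst (prod_decode k)) \<union> E' (snd (prod_decode k))" for k
  have K: "(\<Inter>k. K k) = (\<Inter>n. E n) \<union> (\<Inter>n. E' n)"
  proof (intro set_eqI iffI)
    fix p assume p: "p \<in> (\<Inter>k. K k)"
    have "p \<in> E n \<union> E' m" for n m
    proof -
      have "p \<in> K (prod_encode (n, m))" using p by blast
      then show ?thesis by (simp add: K_def)
    qed
    then show "p \<in> (\<Inter>n. E n) \<union> (\<Inter>n. E' n)" by blast
  qed (auto simp: K_def)
  have "prob (N \<union> N') \<le> prob N + prob N'"
    using E E' by (intro measure_Un_le) auto
  then have "prob (N \<union> N') \<le> e" using E E' by simp
  moreover have "range K \<subseteq> foreseeable" unfolding K_def using E(1) E'(1) by (auto intro!: foreseeable.Un)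
  moreover have "(\<Inter>k. K k) \<subseteq> B \<union> B'" unfolding K using E(2) E'(2) by blast
  moreover have "\<forall>\<omega>\<in>space P - (N \<union> N'). (\<sigma> \<omega>, \<omega>) \<in> B \<union> B' \<longrightarrow> (\<sigma> \<omega>, \<omega>) \<in> (\<Inter>k. K k)"
    unfolding K using E(5) E'(5) by blast
  ultimately show "\<exists>E N. approx_within \<sigma> (B \<union> B') e E N"
    unfolding approx_within_def
    using E(3) E'(3) by (intro exI[of _ K] exI[of _ "N \<union> N'"]) simp
qed

text \<open>By continuity from below a single \<open>B n\<close> already catches the graph up to
  \<open>e / 2\<close>; the other half pays for approximating that one.\<close>

lemma inner_approx_incseq_UN:
  assumes B: "\<And>n::nat. inner_approx \<sigma> (B n)" and inc: "incseq B"
  shows "inner_approx \<sigma> (\<Union>n. B n)"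
  unfolding inner_approx_def
proof (intro conjI allI impI)
  define W where "W n = {\<omega>\<in>space P. (\<sigma> \<omega>, \<omega>) \<in> B n}" for n
  have W: "W n \<in> sets P" for n using B unfolding inner_approx_def W_def by blast
  have UN_W: "{\<omega>\<in>space P. (\<sigma> \<omega>, \<omega>) \<in> (\<Union>n. B n)} = (\<Union>n. W n)" unfolding W_def by auto
  then show "{\<omega>\<in>space P. (\<sigma> \<omega>, \<omega>) \<in> (\<Union>n. B n)} \<in> sets P" using W by auto
  fix e :: real assume "0 < e"
  then have "0 < e / 2" by simp
  have "incseq W" using inc unfolding W_def incseq_def by blast
  then have "(\<lambda>n. prob (W n)) \<longlonglongrightarrow> prob (\<Union>n. W n)"
    using W by (intro finite_Lim_measure_incseq) auto
  then have "\<forall>\<^sub>F n in sequentially. prob (\<Union>n. W n) - e / 2 < prob (W n)"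
    using \<open>0 < e\<close> by (intro order_tendstoD) auto
  then obtain n where n: "prob (\<Union>n. W n) - e / 2 < prob (W n)"
    by (auto simp: eventually_sequentially)
  obtain E N where E: "range E \<subseteq> foreseeable" "(\<Inter>n::nat. E n) \<subseteq> B n" "N \<in> sets P" "prob N \<le> e / 2"
    "\<And>\<omega>. \<omega> \<in> space P \<Longrightarrow> \<omega> \<notin> N \<Longrightarrow> (\<sigma> \<omega>, \<omega>) \<in> B n \<Longrightarrow> (\<sigma> \<omega>, \<omega>) \<in> (\<Inter>n. E n)"
    using inner_approxD[OF B \<open>0 < e / 2\<close>] by metis
  define N' where "N' = N \<union> ((\<Union>n. W n) - W n)"
  have "prob ((\<Union>n. W n) - W n) = prob (\<Union>n. W n) - prob (W n)"
    using W by (intro finite_measure_Diff) auto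
  moreover have "prob N' \<le> prob N + prob ((\<Union>n. W n) - W n)"
    unfolding N'_def using E W by (intro measure_Un_le) auto
  ultimately have "prob N' \<le> e" using E n by simp
  moreover have "N' \<in> sets P" unfolding N'_def using E W by auto
  moreover have "(\<Inter>n. E n) \<subseteq> (\<Union>n. B n)" using E(2) by blast
  moreover have "\<forall>\<omega>\<in>space P - N'. (\<sigma> \<omega>, \<omega>) \<in> (\<Union>n. B n) \<longrightarrow> (\<sigma> \<omega>, \<omega>) \<in> (\<Inter>n. E n)"
    using E(5) unfolding N'_def W_def by blast
  ultimately show "\<exists>E N. approx_within \<sigma> (\<Union>n. B n) e E N"
    unfolding approx_within_def
    using E(1) by (intro exI[of _ E] exI[of _ N']) blast
qed

lemma inner_approx_UN:
  assumes B: "\<And>n::nat. inner_approx \<sigma> (B n)"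
  shows "inner_approx \<sigma> (\<Union>n. B n)"
proof -
  have "inner_approx \<sigma> (\<Union>i\<le>n. B i)" for n
  proof (induction n)
    case (Suc n)
    then show ?case using inner_approx_Un[OF B[of "Suc n"]] by (simp add: atMost_Suc)
  qed (simp add: B)
  then have "inner_approx \<sigma> (\<Union>n. \<Union>i\<le>n. B i)"
    by (rule inner_approx_incseq_UN) (auto simp: incseq_def intro: order_trans)
  moreover have "(\<Union>n. \<Union>i\<le>n. B i) = (\<Union>n. B n)" by auto
  ultimately show ?thesis by simp
qed

text \<open>The approximating families are merged into one sequence, and the error of the n-th set
  is \<open>e\<close> times the n-th term of the series 1/2 + 1/4 + ... = 1.\<close>

lemma inner_approx_INT:
  assumes B: "\<And>n::nat. inner_approx \<sigma> (B n)"
  shows "inner_approx \<sigma> (\<Inter>n. B n)"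
  unfolding inner_approx_def
proof (intro conjI allI impI)
  have "{\<omega>\<in>space P. (\<sigma> \<omega>, \<omega>) \<in> (\<Inter>n. B n)} = (\<Inter>n. {\<omega>\<in>space P. (\<sigma> \<omega>, \<omega>) \<in> B n})" by auto
  moreover have "{\<omega>\<in>space P. (\<sigma> \<omega>, \<omega>) \<in> B n} \<in> sets P" for n
    using B unfolding inner_approx_def by blast
  ultimately show "{\<omega>\<in>space P. (\<sigma> \<omega>, \<omega>) \<in> (\<Inter>n. B n)} \<in> sets P" by auto
  fix e :: real assume "0 < e"
  have "\<exists>E N. approx_within \<sigma> (B n) (e * (1 / 2) ^ Suc n) E N" for n
  proof -
    have "0 < e * (1 / 2) ^ Suc n" using \<open>0 < e\<close> by simp
    then show ?thesis using B[of n] unfolding inner_approx_def by blast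
  qed
  then obtain E N where "approx_within \<sigma> (B n) (e * (1 / 2) ^ Suc n) (E n) (N n)" for n by metis
  then have E: "\<And>n. range (E n) \<subseteq> foreseeable" "\<And>n. (\<Inter>k. E n k) \<subseteq> B n"
    "\<And>n. N n \<in> sets P" "\<And>n. prob (N n) \<le> e * (1 / 2) ^ Suc n"
    "\<And>n. \<forall>\<omega>\<in>space P - N n. (\<sigma> \<omega>, \<omega>) \<in> B n \<longrightarrow> (\<sigma> \<omega>, \<omega>) \<in> (\<Inter>k. E n k)"
    unfolding approx_within_def by blast+
  define K where "K k = E (fst (prod_decode k)) (snd (prod_decode k))" for k
  have K: "(\<Inter>k. K k) = (\<Inter>n. \<Inter>k. E n k)"
  proof (intro set_eqI iffI)
    fix p assume p: "p \<in> (\<Inter>k. K k)"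
    have "p \<in> E n m" for n m
    proof -
      have "p \<in> K (prod_encode (n, m))" using p by blast
      then show ?thesis by (simp add: K_def)
    qed
    then show "p \<in> (\<Inter>n. \<Inter>k. E n k)" by blast
  qed (auto simp: K_def)
  have sums: "(\<lambda>n. e * (1 / 2) ^ Suc n) sums (e * 1)"
    by (intro sums_mult power_half_series)
  have summable: "summable (\<lambda>n. prob (N n))"
    using E(4) by (intro summable_comparison_test'[OF sums_summable[OF sums]])
      (simp only: real_norm_def abs_of_nonneg[OF measure_nonneg])
  then have "prob (\<Union>n. N n) \<le> (\<Sum>n. prob (N n))"
    using E(3) by (intro finite_measure_subadditive_countably) auto
  also have "\<dots> \<le> (\<Sum>n. e * (1 / 2) ^ Suc n)"
    using E(4) summable sums_summable[OF sums] by (rule suminf_le)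
  also have "\<dots> = e" using sums_unique[OF sums] by simp
  finally have "prob (\<Union>n. N n) \<le> e" .
  moreover have "(\<Union>n. N n) \<in> sets P" using E(3) by auto
  moreover have "range K \<subseteq> foreseeable" using E(1) unfolding K_def by blast
  moreover have "(\<Inter>k. K k) \<subseteq> (\<Inter>n. B n)" unfolding K using E(2) by blast
  moreover have "\<forall>\<omega>\<in>space P - (\<Union>n. N n). (\<sigma> \<omega>, \<omega>) \<in> (\<Inter>n. B n) \<longrightarrow> (\<sigma> \<omega>, \<omega>) \<in> (\<Inter>k. K k)"
    unfolding K using E(5) by blast
  ultimately show "\<exists>E N. approx_within \<sigma> (\<Inter>n. B n) e E N"
    unfolding approx_within_def
    by (intro exI[of _ K] exI[of _ "\<Union>n. N n"]) blast
qed

text \<open>A half-open cell is the union of the closed cells starting 1/(n+1) later, and the delay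
  is their lead.\<close>

lemma inner_approx_cell:
  assumes [measurable]: "\<sigma> \<in> borel_measurable P" and "0 \<le> s" and B: "B \<in> sets (F s)"
  shows "inner_approx \<sigma> ({s<..t} \<times> B)"
proof -
  have [measurable]: "B \<in> sets P" using B sets_F_subset \<open>0 \<le> s\<close> by blast
  have "inner_approx \<sigma> (\<Union>n. {s + 1 / real (Suc n)..t} \<times> B)"
  proof (rule inner_approx_UN)
    fix n
    show "inner_approx \<sigma> ({s + 1 / real (Suc n)..t} \<times> B)"
    proof (rule inner_approx_foreseeable)
      have "{\<omega>\<in>space P. (\<sigma> \<omega>, \<omega>) \<in> {s + 1 / real (Suc n)..t} \<times> B}
          = {\<omega>\<in>space P. s + 1 / real (Suc n) \<le> \<sigma> \<omega> \<and> \<sigma> \<omega> \<le> t \<and> \<omega> \<in> B}" by auto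
      also have "\<dots> \<in> sets P" by measurable
      finally show "{\<omega>\<in>space P. (\<sigma> \<omega>, \<omega>) \<in> {s + 1 / real (Suc n)..t} \<times> B} \<in> sets P" .
      show "{s + 1 / real (Suc n)..t} \<times> B \<in> foreseeable"
        using \<open>0 \<le> s\<close> B by (intro foreseeable.cell[of "1 / real (Suc n)"]) auto
    qed
  qed
  moreover have "(\<Union>n. {s + 1 / real (Suc n)..t} \<times> B) = {s<..t} \<times> B"
  proof (intro set_eqI iffI)
    fix p assume p: "p \<in> {s<..t} \<times> B"
    then have "s < fst p" by auto
    then obtain n where "inverse (real (Suc n)) < fst p - s" using reals_Archimedean[of "fst p - s"] by auto
    then have "s + 1 / real (Suc n) \<le> fst p" by (simp add: inverse_eq_divide)
    then show "p \<in> (\<Union>n. {s + 1 / real (Suc n)..t} \<times> B)" using p by (intro UN_I[of n]) auto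
  next
    fix p assume "p \<in> (\<Union>n. {s + 1 / real (Suc n)..t} \<times> B)"
    then obtain n where n: "p \<in> {s + 1 / real (Suc n)..t} \<times> B" by blast
    have "0 < 1 / real (Suc n)" by simp
    moreover have "s + 1 / real (Suc n) \<le> fst p" using n by auto
    ultimately have "s < fst p" by linarith
    with n show "p \<in> {s<..t} \<times> B" by auto
  qed
  ultimately show ?thesis by simp
qed

lemma predictable_generators_subset:
  "{{0} \<times> B | B. B \<in> sets (F 0)} \<union> {{s<..t} \<times> B | s t B. 0 \<le> s \<and> s \<le> t \<and> B \<in> sets (F s)}
    \<subseteq> Pow ({0..} \<times> space P)"
proof -
  have "B \<subseteq> space P" if "0 \<le> s" "B \<in> sets (F s)" for s B
    using that sets.sets_into_space space_F by metis
  then show ?thesis by fastforce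
qed

lemma sets_predictable_sigma:
  "sets (predictable_sigma P F) = sigma_sets ({0..} \<times> space P)
     ({{0} \<times> B | B. B \<in> sets (F 0)} \<union> {{s<..t} \<times> B | s t B. 0 \<le> s \<and> s \<le> t \<and> B \<in> sets (F s)})"
  unfolding predictable_sigma_def
  using predictable_generators_subset by (rule sets_measure_of)

lemma space_predictable_sigma: "space (predictable_sigma P F) = {0..} \<times> space P"
  unfolding predictable_sigma_def by (simp add: space_measure_of_conv)

text \<open>The approximable sets have no evident closure under complements, so the induction over
  the \<sigma>-algebra carries \<open>D\<close> together with its complement; unions of one turn
  into intersections of the other. Since \<sigma> is positive, slices at time 0 are missed by the
  graph and cost nothing.\<close>

lemma predictable_inner_approx:
  assumes \<sigma>[measurable]: "\<sigma> \<in> borel_measurable P" and pos: "\<And>\<omega>. \<omega> \<in> space P \<Longrightarrow> 0 < \<sigma> \<omega>"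
    and D: "D \<in> sets (predictable_sigma P F)"
  shows "inner_approx \<sigma> D"
proof -
  have top: "space P \<in> sets (F s)" if "0 \<le> s" for s using sets.top[of "F s"] space_F[OF that] by simp
  have zero: "inner_approx \<sigma> ({0} \<times> B)" for B by (rule inner_approx_missed) (use pos in force)
  have ray: "inner_approx \<sigma> ({s<..} \<times> space P)" if "0 \<le> s" for s
  proof -
    have "inner_approx \<sigma> (\<Union>n::nat. {s<..real n} \<times> space P)"
      by (intro inner_approx_UN inner_approx_cell \<sigma> that top)
    moreover have "(\<Union>n::nat. {s<..real n} \<times> space P) = {s<..} \<times> space P"
      using real_arch_simple by fastforce
    ultimately show ?thesis by simp
  qed
  have "inner_approx \<sigma> D \<and> inner_approx \<sigma> ({0..} \<times> space P - D)"
    using D unfolding sets_predictable_sigma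
  proof induction
    case (Basic D)
    then consider B where "D = {0} \<times> B" "B \<in> sets (F 0)"
      | s t B where "D = {s<..t} \<times> B" "0 \<le> s" "s \<le> t" "B \<in> sets (F s)" by blast
    then show ?case
    proof cases
      case 1
      have "{0..} \<times> space P - D = {0} \<times> (space P - B) \<union> {0<..} \<times> space P" using 1 by auto
      then show ?thesis using 1 zero inner_approx_Un[OF zero ray[OF order_refl]] by simp
    next
      case 2
      have "space P - B \<in> sets (F s)" using 2 top[of s] by auto
      then have "inner_approx \<sigma> (({s<..t} \<times> (space P - B) \<union> {0} \<times> space P) \<union>
          ({0<..s} \<times> space P \<union> {t<..} \<times> space P))"
        using 2 top[of 0]
        by (intro inner_approx_Un zero ray inner_approx_cell \<sigma>) auto
      moreover have "{0..} \<times> space P - D = ({s<..t} \<times> (space P - B) \<union> {0} \<times> space P) \<union>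
          ({0<..s} \<times> space P \<union> {t<..} \<times> space P)" using 2 by auto
      ultimately show ?thesis using 2 inner_approx_cell[OF \<sigma>] by simp
    qed
  next
    case Empty
    have "{0::real..} \<times> space P = {0} \<times> space P \<union> {0<..} \<times> space P" by auto
    then show ?case
      using inner_approx_Un[OF zero ray[OF order_refl], of "space P"] by (simp add: inner_approx_missed)
  next
    case (Compl D)
    have "D \<subseteq> {0..} \<times> space P"
      using Compl(1) sets.sets_into_space[of D "predictable_sigma P F"]
      unfolding sets_predictable_sigma space_predictable_sigma by blast
    then have "{0..} \<times> space P - ({0..} \<times> space P - D) = D" by blast
    then show ?case using Compl by simp
  next
    case (Union D)
    have eq: "{0..} \<times> space P - (\<Union>i. D i) = (\<Inter>i. {0..} \<times> space P - D i)" by auto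
    show ?case
      unfolding eq using Union(2) inner_approx_UN[of \<sigma> D] inner_approx_INT[of \<sigma> "\<lambda>i. {0..} \<times> space P - D i"]
      by blast
  qed
  then show ?thesis ..
qed

text \<open>The debut \<sigma>' of an inner approximation of \<open>D\<close> is announced and never
  earlier than \<sigma>, the approximation being smaller than \<open>D\<close>. Outside
  \<open>N\<close> the approximation contains the graph point of \<sigma>, so the two agree. Where
  \<sigma> is the cutoff \<open>L\<close>, agreement follows from \<sigma>' being at most
  \<open>L\<close>.\<close>

lemma predictable_debut_announced:
  assumes \<sigma>: "\<sigma> \<in> borel_measurable P" "\<And>\<omega>. \<omega> \<in> space P \<Longrightarrow> 0 < \<sigma> \<omega>" "\<And>\<omega>. \<omega> \<in> space P \<Longrightarrow> \<sigma> \<omega> \<le> L"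
    and D: "D \<in> sets (predictable_sigma P F)"
    and hit: "\<And>\<omega>. \<omega> \<in> space P \<Longrightarrow> \<sigma> \<omega> < L \<Longrightarrow> (\<sigma> \<omega>, \<omega>) \<in> D"
    and first: "\<And>\<omega> s. \<omega> \<in> space P \<Longrightarrow> (s, \<omega>) \<in> D \<Longrightarrow> \<sigma> \<omega> \<le> s"
    and "0 < e"
  obtains S \<sigma>' N where "\<And>n::nat. opt_time (S n)"
    "\<And>n \<omega>. \<omega> \<in> space P \<Longrightarrow> S n \<omega> < \<sigma>' \<omega>" "\<And>\<omega>. \<omega> \<in> space P \<Longrightarrow> (\<lambda>n. S n \<omega>) \<longlonglongrightarrow> \<sigma>' \<omega>"
    "N \<in> sets P" "prob N \<le> e" "\<And>\<omega>. \<omega> \<in> space P \<Longrightarrow> \<omega> \<notin> N \<Longrightarrow> \<sigma>' \<omega> = \<sigma> \<omega>"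
proof -
  obtain E N where E: "range E \<subseteq> foreseeable" "(\<Inter>n::nat. E n) \<subseteq> D" "N \<in> sets P" "prob N \<le> e"
    "\<And>\<omega>. \<omega> \<in> space P \<Longrightarrow> \<omega> \<notin> N \<Longrightarrow> (\<sigma> \<omega>, \<omega>) \<in> D \<Longrightarrow> (\<sigma> \<omega>, \<omega>) \<in> (\<Inter>n. E n)"
    using inner_approxD[OF predictable_inner_approx[OF \<sigma>(1,2) D] \<open>0 < e\<close>] by metis
  obtain \<omega>0 where "\<omega>0 \<in> space P" using not_empty by blast
  then have "0 < L" using \<sigma>(2,3)[of \<omega>0] by linarith
  have "E n \<in> foreseeable" for n using E(1) by blast
  then obtain S \<sigma>' where S: "\<And>n::nat. opt_time (S n)"
    "\<And>n \<omega>. \<omega> \<in> space P \<Longrightarrow> S n \<omega> < \<sigma>' \<omega>" "\<And>\<omega>. \<omega> \<in> space P \<Longrightarrow> (\<lambda>n. S n \<omega>) \<longlonglongrightarrow> \<sigma>' \<omega>"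
    and \<sigma>': "\<And>\<omega>. \<omega> \<in> space P \<Longrightarrow> \<sigma>' \<omega> \<le> L" "\<And>\<omega>. \<omega> \<in> space P \<Longrightarrow> \<sigma>' \<omega> < L \<Longrightarrow> (\<sigma>' \<omega>, \<omega>) \<in> (\<Inter>n. E n)"
    "\<And>\<omega> s. \<omega> \<in> space P \<Longrightarrow> (s, \<omega>) \<in> (\<Inter>n. E n) \<Longrightarrow> \<sigma>' \<omega> \<le> s"
    by (rule debut_announced[where E=E, OF _ \<open>0 < L\<close>]) (rule that)
  have "\<sigma>' \<omega> = \<sigma> \<omega>" if \<omega>: "\<omega> \<in> space P" "\<omega> \<notin> N" for \<omega>
  proof (rule antisym)
    show "\<sigma>' \<omega> \<le> \<sigma> \<omega>"
    proof (cases "\<sigma> \<omega> < L")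
      case True
      then show ?thesis using \<sigma>'(3)[OF \<omega>(1) E(5)[OF \<omega> hit[OF \<omega>(1)]]] by simp
    next
      case False
      then show ?thesis using \<sigma>'(1)[OF \<omega>(1)] by linarith
    qed
    show "\<sigma> \<omega> \<le> \<sigma>' \<omega>"
    proof (cases "\<sigma>' \<omega> < L")
      case True
      then show ?thesis using first[OF \<omega>(1), of "\<sigma>' \<omega>"] \<sigma>'(2)[OF \<omega>(1)] E(2) by blast
    next
      case False
      then show ?thesis using \<sigma>(3)[OF \<omega>(1)] by linarith
    qed
  qed
  then show thesis using that[OF S E(3,4)] by blast
qed

text \<open>The limit of \<open>Y\<close> at the minimum of \<open>T\<close> and \<open>S n\<close>,
  when the times \<open>S n\<close> announce \<sigma>.\<close>

definition value_before :: "(real \<Rightarrow> 'a \<Rightarrow> real) \<Rightarrow> ('a \<Rightarrow> real) \<Rightarrow> ('a \<Rightarrow> real) \<Rightarrow> 'a \<Rightarrow> real" where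
  "value_before Y T \<sigma> \<omega> = (if T \<omega> < \<sigma> \<omega> then Y (T \<omega>) \<omega> else left_limit Y (\<sigma> \<omega>) \<omega>)"

text \<open>If \<open>T < \<sigma>\<close>, the minimum of \<open>T\<close> and \<open>S n\<close>
  is eventually \<open>T\<close>; otherwise it is always \<open>S n\<close>, which approaches
  \<sigma> strictly from the left. So \<open>sampled_limit\<close> applies to optional stopping at
  these minima.\<close>

lemma sampled_before_announced:
  assumes N: "martingale_process P F N" and cadlag: "cadlag_process P N"
    and T: "opt_time T" and Tt: "\<And>\<omega>. \<omega> \<in> space P \<Longrightarrow> T \<omega> \<le> t" and "0 \<le> t"
    and S: "\<And>n::nat. opt_time (S n)" "\<And>n \<omega>. \<omega> \<in> space P \<Longrightarrow> S n \<omega> < \<sigma> \<omega>"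
      "\<And>\<omega>. \<omega> \<in> space P \<Longrightarrow> (\<lambda>n. S n \<omega>) \<longlonglongrightarrow> \<sigma> \<omega>"
  shows "sampled (N (t + 1)) (value_before N T \<sigma>)"
proof (rule sampled_limit[where Zn="\<lambda>n \<omega>. N (min (T \<omega>) (S n \<omega>)) \<omega>"])
  show "integrable P (N (t + 1))" using N \<open>0 \<le> t\<close> unfolding martingale_process_def by simp
  show samp: "sampled (N (t + 1)) (\<lambda>\<omega>. N (min (T \<omega>) (S n \<omega>)) \<omega>)" for n
    using Tt by (intro sampled_opt_time N cadlag opt_time_min T S(1) \<open>0 \<le> t\<close>) (auto simp: min_le_iff_disj)
  have lim: "(\<lambda>n. N (min (T \<omega>) (S n \<omega>)) \<omega>) \<longlonglongrightarrow>
      value_before N T \<sigma> \<omega>" if \<omega>: "\<omega> \<in> space P" for \<omega>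
  proof (cases "T \<omega> < \<sigma> \<omega>")
    case True
    then have "\<forall>\<^sub>F n in sequentially. T \<omega> < S n \<omega>" using S(3)[OF \<omega>] by (intro order_tendstoD) auto
    then have "\<forall>\<^sub>F n in sequentially. N (min (T \<omega>) (S n \<omega>)) \<omega> = N (T \<omega>) \<omega>"
      by eventually_elim simp
    with True show ?thesis unfolding value_before_def by (simp add: tendsto_eventually)
  next
    case False
    then have "min (T \<omega>) (S n \<omega>) = S n \<omega>" for n using S(2)[OF \<omega>, of n] by auto
    moreover have "0 < \<sigma> \<omega>" using S(2)[OF \<omega>, of 0] opt_time_nonneg[OF S(1) \<omega>, of 0] by linarith
    then have "(\<lambda>n. N (S n \<omega>) \<omega>) \<longlonglongrightarrow> left_limit N (\<sigma> \<omega>) \<omega>"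
      by (intro LIMSEQ_from_left[OF cadlag_tendsto_left[OF cadlag \<omega>]] S \<omega>)
    ultimately show ?thesis using False unfolding value_before_def by simp
  qed
  then show "AE \<omega> in P. (\<lambda>n. N (min (T \<omega>) (S n \<omega>)) \<omega>) \<longlonglongrightarrow>
      value_before N T \<sigma> \<omega>" by (rule AE_I2)
  show "value_before N T \<sigma> \<in> borel_measurable P"
    using lim by (rule borel_measurable_LIMSEQ_real) (use samp in \<open>simp_all add: sampled_def\<close>)
qed

text \<open>A martingale has no expected jump at a predictable time.\<close>

lemma sampled_before_predictable_debut:
  assumes N: "martingale_process P F N" and cadlag: "cadlag_process P N"
    and T: "opt_time T" and Tt: "\<And>\<omega>. \<omega> \<in> space P \<Longrightarrow> T \<omega> \<le> t" and "0 \<le> t"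
    and \<sigma>: "\<sigma> \<in> borel_measurable P" "\<And>\<omega>. \<omega> \<in> space P \<Longrightarrow> 0 < \<sigma> \<omega>" "\<And>\<omega>. \<omega> \<in> space P \<Longrightarrow> \<sigma> \<omega> \<le> L"
    and D: "D \<in> sets (predictable_sigma P F)"
    and hit: "\<And>\<omega>. \<omega> \<in> space P \<Longrightarrow> \<sigma> \<omega> < L \<Longrightarrow> (\<sigma> \<omega>, \<omega>) \<in> D"
    and first: "\<And>\<omega> s. \<omega> \<in> space P \<Longrightarrow> (s, \<omega>) \<in> D \<Longrightarrow> \<sigma> \<omega> \<le> s"
  shows "sampled (N (t + 1)) (value_before N T \<sigma>)"
proof -
  have "\<exists>\<sigma>' B. sampled (N (t + 1)) (value_before N T \<sigma>') \<and> B \<in> sets P \<and> prob B \<le> (1 / 2) ^ j \<and>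
      (\<forall>\<omega>\<in>space P - B. \<sigma>' \<omega> = \<sigma> \<omega>)" for j :: nat
  proof -
    have "0 < (1 / 2 :: real) ^ j" by simp
    then obtain S \<sigma>' B where S: "\<And>n::nat. opt_time (S n)"
      "\<And>n \<omega>. \<omega> \<in> space P \<Longrightarrow> S n \<omega> < \<sigma>' \<omega>" "\<And>\<omega>. \<omega> \<in> space P \<Longrightarrow> (\<lambda>n. S n \<omega>) \<longlonglongrightarrow> \<sigma>' \<omega>"
      and B: "B \<in> sets P" "prob B \<le> (1 / 2) ^ j" "\<And>\<omega>. \<omega> \<in> space P \<Longrightarrow> \<omega> \<notin> B \<Longrightarrow> \<sigma>' \<omega> = \<sigma> \<omega>"
      using predictable_debut_announced[where \<sigma>=\<sigma> and L=L and D=D and e="(1 / 2) ^ j", OF \<sigma> D] hit first by blast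
    have "sampled (N (t + 1)) (value_before N T \<sigma>')"
      by (rule sampled_before_announced[OF N cadlag T Tt \<open>0 \<le> t\<close> S])
    with B show ?thesis by blast
  qed
  then obtain \<sigma>' where "\<exists>B. sampled (N (t + 1)) (value_before N T (\<sigma>' j)) \<and> B \<in> sets P \<and> prob B \<le> (1 / 2) ^ j \<and>
      (\<forall>\<omega>\<in>space P - B. \<sigma>' j \<omega> = \<sigma> \<omega>)" for j :: nat by moura
  then obtain B where choice: "sampled (N (t + 1)) (value_before N T (\<sigma>' j)) \<and> B j \<in> sets P \<and> prob (B j) \<le> (1 / 2) ^ j \<and>
      (\<forall>\<omega>\<in>space P - B j. \<sigma>' j \<omega> = \<sigma> \<omega>)" for j :: nat by moura
  have samp: "\<And>j. sampled (N (t + 1)) (value_before N T (\<sigma>' j))" and B: "\<And>j. B j \<in> sets P"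
    "\<And>j. prob (B j) \<le> (1 / 2) ^ j" and eq: "\<And>j \<omega>. \<omega> \<in> space P - B j \<Longrightarrow> \<sigma>' j \<omega> = \<sigma> \<omega>"
    using choice by blast+
  \<comment> \<open>Announcement is available only up to an error, here 2 to the power -j. By
    Borel-Cantelli almost every path has \<open>\<sigma>' j = \<sigma>\<close> for all large
    \<open>j\<close>, so a further limit removes the error.\<close>
  have "AE \<omega> in P. \<forall>\<^sub>F j in sequentially. \<omega> \<in> space P - B j"
  proof (rule borel_cantelli_AE1[OF B(1)])
    show "summable (\<lambda>j. prob (B j))"
      using B(2) by (intro summable_comparison_test'[OF summable_geometric[of "1 / 2 :: real"]]) auto
    show "emeasure P (B j) < \<infinity>" for j by (simp add: emeasure_eq_measure)
  qed
  then have AE_lim: "AE \<omega> in P. (\<lambda>j. value_before N T (\<sigma>' j) \<omega>) \<longlonglongrightarrow> value_before N T \<sigma> \<omega>"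
  proof eventually_elim
    case (elim \<omega>)
    then have "\<forall>\<^sub>F j in sequentially. value_before N T (\<sigma>' j) \<omega> = value_before N T \<sigma> \<omega>"
      by eventually_elim (simp add: value_before_def eq)
    then show ?case by (rule tendsto_eventually)
  qed
  have meas: "N s \<in> borel_measurable P" if "0 \<le> s" for s
    using N adapted_measurable that unfolding martingale_process_def by blast
  note [measurable] = cadlag_at_time_measurable[OF meas cadlag opt_time_measurable[OF T] opt_time_nonneg[OF T]]
    left_limit_at_time_measurable[OF meas cadlag \<sigma>(1,2)] opt_time_measurable[OF T] \<sigma>(1)
  have "value_before N T \<sigma> \<in> borel_measurable P" unfolding value_before_def by measurable
  moreover have "integrable P (N (t + 1))" using N \<open>0 \<le> t\<close> unfolding martingale_process_def by simp
  ultimately show ?thesis by (intro sampled_limit[OF _ samp _ AE_lim])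
qed

end

section \<open>Bihari's inequality\<close>

lemma emeasure_interval_measure_halfline:
  fixes g :: "real \<Rightarrow> real"
  assumes mono: "mono_on {0..} g" and rc: "\<And>x. 0 \<le> x \<Longrightarrow> continuous (at_right x) g" and "x \<le> y"
  shows "emeasure (interval_measure (\<lambda>x. g (max 0 x))) {x<..y} = ennreal (g (max 0 y) - g (max 0 x))"
proof (rule emeasure_interval_measure_Ioc[OF \<open>x \<le> y\<close>])
  show "g (max 0 x) \<le> g (max 0 y)" if "x \<le> y" for x y
    using that by (intro mono_onD[OF mono]) auto
  show "continuous (at_right x) (\<lambda>x. g (max 0 x))" for x
  proof (cases "0 \<le> x")
    case True
    have "((\<lambda>x. g (max 0 x)) \<longlongrightarrow> g x) (at_right x)"
    proof (rule Lim_transform_eventually)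
      show "(g \<longlongrightarrow> g x) (at_right x)" using rc[OF True] by (simp add: continuous_within)
      show "\<forall>\<^sub>F y in at_right x. g y = g (max 0 y)"
        using True by (auto simp: eventually_at_filter max_def)
    qed
    then show ?thesis using True by (simp add: continuous_within max_absorb2)
  next
    case False
    have "((\<lambda>x. g (max 0 x)) \<longlongrightarrow> g 0) (at_right x)"
    proof (rule tendsto_eventually)
      show "\<forall>\<^sub>F y in at_right x. g (max 0 y) = g 0"
        using False unfolding eventually_at_right_field by (intro exI[of _ 0]) auto
    qed
    then show ?thesis using False by (simp add: continuous_within)
  qed
qed

text \<open>The hypothesis \<open>inverse\<close> says that \<sigma> is the generalised inverse of
  \<open>g\<close>. The Stieltjes measure on (0, s] is then the image of Lebesgue measure on (0, g
  s] under \<sigma>, a jump of \<open>g\<close> being an interval on which \<sigma> is constant. The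
  two measures are compared on the rays \<open>{x<..}\<close>.\<close>

lemma stieltjes_substitution:
  fixes g \<sigma> :: "real \<Rightarrow> real" and f :: "real \<Rightarrow> ennreal"
  assumes mono: "mono_on {0..} g" and rc: "\<And>x. 0 \<le> x \<Longrightarrow> continuous (at_right x) g"
    and "g 0 = 0" and "0 \<le> s"
    and \<sigma>[measurable]: "\<sigma> \<in> borel_measurable borel"
    and inverse: "\<And>x v. 0 \<le> x \<Longrightarrow> x \<le> s \<Longrightarrow> 0 < v \<Longrightarrow> v \<le> g s \<Longrightarrow> \<sigma> v \<le> x \<longleftrightarrow> v \<le> g x"
    and f[measurable]: "f \<in> borel_measurable borel"
  shows "(\<integral>\<^sup>+x\<in>{0<..s}. f x \<partial>interval_measure (\<lambda>x. g (max 0 x))) = (\<integral>\<^sup>+v\<in>{0<..g s}. f (\<sigma> v) \<partial>lborel)"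
proof -
  define M where "M = interval_measure (\<lambda>x. g (max 0 x))"
  have [measurable_cong]: "sets M = sets borel" unfolding M_def by simp
  have mono': "g x \<le> g y" if "0 \<le> x" "x \<le> y" for x y using mono_onD[OF mono] that by simp
  have Ioc: "emeasure M {x<..y} = ennreal (g (max 0 y) - g (max 0 x))" if "x \<le> y" for x y
    unfolding M_def by (rule emeasure_interval_measure_halfline[OF mono rc that])
  have eq: "density M (indicator {0<..s}) = distr (density lborel (indicator {0<..g s})) borel \<sigma>" (is "?N1 = ?N2")
  proof (rule measure_eqI_lessThan)
    fix x :: real
    have "emeasure ?N1 {x<..} = emeasure M ({0<..s} \<inter> {x<..})"
      by (subst emeasure_density) (auto simp: indicator_inter_arith[symmetric])
    also have "{0<..s} \<inter> {x<..} = {max 0 x<..s}" by auto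
    also have "emeasure M {max 0 x<..s} = ennreal (if max 0 x \<le> s then g s - g (max 0 x) else 0)"
      using \<open>0 \<le> s\<close> Ioc[of "max 0 x" s] by (auto simp: max_absorb2)
    finally have N1: "emeasure ?N1 {x<..} = ennreal (if max 0 x \<le> s then g s - g (max 0 x) else 0)" .
    have "emeasure ?N2 {x<..} = emeasure lborel ({0<..g s} \<inter> \<sigma> -` {x<..})"
      using measurable_sets_borel[OF \<sigma>, of "{x<..}"]
      by (subst emeasure_distr, simp, simp, subst emeasure_density)
         (auto simp: indicator_inter_arith[symmetric])
    also have "{0<..g s} \<inter> \<sigma> -` {x<..} = (if max 0 x \<le> s then {g (max 0 x)<..g s} else {})"
    proof -
      have "x < \<sigma> v \<longleftrightarrow> max 0 x \<le> s \<and> g (max 0 x) < v" if v: "0 < v" "v \<le> g s" for v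
      proof -
        have "0 < \<sigma> v" using inverse[OF order_refl \<open>0 \<le> s\<close> v] \<open>g 0 = 0\<close> v by auto
        moreover have "\<sigma> v \<le> s" using inverse[OF \<open>0 \<le> s\<close> order_refl v] v by auto
        ultimately have "x < \<sigma> v \<longleftrightarrow> max 0 x \<le> s \<and> \<not> \<sigma> v \<le> max 0 x" by auto
        then show ?thesis using inverse[of "max 0 x" v] v by auto
      qed
      moreover have "0 \<le> g (max 0 x)" using mono'[of 0 "max 0 x"] \<open>g 0 = 0\<close> by simp
      ultimately show ?thesis by auto
    qed
    also have "emeasure lborel \<dots> = ennreal (if max 0 x \<le> s then g s - g (max 0 x) else 0)"
      using mono'[of "max 0 x" s] by auto
    finally show "emeasure ?N1 {x<..} = emeasure ?N2 {x<..}" using N1 by simp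
    show "emeasure ?N1 {x<..} < \<infinity>" unfolding N1 by simp
  qed (simp_all add: \<open>sets M = sets borel\<close>)
  have "(\<integral>\<^sup>+x\<in>{0<..s}. f x \<partial>M) = (\<integral>\<^sup>+x. f x \<partial>?N1)"
    by (subst nn_integral_density) (auto simp: mult.commute)
  also have "\<dots> = (\<integral>\<^sup>+v. f (\<sigma> v) \<partial>density lborel (indicator {0<..g s}))"
    unfolding eq by (rule nn_integral_distr) measurable
  also have "\<dots> = (\<integral>\<^sup>+v\<in>{0<..g s}. f (\<sigma> v) \<partial>lborel)"
    by (subst nn_integral_density) (auto simp: mult.commute)
  finally show ?thesis unfolding M_def .
qed

section \<open>The function \<open>G\<close>, its inverse, and the deterministic inequality\<close>

locale bihari_function =
  fixes \<eta> :: "real \<Rightarrow> real" and c :: real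
  assumes cont: "continuous_on {0..} \<eta>" and mono: "mono_on {0..} \<eta>" and concave: "concave_on {0..} \<eta>"
    and nonneg: "\<And>x. 0 \<le> x \<Longrightarrow> 0 \<le> \<eta> x" and pos: "\<And>x. 0 < x \<Longrightarrow> 0 < \<eta> x" and c: "0 < c"
begin

abbreviation "G \<equiv> bihari_G \<eta> c"

lemma continuous_ext: "continuous_on UNIV (\<lambda>x. \<eta> (max 0 x))"
  by (rule continuous_on_compose2[OF cont]) (auto intro!: continuous_intros)

lemma measurable_ext: "(\<lambda>x. \<eta> (max 0 x)) \<in> borel_measurable borel"
  using continuous_ext by (rule borel_measurable_continuous_onI)

lemma mono_le: "0 \<le> x \<Longrightarrow> x \<le> y \<Longrightarrow> \<eta> x \<le> \<eta> y"
  using mono_onD[OF mono] by simp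

text \<open>The real version of \<open>G\<close> on positive arguments, in a form to which the
  fundamental theorem of calculus applies. The point 0 is left out because 1/\<open>\<eta>\<close>
  may fail to be integrable near it.\<close>

definition Greal :: "real \<Rightarrow> real" where
  "Greal x = (LBINT u=ereal c..ereal x. 1 / \<eta> u)"

lemma Greal_deriv:
  assumes "0 < x"
  shows "(Greal has_real_derivative 1 / \<eta> x) (at x)"
proof -
  \<comment> \<open>An interval away from 0 that contains \<open>c\<close> and has \<open>x\<close>
    in its interior.\<close>
  define l r where "l = min c x / 2" and "r = max c x + 1"
  have lr: "0 < l" "l < x" "x < r" "l \<le> c" "c \<le> r" using assms c unfolding l_def r_def by (auto simp: min_def max_def)
  have "continuous_on {l..r} (\<lambda>u. 1 / \<eta> u)"
    using lr pos by (intro continuous_intros continuous_on_subset[OF cont]) (auto simp: less_le)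
  then have "((\<lambda>x. LBINT u=ereal c..ereal x. 1 / \<eta> u) has_vector_derivative 1 / \<eta> x) (at x within {l..r})"
    using lr by (intro interval_integral_FTC2) auto
  moreover have "at x within {l..r} = at x" using lr by (intro at_within_interior) auto
  ultimately show ?thesis
    unfolding Greal_def[abs_def] by (simp add: has_real_derivative_iff_has_vector_derivative)
qed

lemma nn_integral_Greal:
  assumes "0 < x" "x \<le> y"
  shows "(\<integral>\<^sup>+u\<in>{x..y}. ennreal (1 / \<eta> u) \<partial>lborel) = ennreal (Greal y - Greal x)"
proof -
  have "(\<integral>\<^sup>+u\<in>{x..y}. ennreal (1 / \<eta> u) \<partial>lborel) = (\<integral>\<^sup>+u\<in>{x..y}. ennreal (1 / \<eta> (max 0 u)) \<partial>lborel)"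
    using assms by (intro nn_integral_cong) (auto simp: indicator_def)
  also have "\<dots> = ennreal (Greal y - Greal x)"
  proof (rule nn_integral_FTC_Icc)
    show "(\<lambda>u. 1 / \<eta> (max 0 u)) \<in> borel_measurable borel" using measurable_ext by measurable
    show "(Greal has_real_derivative 1 / \<eta> (max 0 u)) (at u)" if "u \<in> {x..y}" for u
      using Greal_deriv[of u] that assms by (simp add: max_absorb2)
  qed (use assms nonneg in auto)
  finally show ?thesis .
qed

lemma Greal_strict_mono:
  assumes "0 < x" "x < y"
  shows "Greal x < Greal y"
proof (rule DERIV_pos_imp_increasing[OF \<open>x < y\<close>])
  fix z assume "x \<le> z" "z \<le> y"
  then show "\<exists>d. (Greal has_real_derivative d) (at z) \<and> 0 < d"
    using assms Greal_deriv[of z] pos[of z] by (intro exI[of _ "1 / \<eta> z"]) auto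
qed

lemma Greal_mono: "0 < x \<Longrightarrow> x \<le> y \<Longrightarrow> Greal x \<le> Greal y"
  using Greal_strict_mono[of x y] by (cases "x = y") auto

lemma Greal_c: "Greal c = 0"
  unfolding Greal_def by simp

lemma G_eq_Greal:
  assumes "0 < x"
  shows "G x = ereal (Greal x)"
proof (cases "c \<le> x")
  case True
  then show ?thesis
    unfolding bihari_G_def using c Greal_mono[of c x] nn_integral_Greal[of c x] by (simp add: Greal_c)
next
  case False
  then show ?thesis
    unfolding bihari_G_def using assms Greal_mono[of x c] nn_integral_Greal[of x c] by (simp add: Greal_c)
qed

text \<open>Monotone convergence over intervals shrinking towards 0, valid whether
  \<open>G 0\<close> is finite or -\<infinity>. It is the link from \<open>Greal\<close> to the
  value at 0; the point 0 itself is a null set, so the convention for 1/0 has no effect.\<close>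

lemma G_0: "G 0 = (INF n. G (c / real (Suc n)))"
proof -
  define \<mu> where "\<mu> = density lborel (\<lambda>u. ennreal (1 / \<eta> (max 0 u)))"
  have [measurable]: "(\<lambda>u. ennreal (1 / \<eta> (max 0 u))) \<in> borel_measurable borel"
    using measurable_ext by measurable
  have \<mu>: "emeasure \<mu> {x..c} = (\<integral>\<^sup>+u\<in>{x..c}. ennreal (1 / \<eta> u) \<partial>lborel)" if "0 \<le> x" for x
    unfolding \<mu>_def using that
    by (subst emeasure_density) (auto intro!: nn_integral_cong simp: indicator_def)
  have pos_n: "0 < c / real (Suc n)" "c / real (Suc n) \<le> c" for n using c by (auto simp: field_simps)
  have G_n: "G (c / real (Suc n)) = - enn2ereal (emeasure \<mu> {c / real (Suc n)..c})" for n
  \<comment> \<open>For \<open>n = 0\<close> the argument is \<open>c\<close>, which falls under the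
    other branch of \<open>bihari_G\<close>; both sides vanish.\<close>
  proof (cases "n = 0")
    case True
    then show ?thesis using c G_eq_Greal[of c] nn_integral_Greal[of c c] \<mu>[of c] by (simp add: Greal_c zero_ereal_def[symmetric] zero_ennreal.rep_eq)
  next
    case False
    then have "\<not> c \<le> c / real (Suc n)" using c by (simp add: field_simps mult_le_0_iff)
    then show ?thesis unfolding bihari_G_def using \<mu> pos_n(1)[of n] by simp
  qed
  have inc: "incseq (\<lambda>n. {c / real (Suc n)..c})"
    using c by (auto simp: incseq_def frac_le intro: order_trans[rotated])
  have "emeasure \<mu> {0..c} = emeasure \<mu> {0<..c}"
  proof (rule emeasure_eq_AE)
    have "AE u in lborel. u \<noteq> (0 :: real)" by (rule AE_lborel_singleton)
    then have "AE u in \<mu>. u \<noteq> (0 :: real)" unfolding \<mu>_def by (subst AE_density) auto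
    then show "AE u in \<mu>. u \<in> {0..c} \<longleftrightarrow> u \<in> {0<..c}" by eventually_elim auto
  qed (auto simp: \<mu>_def)
  also have "{0<..c} = (\<Union>n. {c / real (Suc n)..c})"
  proof (intro set_eqI iffI)
    fix u assume u: "u \<in> {0<..c}"
    then obtain n where "inverse (real (Suc n)) < u / c" using reals_Archimedean[of "u / c"] c by auto
    then have "c / real (Suc n) \<le> u" using c by (simp add: field_simps)
    then show "u \<in> (\<Union>n. {c / real (Suc n)..c})" using u by auto
  next
    fix u assume "u \<in> (\<Union>n. {c / real (Suc n)..c})"
    then obtain n where "c / real (Suc n) \<le> u" "u \<le> c" by auto
    then show "u \<in> {0<..c}" using pos_n(1)[of n] by auto
  qed
  also have "emeasure \<mu> \<dots> = (SUP n. emeasure \<mu> {c / real (Suc n)..c})"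
    using inc by (intro SUP_emeasure_incseq[symmetric]) (auto simp: \<mu>_def)
  finally have "emeasure \<mu> {0..c} = (SUP n. emeasure \<mu> {c / real (Suc n)..c})" .
  moreover have "mono (\<lambda>n. emeasure \<mu> {c / real (Suc n)..c})"
    using inc by (intro monoI emeasure_mono) (auto simp: \<mu>_def incseq_def simp del: of_nat_Suc)
  moreover have "sup_continuous enn2ereal"
    using sup_continuous_enn2ereal[of "\<lambda>x. x"] by (simp add: sup_continuous_def)
  ultimately have "enn2ereal (emeasure \<mu> {0..c}) = (SUP n. enn2ereal (emeasure \<mu> {c / real (Suc n)..c}))"
    using sup_continuousD[of enn2ereal "\<lambda>n. emeasure \<mu> {c / real (Suc n)..c}"] by simp
  then have "G 0 = - (SUP n. enn2ereal (emeasure \<mu> {c / real (Suc n)..c}))"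
    unfolding bihari_G_def using c \<mu>[of 0] by simp
  also have "\<dots> = (INF n. G (c / real (Suc n)))" unfolding G_n by (simp add: ereal_INF_uminus_eq)
  finally show ?thesis .
qed

lemma G_mono_0: "0 < x \<Longrightarrow> G 0 \<le> G x"
proof -
  assume "0 < x"
  obtain n where "inverse (real (Suc n)) < x / c" using reals_Archimedean[of "x / c"] c \<open>0 < x\<close> by auto
  then have "c / real (Suc n) \<le> x" using c by (simp add: field_simps)
  then have "G (c / real (Suc n)) \<le> G x" using c \<open>0 < x\<close> Greal_mono by (simp add: G_eq_Greal)
  moreover have "G 0 \<le> G (c / real (Suc n))" unfolding G_0 by (rule INF_lower) simp
  ultimately show ?thesis by (rule order_trans[rotated])
qed

lemma G_strict_mono:
  assumes "0 \<le> x" "x < y"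
  shows "G x < G y"
proof (cases "x = 0")
  case True
  have "G 0 \<le> G (y / 2)" using assms by (intro G_mono_0) auto
  also have "\<dots> < G y" using assms Greal_strict_mono[of "y / 2" y] by (simp add: G_eq_Greal)
  finally show ?thesis using True by simp
next
  case False
  then show ?thesis using assms Greal_strict_mono[of x y] by (simp add: G_eq_Greal)
qed

text \<open>Right-continuity of \<open>G\<close> in a form that makes sense also for
  \<open>G 0 = -\<infinity>\<close>.\<close>

lemma G_right_dense:
  assumes "0 \<le> h" "G h < ereal m"
  shows "\<exists>r>h. G r < ereal m"
proof (cases "h = 0")
  case True
  then obtain n where "G (c / real (Suc n)) < ereal m" using assms unfolding True G_0 INF_less_iff by blast
  then show ?thesis using True c by (intro exI[of _ "c / real (Suc n)"]) auto
next
  case False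
  then have "isCont Greal h" using assms by (intro DERIV_isCont[OF Greal_deriv]) auto
  then have "(Greal \<longlongrightarrow> Greal h) (at_right h)" by (simp add: isCont_def filterlim_at_split)
  moreover have "Greal h < m" using assms False by (simp add: G_eq_Greal)
  ultimately have "\<forall>\<^sub>F r in at_right h. Greal r < m" by (rule order_tendstoD)
  then obtain b where "h < b" "\<And>r. h < r \<Longrightarrow> r < b \<Longrightarrow> Greal r < m"
    unfolding eventually_at_right_field by blast
  then have "Greal ((h + b) / 2) < m" "h < (h + b) / 2" by auto
  then show ?thesis using assms False by (intro exI[of _ "(h + b) / 2"]) (auto simp: G_eq_Greal)
qed

text \<open>The point \<open>c\<close> is the convex combination of 0 and \<open>x\<close> with
  weight \<open>c / x\<close> on \<open>x\<close>, and \<open>\<eta> 0\<close> is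
  nonnegative.\<close>

lemma linear_growth:
  assumes "c \<le> x"
  shows "\<eta> x \<le> \<eta> c / c * x"
proof -
  have "0 < x" using assms c by simp
  have "(1 - c / x) * \<eta> 0 + (c / x) * \<eta> x \<le> \<eta> ((1 - c / x) *\<^sub>R 0 + (c / x) *\<^sub>R x)"
    using assms c \<open>0 < x\<close> by (intro concave_onD[OF concave]) (auto simp: field_simps)
  moreover have "0 \<le> (1 - c / x) * \<eta> 0" using assms c \<open>0 < x\<close> nonneg[of 0] by (intro mult_nonneg_nonneg) auto
  ultimately have "(c / x) * \<eta> x \<le> \<eta> c" using \<open>0 < x\<close> by simp
  then show ?thesis using c \<open>0 < x\<close> by (simp add: field_simps)
qed

text \<open>Concavity forces \<open>\<eta>\<close> to grow at most linearly, so \<open>G\<close> grows at least like the logarithm.\<close>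

lemma Greal_unbounded: "\<exists>x\<ge>c. K \<le> Greal x"
proof -
  define k where "k = c / \<eta> c"
  have k: "0 < k" unfolding k_def using c pos by simp
  \<comment> \<open>Chosen so that \<open>k * ln (x / c)\<close> is \<open>max 0 K\<close>; by
    \<open>linear_growth\<close> the derivative of \<open>Greal\<close> is at least that of
    \<open>k * ln\<close>.\<close>
  define x where "x = c * exp (max 0 K / k)"
  have "c * 1 \<le> x" unfolding x_def using c k by (intro mult_left_mono) auto
  then have x: "c \<le> x" by simp
  have "Greal c - k * ln c \<le> Greal x - k * ln x"
  proof (rule DERIV_nonneg_imp_nondecreasing[OF x])
    fix z assume z: "c \<le> z" "z \<le> x"
    then have "0 < z" using c by simp
    have "((\<lambda>z. Greal z - k * ln z) has_real_derivative 1 / \<eta> z - k * (1 / z)) (at z)"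
      using \<open>0 < z\<close> by (auto intro!: derivative_eq_intros Greal_deriv)
    moreover have "k * (1 / z) \<le> 1 / \<eta> z"
      using linear_growth[OF z(1)] \<open>0 < z\<close> c pos[of z] pos[of c] unfolding k_def by (simp add: field_simps)
    ultimately show "\<exists>d. ((\<lambda>z. Greal z - k * ln z) has_real_derivative d) (at z) \<and> 0 \<le> d"
      by (intro exI[of _ "1 / \<eta> z - k * (1 / z)"]) auto
  qed
  moreover have "ln x = ln c + max 0 K / k" unfolding x_def using c by (simp add: ln_mult)
  ultimately have "k * (max 0 K / k) \<le> Greal x" by (simp add: Greal_c algebra_simps)
  then show ?thesis using x k by (intro exI[of _ x]) auto
qed

text \<open>Intermediate values between a point slightly above \<open>h\<close>, where
  \<open>G\<close> is still below the target, and a far point supplied by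
  \<open>Greal_unbounded\<close>. Thus \<open>bihari_G_inv\<close> is a genuine inverse wherever it
  is evaluated with finite \<open>G h\<close>.\<close>

lemma G_surj:
  assumes "0 \<le> h" "0 < R" "G h \<noteq> - \<infinity>"
  shows "\<exists>x\<ge>0. G x = G h + ereal R"
proof -
  have "G h \<noteq> \<infinity>" using G_strict_mono[of h "h + 1"] assms(1) by auto
  then obtain g where g: "G h = ereal g" using assms(3) by (cases "G h") auto
  obtain r where r: "h < r" "G r < ereal (g + R)"
    using G_right_dense[OF assms(1), of "g + R"] assms(2) g by auto
  obtain x where x: "c \<le> x" "g + R \<le> Greal x" using Greal_unbounded by blast
  have "0 < r" using r assms by simp
  then have "Greal r < g + R" using r by (simp add: G_eq_Greal)
  then have "r \<le> x" using x Greal_mono[of x r] c by force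
  have "\<exists>z\<ge>r. z \<le> x \<and> Greal z = g + R"
    using x \<open>0 < r\<close> \<open>Greal r < g + R\<close> \<open>r \<le> x\<close>
    by (intro IVT) (auto intro!: DERIV_isCont[OF Greal_deriv])
  then obtain z where "r \<le> z" "Greal z = g + R" by blast
  then show ?thesis using \<open>0 < r\<close> g by (intro exI[of _ z]) (auto simp: G_eq_Greal)
qed

text \<open>A strict inequality leaves room to enlarge both \<open>h\<close> and \<open>R\<close>.
  If \<open>G h\<close> is -\<infinity>, the convention turns the assumption into
  \<open>0 < y\<close>, and room exists because \<open>G\<close> is arbitrarily negative just above
  \<open>h\<close>.\<close>

lemma less_G_inv_room:
  assumes "0 \<le> h" "0 < R" "bihari_G_inv \<eta> c (G h + ereal R) < y"
  shows "\<exists>r>h. \<exists>b>R. G r + ereal b < G y" and "0 < y"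
proof -
  have inj: "inj_on G {0..}"
  proof (rule inj_onI)
    fix x y assume "x \<in> {0..}" "y \<in> {0..}" "G x = G y"
    then show "x = y" using G_strict_mono[of x y] G_strict_mono[of y x] by (cases x y rule: linorder_cases) auto
  qed
  have "0 < y \<and> G h + ereal R < G y"
  proof (cases "G h = - \<infinity>")
    case True
    then have "0 < y" using assms(3) unfolding bihari_G_inv_def by simp
    then show ?thesis using True by (simp add: G_eq_Greal)
  next
    case False
    then obtain z where z: "0 \<le> z" "G z = G h + ereal R" using G_surj assms by blast
    have "G h + ereal R \<noteq> - \<infinity>" using False by simp
    then have "bihari_G_inv \<eta> c (G h + ereal R) = z"
      unfolding bihari_G_inv_def using the_inv_into_f_f[OF inj, of z] z by simp
    then have "z < y" using assms by simp
    then show ?thesis using G_strict_mono[OF z(1)] z by auto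
  qed
  then have lt: "G h + ereal R < G y" and "0 < y" by auto
  from \<open>0 < y\<close> show "0 < y" .
  have Gy: "G y = ereal (Greal y)" using \<open>0 < y\<close> by (rule G_eq_Greal)
  have "G h < ereal (Greal y - R)"
    using lt unfolding Gy by (cases "G h") auto
  \<comment> \<open>The gap is split at \<open>m\<close>: \<open>r\<close> has \<open>G r\<close>
    below \<open>m\<close>, and \<open>b\<close> is the remaining distance from \<open>m\<close> to
    \<open>Greal y\<close>.\<close>
  then obtain m where m: "G h < ereal m" "m < Greal y - R"
    using ereal_dense2[of "G h" "ereal (Greal y - R)"] by auto
  obtain r where r: "h < r" "G r < ereal m" using G_right_dense[OF assms(1) m(1)] by blast
  have "0 < r" using r assms by simp
  then have "G r + ereal (Greal y - m) < G y" using r unfolding Gy by (simp add: G_eq_Greal)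
  then show "\<exists>r>h. \<exists>b>R. G r + ereal b < G y"
    using r m by (intro exI[of _ r] conjI exI[of _ "Greal y - m"]) auto
qed

text \<open>As \<open>v\<close> is only measurable, \<open>V\<close> need not be differentiable. It
  is dominated by \<open>W\<close>, whose derivative \<open>\<eta> (V a)\<close> is continuous and
  at most \<open>\<eta> (W a)\<close>; hence \<open>Greal (W a)\<close> grows with slope at most
  1.\<close>

lemma bihari_bound:
  assumes "0 < r" "0 < b" and v[measurable]: "v \<in> borel_measurable borel"
    and bounds: "\<And>a. 0 \<le> v a" "\<And>a. v a \<le> K"
    and le: "\<And>a. 0 \<le> a \<Longrightarrow> a \<le> b \<Longrightarrow> v a \<le> \<eta> (r + (LINT x:{0..a}|lborel. v x))"
  shows "G (r + (LINT x:{0..b}|lborel. v x)) \<le> G r + ereal b"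
proof -
  have set_int: "set_integrable lborel {0..a} v" for a
    unfolding set_integrable_def
  proof (rule Bochner_Integration.integrable_bound)
    show "integrable lborel (\<lambda>x. indicator {0..a} x *\<^sub>R K)"
      using integrable_real_indicator[of "{0..a}" lborel] by (simp add: emeasure_lborel_Icc_eq)
    have "norm (indicator {0..a} x *\<^sub>R v x) \<le> norm (indicator {0..a} x *\<^sub>R K)" for x
      using bounds[of x] by (auto simp: indicator_def)
    then show "AE x in lborel. norm (indicator {0..a} x *\<^sub>R v x) \<le> norm (indicator {0..a} x *\<^sub>R K)"
      by (rule AE_I2)
  qed measurable
  define V where "V a = r + (LINT x:{0..a}|lborel. v x)" for a
  have V_eq: "V a = r + integral {0..a} v" for a
    unfolding V_def by (subst set_borel_integral_eq_integral(2)[OF set_int]) simp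
  have v_int: "v integrable_on {0..a}" for a using set_borel_integral_eq_integral(1)[OF set_int] .
  have Vr: "r \<le> V a" for a unfolding V_eq using bounds by (simp add: integral_nonneg v_int)
  have V_cont: "continuous_on {0..b} V"
    unfolding V_eq[abs_def] by (intro continuous_intros indefinite_integral_continuous_1 v_int)
  have \<eta>V_cont: "continuous_on {0..b} (\<lambda>a. \<eta> (V a))"
    using Vr \<open>0 < r\<close> by (intro continuous_on_compose2[OF cont V_cont]) (auto intro: order_trans[of _ r])
  define W where "W a = r + integral {0..a} (\<lambda>a. \<eta> (V a))" for a
  have \<eta>V_int: "(\<lambda>a. \<eta> (V a)) integrable_on {0..a}" if "a \<le> b" for a
    using that by (intro integrable_continuous_real continuous_on_subset[OF \<eta>V_cont]) auto
  have VW: "V a \<le> W a" if "0 \<le> a" "a \<le> b" for a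
  proof -
    have "integral {0..a} v \<le> integral {0..a} (\<lambda>a. \<eta> (V a))"
      using le that by (intro integral_le v_int \<eta>V_int) (auto simp: V_def[symmetric])
    then show ?thesis unfolding W_def V_eq[of a] by simp
  qed
  have Wr: "0 < W a" if "0 \<le> a" "a \<le> b" for a using VW[OF that] Vr[of a] \<open>0 < r\<close> by linarith
  have W_deriv: "(W has_real_derivative \<eta> (V a)) (at a within {0..b})" if "a \<in> {0..b}" for a
    unfolding W_def[abs_def]
    using integral_has_real_derivative[OF \<eta>V_cont that] by (auto intro!: derivative_eq_intros)
  have W_cont: "continuous_on {0..b} W"
    using W_deriv by (intro DERIV_continuous_on)
  have "0 - Greal (W 0) \<le> b - Greal (W b)"
  proof (rule DERIV_nonneg_imp_increasing_open[where f="\<lambda>a. a - Greal (W a)"])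
    fix a assume a: "0 < a" "a < b"
    have "at a within {0..b} = at a" using a by (intro at_within_interior) auto
    then have "(W has_real_derivative \<eta> (V a)) (at a)" using W_deriv[of a] a by simp
    moreover have "0 < W a" using Wr a by simp
    ultimately have "((\<lambda>a. a - Greal (W a)) has_real_derivative 1 - 1 / \<eta> (W a) * \<eta> (V a)) (at a)"
      by (auto intro!: derivative_eq_intros DERIV_chain2[OF Greal_deriv])
    moreover have "\<eta> (V a) \<le> \<eta> (W a)" using VW[of a] Vr[of a] \<open>0 < r\<close> a by (intro mono_le) auto
    then have "0 \<le> 1 - 1 / \<eta> (W a) * \<eta> (V a)" using pos[OF \<open>0 < W a\<close>] by (simp add: field_simps)
    ultimately show "\<exists>d. ((\<lambda>a. a - Greal (W a)) has_real_derivative d) (at a) \<and> 0 \<le> d" by blast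
  next
    have "continuous_on {0<..} Greal"
      by (auto intro!: continuous_at_imp_continuous_on DERIV_isCont[OF Greal_deriv])
    then have "continuous_on {0..b} (\<lambda>a. Greal (W a))"
      using Wr by (intro continuous_on_compose2[OF _ W_cont]) auto
    then show "continuous_on {0..b} (\<lambda>a. a - Greal (W a))" by (intro continuous_intros)
  qed (use \<open>0 < b\<close> in auto)
  moreover have "W 0 = r" unfolding W_def by simp
  moreover have "Greal (V b) \<le> Greal (W b)" using VW[of b] Vr[of b] \<open>0 < r\<close> \<open>0 < b\<close> by (intro Greal_mono) auto
  ultimately have "Greal (V b) \<le> Greal r + b" by simp
  then show ?thesis
    unfolding V_def[symmetric] using \<open>0 < r\<close> Vr[of b] by (simp add: G_eq_Greal)
qed

text \<open>The supporting line of the convex function \<open>- \<eta>\<close> at \<open>m\<close>;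
  monotonicity of \<open>\<eta>\<close>, tested at \<open>m + 1\<close>, gives the sign of the
  slope.\<close>

lemma tangent:
  assumes "0 < m"
  obtains p where "0 \<le> p" "\<And>x. 0 \<le> x \<Longrightarrow> \<eta> x \<le> \<eta> m + p * (x - m)"
proof -
  define q where "q = (INF t\<in>{m<..} \<inter> {0..}. ((- \<eta> m) - (- \<eta> t)) / (m - t))"
  have "convex_on {0..} (\<lambda>x. - \<eta> x)" using concave unfolding concave_on_def .
  moreover have "m \<in> interior {0..}" using assms by simp
  ultimately have q: "- \<eta> m + q * (x - m) \<le> - \<eta> x" if "0 \<le> x" for x
    unfolding q_def using that by (intro convex_le_Inf_differential) auto
  have "\<eta> m \<le> \<eta> (m + 1)" using assms by (intro mono_le) auto
  with q[of "m + 1"] assms have "q \<le> 0" by simp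
  then show thesis using that[of "- q"] q by (auto simp: algebra_simps)
qed

end

section \<open>Measurability and first passage times\<close>

context usual_filtered_prob_space
begin

lemma predictable_measurable:
  assumes "predictable_process P F X" "0 \<le> s"
  shows "X s \<in> borel_measurable P"
proof -
  have "(\<lambda>\<omega>. (s, \<omega>)) \<in> P \<rightarrow>\<^sub>M predictable_sigma P F"
  proof (rule measurable_sigma_sets[OF sets_predictable_sigma])
    show "(\<lambda>\<omega>. (s, \<omega>)) \<in> space P \<rightarrow> {0..} \<times> space P" using assms(2) by auto
    show "{{0} \<times> B | B. B \<in> sets (F 0)} \<union> {{s<..t} \<times> B | s t B. 0 \<le> s \<and> s \<le> t \<and> B \<in> sets (F s)}
        \<subseteq> Pow ({0..} \<times> space P)"
      by (rule predictable_generators_subset)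
  next
    fix y assume "y \<in> {{0} \<times> B | B. B \<in> sets (F 0)} \<union> {{s<..t} \<times> B | s t B. 0 \<le> s \<and> s \<le> t \<and> B \<in> sets (F s)}"
    then consider B where "y = {0} \<times> B" "B \<in> sets (F 0)"
      | r t B where "y = {r<..t} \<times> B" "0 \<le> r" "B \<in> sets (F r)" by blast
    then show "(\<lambda>\<omega>. (s, \<omega>)) -` y \<inter> space P \<in> sets P"
    proof cases
      case 1
      then have "(\<lambda>\<omega>. (s, \<omega>)) -` y \<inter> space P = (if s = 0 then B \<inter> space P else {})" by auto
      then show ?thesis using 1 sets_F_subset[of 0 B] by auto
    next
      case 2
      then have "(\<lambda>\<omega>. (s, \<omega>)) -` y \<inter> space P = (if r < s \<and> s \<le> t then B \<inter> space P else {})" by auto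
      then show ?thesis using 2 sets_F_subset[of r B] by auto
    qed
  qed
  from measurable_compose[OF this] have "(\<lambda>\<omega>. (\<lambda>(t, \<omega>). X t \<omega>) (s, \<omega>)) \<in> borel_measurable P"
    using assms(1) unfolding predictable_process_def by blast
  then show ?thesis by simp
qed

lemma running_sup_greater_iff:
  assumes "cadlag_process P X" "\<omega> \<in> space P" "0 \<le> t"
  shows "u < running_sup X t \<omega> \<longleftrightarrow> (\<exists>s\<in>{0..t}. u < X s \<omega>)"
  unfolding running_sup_def using cadlag_bdd_above[OF assms] assms(3) by (subst less_cSUP_iff) auto

text \<open>Right-continuity moves an exceedance to a nearby rational time, which reduces suprema
  and entrance times to countable unions.\<close>

lemma cadlag_exceeds_before:
  assumes cadlag: "cadlag_process P X" "\<omega> \<in> space P" and "0 \<le> s" "s < t" "u < X s \<omega>"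
  shows "\<exists>q\<in>\<rat>. 0 \<le> q \<and> q < t \<and> u < X q \<omega>"
proof -
  have "\<forall>\<^sub>F r in at_right s. u < X r \<omega>"
    using order_tendstoD(1)[OF cadlag_tendsto_right[OF cadlag \<open>0 \<le> s\<close>] \<open>u < X s \<omega>\<close>] .
  then obtain b where b: "s < b" "\<And>r. s < r \<Longrightarrow> r < b \<Longrightarrow> u < X r \<omega>"
    unfolding eventually_at_right_field by blast
  then obtain q where "q \<in> \<rat>" "s < q" "q < min b t" using Rats_dense_in_real[of s "min b t"] \<open>s < t\<close> by auto
  then show ?thesis using b(2)[of q] \<open>0 \<le> s\<close> by (intro bexI[of _ q]) auto
qed

lemma running_sup_measurable:
  assumes X: "adapted_process F X" and cadlag: "cadlag_process P X" and "0 \<le> t"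
  shows "{\<omega>\<in>space P. u < running_sup X t \<omega>} \<in> sets P"
proof -
  have [measurable]: "X s \<in> borel_measurable P" if "0 \<le> s" for s using X that by (rule adapted_measurable)
  have "{\<omega>\<in>space P. u < running_sup X t \<omega>}
      = {\<omega>\<in>space P. u < X t \<omega>} \<union> (\<Union>q\<in>\<rat> \<inter> {0..<t}. {\<omega>\<in>space P. u < X q \<omega>})"
  proof (intro set_eqI iffI)
    fix \<omega> assume \<omega>: "\<omega> \<in> {\<omega>\<in>space P. u < running_sup X t \<omega>}"
    then obtain s where s: "0 \<le> s" "s \<le> t" "u < X s \<omega>"
      using running_sup_greater_iff[OF cadlag _ \<open>0 \<le> t\<close>] by auto
    show "\<omega> \<in> {\<omega>\<in>space P. u < X t \<omega>} \<union> (\<Union>q\<in>\<rat> \<inter> {0..<t}. {\<omega>\<in>space P. u < X q \<omega>})"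
    proof (cases "s = t")
      case False
      then have "\<exists>q\<in>\<rat>. 0 \<le> q \<and> q < t \<and> u < X q \<omega>"
        using \<omega> s by (intro cadlag_exceeds_before[OF cadlag]) auto
      then show ?thesis using \<omega> by auto
    qed (use s \<omega> in auto)
  next
    fix \<omega> assume "\<omega> \<in> {\<omega>\<in>space P. u < X t \<omega>} \<union> (\<Union>q\<in>\<rat> \<inter> {0..<t}. {\<omega>\<in>space P. u < X q \<omega>})"
    then have \<omega>: "\<omega> \<in> space P" "\<exists>s\<in>{0..t}. u < X s \<omega>" using \<open>0 \<le> t\<close> by auto
    then show "\<omega> \<in> {\<omega>\<in>space P. u < running_sup X t \<omega>}"
      using running_sup_greater_iff[OF cadlag \<omega>(1) \<open>0 \<le> t\<close>] by simp
  qed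
  also have "\<dots> \<in> sets P"
  proof (intro sets.Un sets.countable_UN')
    show "countable (\<rat> \<inter> {0..<t})" by (simp add: countable_rat)
    show "{\<omega>\<in>space P. u < X t \<omega>} \<in> sets P" using \<open>0 \<le> t\<close> by measurable
    show "(\<lambda>q. {\<omega>\<in>space P. u < X q \<omega>}) ` (\<rat> \<inter> {0..<t}) \<subseteq> sets P" by auto
  qed
  finally show ?thesis .
qed

text \<open>The entrance time into the open half-line above \<open>u\<close>, made real-valued by
  the cap \<open>L\<close>.\<close>

definition first_above :: "(real \<Rightarrow> 'a \<Rightarrow> real) \<Rightarrow> real \<Rightarrow> real \<Rightarrow> 'a \<Rightarrow> real" where
  "first_above X u L \<omega> = Inf (insert L {s. 0 \<le> s \<and> u < X s \<omega>})"

lemma first_above_less_iff: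
  assumes "0 \<le> L"
  shows "first_above X u L \<omega> < s \<longleftrightarrow> L < s \<or> (\<exists>r<s. 0 \<le> r \<and> u < X r \<omega>)"
  unfolding first_above_def using assms by (subst cInf_less_iff) (auto intro!: bdd_belowI[of _ 0])

lemma first_above_nonneg: "0 \<le> L \<Longrightarrow> 0 \<le> first_above X u L \<omega>"
  unfolding first_above_def by (intro cInf_greatest) auto

lemma before_first_above: "0 \<le> L \<Longrightarrow> 0 \<le> r \<Longrightarrow> r < first_above X u L \<omega> \<Longrightarrow> X r \<omega> \<le> u"
  using first_above_less_iff[of L X u \<omega>] dense[of r "first_above X u L \<omega>"] by force

text \<open>Were \<open>X\<close> below \<open>u\<close> at the infimum, right-continuity would keep
  it there for a while, against the definition of the infimum. Only \<open>u \<le> X\<close>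
  results, as the infimum need not be attained. The strict \<open>s < L\<close> excludes
  interference of the cap.\<close>

lemma at_first_above:
  assumes cadlag: "cadlag_process P X" "\<omega> \<in> space P" and "0 \<le> s" "s < L" "u < X s \<omega>"
  shows "first_above X u L \<omega> \<le> s" "u \<le> X (first_above X u L \<omega>) \<omega>"
proof -
  let ?\<tau> = "first_above X u L \<omega>"
  have L: "0 \<le> L" using assms by simp
  show le: "?\<tau> \<le> s" unfolding first_above_def using assms by (intro cInf_lower) (auto intro!: bdd_belowI[of _ 0])
  show "u \<le> X ?\<tau> \<omega>"
  proof (rule ccontr)
    assume "\<not> u \<le> X ?\<tau> \<omega>"
    then have "X ?\<tau> \<omega> < u" by simp
    then have "\<forall>\<^sub>F r in at_right ?\<tau>. X r \<omega> < u"
      using order_tendstoD(2)[OF cadlag_tendsto_right[OF cadlag first_above_nonneg[OF L]]] by blast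
    then obtain b where b: "?\<tau> < b" "\<And>r. ?\<tau> < r \<Longrightarrow> r < b \<Longrightarrow> X r \<omega> < u"
      unfolding eventually_at_right_field by blast
    have "?\<tau> < min b L" using b(1) le \<open>s < L\<close> by simp
    then obtain r where r: "r < min b L" "0 \<le> r" "u < X r \<omega>"
      using first_above_less_iff[OF L, of X u \<omega> "min b L"] by auto
    then have "?\<tau> \<le> r" using before_first_above[OF L r(2), of X u \<omega>] by force
    then show False using b(2)[of r] r \<open>X ?\<tau> \<omega> < u\<close> by (cases "?\<tau> = r") auto
  qed
qed

lemma opt_time_first_above:
  assumes X: "adapted_process F X" and cadlag: "cadlag_process P X" and "0 \<le> L"
  shows "opt_time (first_above X u L)"
  unfolding opt_time_def
proof (intro conjI ballI allI impI)
  fix s :: real assume "0 < s"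
  have "{\<omega>\<in>space P. first_above X u L \<omega> < s}
      = (if L < s then space (F s) else (\<Union>q\<in>\<rat> \<inter> {0..<s}. {\<omega>\<in>space P. u < X q \<omega>}))"
  proof (cases "L < s")
    case True
    then show ?thesis using first_above_less_iff[OF \<open>0 \<le> L\<close>] space_F[of s] \<open>0 < s\<close> by auto
  next
    case False
    have "(\<exists>r<s. 0 \<le> r \<and> u < X r \<omega>) \<longleftrightarrow> (\<exists>q\<in>\<rat> \<inter> {0..<s}. u < X q \<omega>)" if "\<omega> \<in> space P" for \<omega>
      using cadlag_exceeds_before[OF cadlag that] by (auto simp: Bex_def)
    then show ?thesis using first_above_less_iff[OF \<open>0 \<le> L\<close>, of X u _ s] False by auto
  qed
  also have "\<dots> \<in> sets (F s)"
  proof -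
    have "{\<omega>\<in>space P. u < X q \<omega>} \<in> sets (F s)" if "0 \<le> q" "q < s" for q
    proof (rule sets_F_mono[OF that(1)])
      have [measurable]: "X q \<in> borel_measurable (F q)" using X that unfolding adapted_process_def by simp
      have "{\<omega>\<in>space (F q). u < X q \<omega>} \<in> sets (F q)" by measurable
      then show "{\<omega>\<in>space P. u < X q \<omega>} \<in> sets (F q)" using space_F that by simp
    qed (use that in simp)
    then have "(\<Union>q\<in>\<rat> \<inter> {0..<s}. {\<omega>\<in>space P. u < X q \<omega>}) \<in> sets (F s)"
      by (intro sets.countable_UN') (auto simp: countable_rat)
    then show ?thesis by simp
  qed
  finally show "{\<omega>\<in>space P. first_above X u L \<omega> < s} \<in> sets (F s)" .
qed (rule first_above_nonneg[OF \<open>0 \<le> L\<close>])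

text \<open>The strict event is the union of the events
  \<open>\<tau> \<omega> \<le> s - 1/(n+1)\<close>; cutting at \<open>t\<close> makes an infinite
  value harmless.\<close>

lemma opt_time_ext_stopping_time:
  assumes \<tau>: "ext_stopping_time P F \<tau>" and "0 \<le> t"
  shows "opt_time (\<lambda>\<omega>. real_of_ereal (min (ereal t) (\<tau> \<omega>)))"
  unfolding opt_time_def
proof (intro conjI ballI allI impI)
  have cut: "ereal (real_of_ereal (min (ereal t) (\<tau> \<omega>))) = min (ereal t) (\<tau> \<omega>)" if "\<omega> \<in> space P" for \<omega>
  proof -
    have "0 \<le> \<tau> \<omega>" using \<tau> that unfolding ext_stopping_time_def by blast
    then show ?thesis using \<open>0 \<le> t\<close> by (cases "\<tau> \<omega>") (auto simp: min_def)
  qed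
  show "0 \<le> real_of_ereal (min (ereal t) (\<tau> \<omega>))" if "\<omega> \<in> space P" for \<omega>
    using \<tau> that \<open>0 \<le> t\<close> unfolding ext_stopping_time_def by (intro real_of_ereal_pos) (auto simp: min_def)
  fix s :: real assume "0 < s"
  have "real_of_ereal (min (ereal t) (\<tau> \<omega>)) < s \<longleftrightarrow>
      t < s \<or> (\<exists>n. 0 \<le> s - 1 / real (Suc n) \<and> \<tau> \<omega> \<le> ereal (s - 1 / real (Suc n)))" if \<omega>: "\<omega> \<in> space P" for \<omega>
  proof -
    have "0 \<le> \<tau> \<omega>" using \<tau> \<omega> unfolding ext_stopping_time_def by blast
    have "real_of_ereal (min (ereal t) (\<tau> \<omega>)) < s \<longleftrightarrow> t < s \<or> \<tau> \<omega> < ereal s"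
      using cut[OF \<omega>] by (metis ereal_less(1) min_less_iff_disj ereal_less_eq(3) not_le)
    moreover have "\<exists>n. 0 \<le> s - 1 / real (Suc n) \<and> \<tau> \<omega> \<le> ereal (s - 1 / real (Suc n))" if lt: "\<tau> \<omega> < ereal s"
    proof -
      obtain r where r: "\<tau> \<omega> = ereal r" "0 \<le> r" "r < s" using lt \<open>0 \<le> \<tau> \<omega>\<close> by (cases "\<tau> \<omega>") auto
      then obtain n where "inverse (real (Suc n)) < s - r" using reals_Archimedean[of "s - r"] by auto
      then have "r \<le> s - 1 / real (Suc n)" by (simp add: inverse_eq_divide)
      then show ?thesis using r by (intro exI[of _ n]) auto
    qed
    moreover have "\<tau> \<omega> < ereal s" if "\<tau> \<omega> \<le> ereal (s - 1 / real (Suc n))" for n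
    proof -
      have "0 < 1 / real (Suc n)" by simp
      then have "ereal (s - 1 / real (Suc n)) < ereal s" by (simp only: ereal_less_eq less_ereal.simps)
      with that show ?thesis by (rule le_less_trans)
    qed
    ultimately show ?thesis by blast
  qed
  then have "{\<omega>\<in>space P. real_of_ereal (min (ereal t) (\<tau> \<omega>)) < s} = (if t < s then space (F s) else
      (\<Union>n\<in>{n. 0 \<le> s - 1 / real (Suc n)}. {\<omega>\<in>space P. \<tau> \<omega> \<le> ereal (s - 1 / real (Suc n))}))"
    using space_F[of s] \<open>0 < s\<close> by auto
  also have "\<dots> \<in> sets (F s)"
  proof -
    have "{\<omega>\<in>space P. \<tau> \<omega> \<le> ereal (s - 1 / real (Suc n))} \<in> sets (F s)" if "0 \<le> s - 1 / real (Suc n)" for n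
      by (rule sets_F_mono[OF that]) (use \<tau> that in \<open>auto simp: ext_stopping_time_def\<close>)
    then have "(\<Union>n\<in>{n. 0 \<le> s - 1 / real (Suc n)}. {\<omega>\<in>space P. \<tau> \<omega> \<le> ereal (s - 1 / real (Suc n))}) \<in> sets (F s)"
      by (intro sets.countable_UN') auto
    then show ?thesis by simp
  qed
  finally show "{\<omega>\<in>space P. real_of_ereal (min (ereal t) (\<tau> \<omega>)) < s} \<in> sets (F s)" .
qed

lemma cadlag_stopped:
  assumes cadlag: "cadlag_process P X" and \<tau>: "\<And>\<omega>. \<omega> \<in> space P \<Longrightarrow> 0 \<le> \<tau> \<omega>"
  shows "cadlag_process P (stopped_process \<tau> X)"
  unfolding cadlag_process_def
proof (intro ballI conjI allI impI)
  fix \<omega> assume \<omega>: "\<omega> \<in> space P"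
  have before: "stopped_process \<tau> X s \<omega> = X s \<omega>" if "ereal s \<le> \<tau> \<omega>" for s
    using that unfolding stopped_process_def by (simp add: min_absorb1)
  have after: "stopped_process \<tau> X s \<omega> = X (real_of_ereal (\<tau> \<omega>)) \<omega>" if "\<tau> \<omega> \<le> ereal s" for s
    using that unfolding stopped_process_def by (simp add: min_absorb2)
  show "continuous (at_right t) (\<lambda>s. stopped_process \<tau> X s \<omega>)" if t: "0 \<le> t" for t
    proof (cases "ereal t < \<tau> \<omega>")
      case True
      then obtain r where r: "ereal t < ereal r" "ereal r < \<tau> \<omega>" using ereal_dense2 by blast
      have "\<forall>\<^sub>F s in at_right t. X s \<omega> = stopped_process \<tau> X s \<omega>"
        unfolding eventually_at_right_field
      proof (intro exI conjI allI impI)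
        show "t < r" using r by simp
        fix s assume "t < s" "s < r"
        then have "ereal s \<le> \<tau> \<omega>" using r by (meson ereal_less_eq(3) less_imp_le order_trans)
        then show "X s \<omega> = stopped_process \<tau> X s \<omega>" by (simp add: before)
      qed
      with cadlag_tendsto_right[OF cadlag \<omega> t] show ?thesis
        unfolding continuous_within before[OF less_imp_le[OF True]] by (rule Lim_transform_eventually)
    next
      case False
      have "\<forall>\<^sub>F s in at_right t. stopped_process \<tau> X s \<omega> = stopped_process \<tau> X t \<omega>"
        unfolding eventually_at_right_field
      proof (intro exI[of _ "t + 1"] conjI allI impI)
        fix s assume "t < s" "s < t + 1"
        then have "\<tau> \<omega> \<le> ereal s" using False by (meson ereal_less_eq(3) less_imp_le not_le order_trans)
        then show "stopped_process \<tau> X s \<omega> = stopped_process \<tau> X t \<omega>" using False by (simp add: after)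
      qed simp
      then show ?thesis unfolding continuous_within by (rule tendsto_eventually)
    qed
  show "\<exists>l. ((\<lambda>s. stopped_process \<tau> X s \<omega>) \<longlongrightarrow> l) (at_left t)" if t: "0 < t" for t
    proof (cases "ereal t \<le> \<tau> \<omega>")
      case True
      have "\<forall>\<^sub>F s in at_left t. X s \<omega> = stopped_process \<tau> X s \<omega>"
        unfolding eventually_at_left_field
      proof (intro exI[of _ "t - 1"] conjI allI impI)
        fix s assume "t - 1 < s" "s < t"
        then have "ereal s \<le> \<tau> \<omega>" using True by (meson ereal_less_eq(3) less_imp_le order_trans)
        then show "X s \<omega> = stopped_process \<tau> X s \<omega>" by (simp add: before)
      qed simp
      with cadlag_tendsto_left[OF cadlag \<omega> t] show ?thesis by (blast intro: Lim_transform_eventually)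
    next
      case False
      then obtain r where r: "\<tau> \<omega> < ereal r" "ereal r < ereal t" using ereal_dense2[of "\<tau> \<omega>" "ereal t"] by (auto simp: not_le)
      have "\<forall>\<^sub>F s in at_left t. stopped_process \<tau> X s \<omega> = X (real_of_ereal (\<tau> \<omega>)) \<omega>"
        unfolding eventually_at_left_field
      proof (intro exI conjI allI impI)
        show "r < t" using r by simp
        fix s assume "r < s" "s < t"
        then have "\<tau> \<omega> \<le> ereal s" using r by (meson ereal_less_eq(3) less_imp_le order_trans)
        then show "stopped_process \<tau> X s \<omega> = X (real_of_ereal (\<tau> \<omega>)) \<omega>" by (simp add: after)
      qed
      then show ?thesis by (blast intro: tendsto_eventually)
    qed
qed

end

section \<open>Passage times of the controlling processes\<close>

text \<open>\<open>B\<close> is a further predictable non-decreasing process: everything is stopped strictly before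
  it reaches \<open>w\<close>. The choices are \<open>B = H\<close>, up to a modification at time \<open>0\<close>, and \<open>B = 0\<close>.\<close>

locale stochastic_bihari = usual_filtered_prob_space P F + bihari_function \<eta> c
  for P :: "'a measure" and F :: "real \<Rightarrow> 'a measure" and \<eta> :: "real \<Rightarrow> real" and c :: real +
  fixes X A H B M :: "real \<Rightarrow> 'a \<Rightarrow> real" and t u w :: real
  assumes X: "adapted_process F X" "nonneg_process P X" "cadlag_process P X"
    and A: "predictable_process P F A" "nondecreasing_process P A" "cadlag_process P A"
    and A_0: "\<And>\<omega>. \<omega> \<in> space P \<Longrightarrow> A 0 \<omega> = 0"
    and B: "predictable_process P F B" "nondecreasing_process P B" "cadlag_process P B"
    and B_0: "\<And>\<omega>. \<omega> \<in> space P \<Longrightarrow> B 0 \<omega> < w"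
    and H: "cadlag_process P H"
    and M: "local_martingale P F M" "cadlag_process P M"
    and M_0: "\<And>\<omega>. \<omega> \<in> space P \<Longrightarrow> M 0 \<omega> = 0"
    and ineq: "\<And>s. 0 \<le> s \<Longrightarrow> AE \<omega> in P.
        X s \<omega> \<le> stieltjes_integral (\<lambda>s \<omega>. \<eta> (left_limit X s \<omega>)) A s \<omega> + M s \<omega> + H s \<omega>"
    and t: "0 \<le> t" and u: "0 < u"
begin

lemma A_mono: "\<omega> \<in> space P \<Longrightarrow> 0 \<le> x \<Longrightarrow> x \<le> y \<Longrightarrow> A x \<omega> \<le> A y \<omega>"
  using A(2) mono_onD[of "{0..}" "\<lambda>s. A s \<omega>" x y] unfolding nondecreasing_process_def by simp

lemma B_mono: "\<omega> \<in> space P \<Longrightarrow> 0 \<le> x \<Longrightarrow> x \<le> y \<Longrightarrow> B x \<omega> \<le> B y \<omega>"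
  using B(2) mono_onD[of "{0..}" "\<lambda>s. B s \<omega>" x y] unfolding nondecreasing_process_def by simp

lemma X_nonneg: "\<omega> \<in> space P \<Longrightarrow> 0 \<le> s \<Longrightarrow> 0 \<le> X s \<omega>"
  using X(2) unfolding nonneg_process_def by blast

definition Xl :: "real \<Rightarrow> 'a \<Rightarrow> real" where
  "Xl s \<omega> = (if 0 < s then left_limit X s \<omega> else 0)"

lemma Xl_nonneg: "\<omega> \<in> space P \<Longrightarrow> 0 \<le> Xl s \<omega>"
  unfolding Xl_def using left_limit_ge[OF X(3)] X_nonneg by simp

lemma Xl_measurable: "(\<lambda>(s, \<omega>). Xl s \<omega>) \<in> borel_measurable (borel \<Otimes>\<^sub>M P)"
  unfolding Xl_def by (rule left_limit_joint_measurable[OF adapted_measurable[OF X(1)] X(3)])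

lemma Xl_section_measurable: "\<omega> \<in> space P \<Longrightarrow> (\<lambda>s. Xl s \<omega>) \<in> borel_measurable borel"
  using measurable_compose[OF measurable_Pair2'[of \<omega> P borel] Xl_measurable] by simp

text \<open>The hypothesis holds outside a null set depending on the time. The null sets of the
  rational times are combined, and right-continuity does the rest. The nonnegative integral is used
  because it makes sense with no integrability condition.\<close>

lemma AE_path_inequality:
  "AE \<omega> in P. \<forall>s\<ge>0. ennreal (X s \<omega> - M s \<omega> - H s \<omega>)
     \<le> (\<integral>\<^sup>+x\<in>{0<..s}. ennreal (\<eta> (max 0 (Xl x \<omega>))) \<partial>interval_measure (\<lambda>x. A (max 0 x) \<omega>))"
proof -
  have "AE \<omega> in P. \<forall>q\<in>\<rat> \<inter> {0..}.
      X q \<omega> \<le> stieltjes_integral (\<lambda>s \<omega>. \<eta> (left_limit X s \<omega>)) A q \<omega> + M q \<omega> + H q \<omega>"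
    using ineq by (subst AE_ball_countable) (auto simp: countable_rat)
  then show ?thesis
    using AE_space
  proof eventually_elim
    case (elim \<omega>)
    then have \<omega>: "\<omega> \<in> space P" by simp
    define \<mu> where "\<mu> = interval_measure (\<lambda>x. A (max 0 x) \<omega>)"
    define f where "f x = \<eta> (max 0 (Xl x \<omega>))" for x
    define J where "J s = (\<integral>\<^sup>+x\<in>{0<..s}. ennreal (f x) \<partial>\<mu>)" for s
    have [measurable_cong]: "sets \<mu> = sets borel" unfolding \<mu>_def by simp
    have f[measurable]: "f \<in> borel_measurable borel"
      unfolding f_def using measurable_compose[OF Xl_section_measurable[OF \<omega>] measurable_ext] .
    have f_nonneg: "0 \<le> f x" for x unfolding f_def using nonneg by simp
    have \<mu>: "emeasure \<mu> {x<..y} = ennreal (A y \<omega> - A x \<omega>)" if "0 \<le> x" "x \<le> y" for x y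
    proof -
      have "mono_on {0..} (\<lambda>s. A s \<omega>)" using A(2) \<omega> unfolding nondecreasing_process_def by blast
      moreover have "continuous (at_right x) (\<lambda>s. A s \<omega>)" if "0 \<le> x" for x
        using A(3) \<omega> that unfolding cadlag_process_def by blast
      ultimately show ?thesis
        unfolding \<mu>_def using that emeasure_interval_measure_halfline[of "\<lambda>s. A s \<omega>" x y]
        by (simp add: max_absorb2)
    qed
    have rational: "ennreal (X q \<omega> - M q \<omega> - H q \<omega>) \<le> J q" if q: "q \<in> \<rat>" "0 \<le> q" for q
    proof -
      have "stieltjes_integral (\<lambda>s \<omega>. \<eta> (left_limit X s \<omega>)) A q \<omega> = (\<integral>x. indicator {0<..q} x * f x \<partial>\<mu>)"
        unfolding stieltjes_integral_def set_lebesgue_integral_def \<mu>_def[symmetric]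
      proof (rule Bochner_Integration.integral_cong[OF refl])
        have f_eq: "f x = \<eta> (left_limit X x \<omega>)" if "0 < x" for x
          using that Xl_nonneg[OF \<omega>, of x] unfolding f_def by (simp add: max_absorb2) (simp add: Xl_def)
        show "indicator {0<..q} x *\<^sub>R \<eta> (left_limit X x \<omega>) = indicator {0<..q} x * f x" for x
          by (cases "x \<in> {0<..q}") (simp_all add: f_eq)
      qed
      moreover have "X q \<omega> \<le> stieltjes_integral (\<lambda>s \<omega>. \<eta> (left_limit X s \<omega>)) A q \<omega> + M q \<omega> + H q \<omega>"
        using elim(1) q by simp
      ultimately have "X q \<omega> - M q \<omega> - H q \<omega> \<le> (\<integral>x. indicator {0<..q} x * f x \<partial>\<mu>)" by linarith
      then have "ennreal (X q \<omega> - M q \<omega> - H q \<omega>) \<le> ennreal (\<integral>x. indicator {0<..q} x * f x \<partial>\<mu>)"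
        by (rule ennreal_leI)
      \<comment> \<open>For a non-integrable integrand the Bochner integral is 0 by convention, so
        the estimate persists.\<close>
      also have "\<dots> \<le> (\<integral>\<^sup>+x. ennreal (indicator {0<..q} x * f x) \<partial>\<mu>)"
      proof (cases "integrable \<mu> (\<lambda>x. indicator {0<..q} x * f x)")
        case True
        then show ?thesis using f_nonneg by (subst nn_integral_eq_integral) auto
      next
        case False
        then show ?thesis by (simp add: not_integrable_integral_eq)
      qed
      also have "\<dots> = J q"
        unfolding J_def by (intro nn_integral_cong) (auto simp: indicator_def)
      finally show ?thesis .
    qed
    have "ennreal (X s \<omega> - M s \<omega> - H s \<omega>) \<le> J s" if s: "0 \<le> s" for s
    proof -
      have "\<forall>\<^sub>F r in at_right s. X r \<omega> < X s \<omega> + 1"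
        using cadlag_tendsto_right[OF X(3) \<omega> s] by (rule order_tendstoD) simp
      then obtain \<delta> where \<delta>: "s < \<delta>" "\<And>r. s < r \<Longrightarrow> r < \<delta> \<Longrightarrow> X r \<omega> < X s \<omega> + 1"
        unfolding eventually_at_right_field by blast
      have "\<exists>q\<in>\<rat>. s < q \<and> q < min \<delta> (s + 1 / real (Suc n))" for n
        using \<delta>(1) by (intro Rats_dense_in_real) auto
      then obtain q where q: "\<And>n. q n \<in> \<rat>" "\<And>n. s < q n" "\<And>n. q n < min \<delta> (s + 1 / real (Suc n))"
        by metis
      have q_lim: "q \<longlonglongrightarrow> s"
        by (rule tendsto_sandwich[OF _ _ tendsto_const[of s] LIMSEQ_add_inverse_Suc[of s]])
           (use q in \<open>auto intro!: always_eventually less_imp_le simp del: of_nat_Suc\<close>)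
      have right_lim: "(\<lambda>n. Y (q n) \<omega>) \<longlonglongrightarrow> Y s \<omega>" if "cadlag_process P Y" for Y
        using LIMSEQ_from_right[OF cadlag_tendsto_right[OF that \<omega> s] q(2) q_lim] .
      \<comment> \<open>Just after \<open>s\<close> the left limits of \<open>X\<close> are at most
        \<open>X s \<omega> + 1\<close>, so the integral over (s, q n] is at most \<open>K\<close>
        times the increment of \<open>A\<close>, which vanishes in the limit.\<close>
      define K where "K = \<eta> (X s \<omega> + 1)"
      have K: "0 \<le> K" unfolding K_def using X_nonneg[OF \<omega> s] by (intro nonneg) simp
      have f_le: "f x \<le> K" if "s < x" "x < \<delta>" for x
      proof -
        have "0 < x" using s that by simp
        have "left_limit X x \<omega> \<le> X s \<omega> + 1"
        proof (rule tendsto_upperbound[OF cadlag_tendsto_left[OF X(3) \<omega> \<open>0 < x\<close>]])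
          show "\<forall>\<^sub>F r in at_left x. X r \<omega> \<le> X s \<omega> + 1"
            unfolding eventually_at_left_field using \<delta>(2) that by (intro exI[of _ s]) (auto intro: less_imp_le)
        qed simp
        then show ?thesis
          unfolding f_def K_def using \<open>0 < x\<close> X_nonneg[OF \<omega> s] by (intro mono_le) (auto simp: Xl_def)
      qed
      have "ennreal (X (q n) \<omega> - M (q n) \<omega> - H (q n) \<omega>) \<le> J s + ennreal (K * (A (q n) \<omega> - A s \<omega>))" for n
      proof -
        have "ennreal (X (q n) \<omega> - M (q n) \<omega> - H (q n) \<omega>) \<le> J (q n)"
          using q s by (intro rational) (auto intro: less_imp_le le_less_trans)
        also have "J (q n) = (\<integral>\<^sup>+x. ennreal (f x) * indicator {0<..s} x + ennreal (f x) * indicator {s<..q n} x \<partial>\<mu>)"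
          unfolding J_def using q(2)[of n] s by (intro nn_integral_cong) (auto simp: indicator_def)
        also have "\<dots> = J s + (\<integral>\<^sup>+x\<in>{s<..q n}. ennreal (f x) \<partial>\<mu>)"
          unfolding J_def by (intro nn_integral_add) auto
        also have "(\<integral>\<^sup>+x\<in>{s<..q n}. ennreal (f x) \<partial>\<mu>) \<le> (\<integral>\<^sup>+x. ennreal K * indicator {s<..q n} x \<partial>\<mu>)"
          using f_le q(3)[of n] by (intro nn_integral_mono) (auto simp: indicator_def intro!: ennreal_leI)
        also have "\<dots> = ennreal (K * (A (q n) \<omega> - A s \<omega>))"
          using \<mu>[of s "q n"] q(2)[of n] s K
          by (subst nn_integral_cmult_indicator) (auto simp: ennreal_mult' less_imp_le)
        finally show ?thesis by (simp add: add_left_mono)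
      qed
      moreover have "(\<lambda>n. ennreal (X (q n) \<omega> - M (q n) \<omega> - H (q n) \<omega>)) \<longlonglongrightarrow> ennreal (X s \<omega> - M s \<omega> - H s \<omega>)"
        by (intro tendsto_ennrealI tendsto_diff right_lim X(3) M(2) H)
      moreover have "(\<lambda>n. J s + ennreal (K * (A (q n) \<omega> - A s \<omega>))) \<longlonglongrightarrow> J s + ennreal (K * (A s \<omega> - A s \<omega>))"
        by (intro tendsto_add tendsto_ennrealI tendsto_diff tendsto_mult tendsto_const right_lim A(3))
      ultimately show ?thesis by (intro LIMSEQ_le[where Y="\<lambda>n. J s + ennreal (K * (A (q n) \<omega> - A s \<omega>))"]) auto
    qed
    then show ?case unfolding J_def \<mu>_def f_def by blast
  qed
qed

text \<open>The time \<open>\<sigma>\<^sub>a\<close> of the overview, anticipated by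
  \<open>B\<close> reaching \<open>w\<close>. The cap lies beyond \<open>t\<close>, so that
  \<open>t < hit a \<omega>\<close> can express that neither level is reached by time
  \<open>t\<close>.\<close>

definition hit :: "real \<Rightarrow> 'a \<Rightarrow> real" where
  "hit a \<omega> = Inf (insert (t + 1) {s. 0 \<le> s \<and> (a \<le> A s \<omega> \<or> w \<le> B s \<omega>)})"

lemma hit_bdd: "bdd_below (insert (t + 1) {s. 0 \<le> s \<and> (a \<le> A s \<omega> \<or> w \<le> B s \<omega>)})"
  using t by (intro bdd_belowI[of _ 0]) auto

lemma hit_le: "0 \<le> s \<Longrightarrow> a \<le> A s \<omega> \<or> w \<le> B s \<omega> \<Longrightarrow> hit a \<omega> \<le> s"
  unfolding hit_def using hit_bdd by (intro cInf_lower) auto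

lemma hit_le_horizon: "hit a \<omega> \<le> t + 1"
  unfolding hit_def using hit_bdd by (intro cInf_lower) auto

lemma hit_nonneg: "0 \<le> hit a \<omega>"
  unfolding hit_def using t by (intro cInf_greatest) auto

text \<open>By right-continuity the infimum is attained below the cap, and monotonicity extends this
  to later times. This equivalence is the inverse relation that
  \<open>stieltjes_substitution\<close> asks for.\<close>

lemma hit_le_iff:
  assumes \<omega>: "\<omega> \<in> space P" and x: "0 \<le> x" "x < t + 1"
  shows "hit a \<omega> \<le> x \<longleftrightarrow> a \<le> A x \<omega> \<or> w \<le> B x \<omega>"
proof
  assume le: "hit a \<omega> \<le> x"
  let ?z = "hit a \<omega>"
  have "a \<le> A ?z \<omega> \<or> w \<le> B ?z \<omega>"
  proof (rule ccontr)
    assume "\<not> ?thesis"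
    then have z: "A ?z \<omega> < a" "B ?z \<omega> < w" by auto
    have "\<forall>\<^sub>F r in at_right ?z. A r \<omega> < a \<and> B r \<omega> < w"
      using order_tendstoD(2)[OF cadlag_tendsto_right[OF A(3) \<omega> hit_nonneg] z(1)]
        order_tendstoD(2)[OF cadlag_tendsto_right[OF B(3) \<omega> hit_nonneg] z(2)]
      by eventually_elim simp
    then obtain b where b: "?z < b" "\<And>r. ?z < r \<Longrightarrow> r < b \<Longrightarrow> A r \<omega> < a \<and> B r \<omega> < w"
      unfolding eventually_at_right_field by blast
    have "?z < min b (t + 1)" using b(1) le x by simp
    then obtain s where s: "s \<in> insert (t + 1) {s. 0 \<le> s \<and> (a \<le> A s \<omega> \<or> w \<le> B s \<omega>)}" "s < min b (t + 1)"
      unfolding hit_def by (subst (asm) cInf_less_iff[OF _ hit_bdd]) auto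
    then have s': "0 \<le> s" "a \<le> A s \<omega> \<or> w \<le> B s \<omega>" by auto
    then have "?z \<le> s" by (rule hit_le)
    then show False using z b(2)[of s] s s' by (cases "?z = s") auto
  qed
  then show "a \<le> A x \<omega> \<or> w \<le> B x \<omega>"
    using A_mono[OF \<omega> hit_nonneg le] B_mono[OF \<omega> hit_nonneg le] by linarith
qed (use hit_le x in blast)

text \<open>Uses that \<open>A\<close> and \<open>B\<close> both start strictly below their levels;
  left limits at \<open>hit a \<omega>\<close> then make sense.\<close>

lemma hit_pos: "\<omega> \<in> space P \<Longrightarrow> 0 < a \<Longrightarrow> 0 < hit a \<omega>"
  using hit_le_iff[of \<omega> 0 a] A_0[of \<omega>] B_0[of \<omega>] t by fastforce

lemma hit_measurable: "(\<lambda>(a, \<omega>). hit a \<omega>) \<in> borel_measurable (borel \<Otimes>\<^sub>M P)"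
  unfolding borel_measurable_iff_le
proof
  fix x
  consider "x < 0" | "0 \<le> x" "x < t + 1" | "t + 1 \<le> x" by linarith
  then show "{p \<in> space (borel \<Otimes>\<^sub>M P). (case p of (a, \<omega>) \<Rightarrow> hit a \<omega>) \<le> x} \<in> sets (borel \<Otimes>\<^sub>M P)"
  proof cases
    case 1
    then have "{p \<in> space (borel \<Otimes>\<^sub>M P). (case p of (a, \<omega>) \<Rightarrow> hit a \<omega>) \<le> x} = {}"
      using hit_nonneg by (auto simp: not_le intro: less_le_trans)
    then show ?thesis by (simp only: sets.empty_sets)
  next
    case 2
    have [measurable]: "A x \<in> borel_measurable P" "B x \<in> borel_measurable P"
      using A B 2 by (auto intro: predictable_measurable)
    have "{p \<in> space (borel \<Otimes>\<^sub>M P). (case p of (a, \<omega>) \<Rightarrow> hit a \<omega>) \<le> x}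
        = {p \<in> space (borel \<Otimes>\<^sub>M P). fst p \<le> A x (snd p) \<or> w \<le> B x (snd p)}"
      using 2 by (auto simp: hit_le_iff space_pair_measure)
    also have "\<dots> \<in> sets (borel \<Otimes>\<^sub>M P)" by measurable
    finally show ?thesis .
  next
    case 3
    then have "{p \<in> space (borel \<Otimes>\<^sub>M P). (case p of (a, \<omega>) \<Rightarrow> hit a \<omega>) \<le> x} = space (borel \<Otimes>\<^sub>M P)"
      using order_trans[OF hit_le_horizon 3] by auto
    then show ?thesis by (simp only: sets.top)
  qed
qed

lemma hit_at_measurable: "hit a \<in> borel_measurable P"
  using measurable_compose[OF measurable_Pair1'[of a borel P] hit_measurable] by simp

lemma hit_section_measurable: "\<omega> \<in> space P \<Longrightarrow> (\<lambda>a. hit a \<omega>) \<in> borel_measurable borel"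
  using measurable_compose[OF measurable_Pair2'[of \<omega> P borel] hit_measurable] by simp

text \<open>Here predictability of \<open>A\<close> and \<open>B\<close> enters beyond measurability
  at fixed times: \<open>hit a\<close> is the capped debut of this set, so it can be
  announced.\<close>

lemma hit_region_predictable:
  "{(s, \<omega>). 0 \<le> s \<and> \<omega> \<in> space P \<and> (a \<le> A s \<omega> \<or> w \<le> B s \<omega>)} \<in> sets (predictable_sigma P F)"
proof -
  have [measurable]: "(\<lambda>p. A (fst p) (snd p)) \<in> borel_measurable (predictable_sigma P F)"
    "(\<lambda>p. B (fst p) (snd p)) \<in> borel_measurable (predictable_sigma P F)"
    using A(1) B(1) unfolding predictable_process_def case_prod_beta by blast+
  have "{(s, \<omega>). 0 \<le> s \<and> \<omega> \<in> space P \<and> (a \<le> A s \<omega> \<or> w \<le> B s \<omega>)}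
      = {p \<in> space (predictable_sigma P F). a \<le> A (fst p) (snd p) \<or> w \<le> B (fst p) (snd p)}"
    unfolding space_predictable_sigma by auto
  also have "\<dots> \<in> sets (predictable_sigma P F)" by measurable
  finally show ?thesis .
qed

text \<open>The argument of \<open>\<eta>\<close> after the time change, set to 0 once
  \<open>hit a\<close> lies beyond \<open>T\<close>.\<close>

definition level :: "('a \<Rightarrow> real) \<Rightarrow> real \<Rightarrow> 'a \<Rightarrow> real" where
  "level T a \<omega> = (if hit a \<omega> \<le> T \<omega> then Xl (hit a \<omega>) \<omega> else 0)"

abbreviation stopped_value :: "('a \<Rightarrow> real) \<Rightarrow> real \<Rightarrow> 'a \<Rightarrow> real" where
  "stopped_value T b \<equiv> value_before X T (hit b)"

lemma level_nonneg: "\<omega> \<in> space P \<Longrightarrow> 0 \<le> level T a \<omega>"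
  unfolding level_def using Xl_nonneg by simp

text \<open>Strictly before the first passage \<open>X\<close> is at most \<open>u\<close>, and a
  left limit taken up to that time sees nothing of a jump above \<open>u\<close>.\<close>

lemma level_le:
  assumes "\<omega> \<in> space P" "T \<omega> \<le> first_above X u (t + 1) \<omega>"
  shows "level T a \<omega> \<le> u"
proof (cases "hit a \<omega> \<le> T \<omega> \<and> 0 < hit a \<omega>")
  case True
  have "left_limit X (hit a \<omega>) \<omega> \<le> u"
  proof (rule left_limit_le[OF X(3) assms(1)])
    show "X r \<omega> \<le> u" if "0 \<le> r" "r < hit a \<omega>" for r
      using t that(1) order.strict_trans2[OF that(2) order_trans[OF conjunct1[OF True] assms(2)]]
      by (intro before_first_above[where L="t + 1" and X=X]) simp_all
  qed (use True in simp)
  then show ?thesis using True unfolding level_def Xl_def by simp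
next
  case False
  then show ?thesis using u unfolding level_def Xl_def by auto
qed

lemma level_measurable:
  assumes [measurable]: "T \<in> borel_measurable P"
  shows "(\<lambda>(a, \<omega>). level T a \<omega>) \<in> borel_measurable (borel \<Otimes>\<^sub>M P)"
proof -
  note [measurable] = hit_measurable
  have "(\<lambda>p. (hit (fst p) (snd p), snd p)) \<in> borel \<Otimes>\<^sub>M P \<rightarrow>\<^sub>M borel \<Otimes>\<^sub>M P"
    using hit_measurable by (intro measurable_Pair measurable_snd) (simp add: case_prod_beta)
  from measurable_compose[OF this Xl_measurable]
  have [measurable]: "(\<lambda>p. Xl (hit (fst p) (snd p)) (snd p)) \<in> borel_measurable (borel \<Otimes>\<^sub>M P)" by simp
  have [measurable]: "(\<lambda>p. hit (fst p) (snd p)) \<in> borel_measurable (borel \<Otimes>\<^sub>M P)"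
    using hit_measurable by (simp add: case_prod_beta)
  show ?thesis unfolding level_def case_prod_beta by measurable
qed

lemma \<eta>_level_measurable:
  assumes "T \<in> borel_measurable P"
  shows "(\<lambda>(a, \<omega>). \<eta> (level T a \<omega>)) \<in> borel_measurable (borel \<Otimes>\<^sub>M P)"
proof (rule measurable_cong[THEN iffD1])
  show "(\<lambda>p. \<eta> (max 0 (case p of (a, \<omega>) \<Rightarrow> level T a \<omega>))) \<in> borel_measurable (borel \<Otimes>\<^sub>M P)"
    using measurable_compose[OF level_measurable[OF assms] measurable_ext] .
  show "\<eta> (max 0 (case p of (a, \<omega>) \<Rightarrow> level T a \<omega>)) = (case p of (a, \<omega>) \<Rightarrow> \<eta> (level T a \<omega>))"
    if "p \<in> space (borel \<Otimes>\<^sub>M P)" for p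
    using that level_nonneg by (auto simp: space_pair_measure max_absorb2)
qed

context
  fixes T :: "'a \<Rightarrow> real"
  assumes T: "opt_time T" and T_le: "\<And>\<omega>. \<omega> \<in> space P \<Longrightarrow> T \<omega> \<le> t"
    and T_first: "\<And>\<omega>. \<omega> \<in> space P \<Longrightarrow> T \<omega> \<le> first_above X u (t + 1) \<omega>"
begin

lemma \<eta>_level_bounds: "\<omega> \<in> space P \<Longrightarrow> 0 \<le> \<eta> (level T a \<omega>) \<and> \<eta> (level T a \<omega>) \<le> \<eta> u"
  using level_nonneg level_le[where T=T, OF _ T_first] by (auto intro: nonneg mono_le)

lemma \<eta>_level_section:
  assumes "\<omega> \<in> space P"
  shows "(\<lambda>a. \<eta> (level T a \<omega>)) \<in> borel_measurable borel"
  using measurable_compose[OF measurable_Pair2'[OF assms] \<eta>_level_measurable[OF opt_time_measurable[OF T]]]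
  by simp

lemma \<eta>_level_at:
  "(\<lambda>\<omega>. \<eta> (level T a \<omega>)) \<in> borel_measurable P"
  using measurable_compose[OF measurable_Pair1'[of a borel P] \<eta>_level_measurable[OF opt_time_measurable[OF T]]]
  by simp

lemma level_at: "(\<lambda>\<omega>. level T a \<omega>) \<in> borel_measurable P"
  using measurable_compose[OF measurable_Pair1'[of a borel P] level_measurable[OF opt_time_measurable[OF T]]]
  by simp

lemma \<eta>_level_set_integrable:
  assumes "\<omega> \<in> space P"
  shows "set_integrable lborel {0..b} (\<lambda>a. \<eta> (level T a \<omega>))"
  unfolding set_integrable_def
proof (rule Bochner_Integration.integrable_bound)
  show "integrable lborel (\<lambda>a. indicator {0..b} a *\<^sub>R \<eta> u)"
    using integrable_real_indicator[of "{0..b}" lborel] by (simp add: emeasure_lborel_Icc_eq)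
  have [measurable]: "(\<lambda>a. \<eta> (level T a \<omega>)) \<in> borel_measurable borel" using assms by (rule \<eta>_level_section)
  show "(\<lambda>a. indicator {0..b} a *\<^sub>R \<eta> (level T a \<omega>)) \<in> borel_measurable lborel" by measurable
  show "AE a in lborel. norm (indicator {0..b} a *\<^sub>R \<eta> (level T a \<omega>)) \<le> norm (indicator {0..b} a *\<^sub>R \<eta> u)"
    using \<eta>_level_bounds[OF assms] nonneg[of u] u by (intro AE_I2) (auto simp: indicator_def)
qed

text \<open>Before \<open>hit b\<close> both \<open>A s < b\<close> and \<open>B s < w\<close> hold.
  The second makes \<open>hit\<close>, on [0, s], the inverse of \<open>A\<close> alone, so the
  substitution applies; the first allows the range (0, A s] to be enlarged to [0, b], which no
  longer depends on the path.\<close>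

lemma path_bound:
  assumes \<omega>: "\<omega> \<in> space P"
    and path: "\<forall>s\<ge>0. ennreal (X s \<omega> - M s \<omega> - H s \<omega>)
     \<le> (\<integral>\<^sup>+x\<in>{0<..s}. ennreal (\<eta> (max 0 (Xl x \<omega>))) \<partial>interval_measure (\<lambda>x. A (max 0 x) \<omega>))"
    and s: "0 \<le> s" "s \<le> T \<omega>" "s < hit b \<omega>"
  shows "X s \<omega> \<le> (LINT a:{0..b}|lborel. \<eta> (level T a \<omega>)) + M s \<omega> + H s \<omega>"
proof -
  have "s \<le> t" using s T_le[OF \<omega>] by simp
  have AB: "A s \<omega> < b" "B s \<omega> < w"
    using hit_le_iff[OF \<omega>, of s b] s \<open>s \<le> t\<close> by auto
  have inverse: "hit a \<omega> \<le> x \<longleftrightarrow> a \<le> A x \<omega>" if "0 \<le> x" "x \<le> s" for a x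
    using hit_le_iff[OF \<omega>, of x a] B_mono[OF \<omega> that] AB(2) that \<open>s \<le> t\<close> by auto
  have meas: "(\<lambda>x. ennreal (\<eta> (max 0 (Xl x \<omega>)))) \<in> borel_measurable borel"
    using measurable_compose[OF Xl_section_measurable[OF \<omega>] measurable_ext] by measurable
  have "ennreal (X s \<omega> - M s \<omega> - H s \<omega>)
      \<le> (\<integral>\<^sup>+x\<in>{0<..s}. ennreal (\<eta> (max 0 (Xl x \<omega>))) \<partial>interval_measure (\<lambda>x. A (max 0 x) \<omega>))"
    using path s by blast
  also have "\<dots> = (\<integral>\<^sup>+a\<in>{0<..A s \<omega>}. ennreal (\<eta> (max 0 (Xl (hit a \<omega>) \<omega>))) \<partial>lborel)"
  proof (rule stieltjes_substitution)
    show "mono_on {0..} (\<lambda>s. A s \<omega>)" using A(2) \<omega> unfolding nondecreasing_process_def by blast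
    show "continuous (at_right x) (\<lambda>s. A s \<omega>)" if "0 \<le> x" for x
      using A(3) \<omega> that unfolding cadlag_process_def by blast
  qed (use A_0[OF \<omega>] s inverse hit_section_measurable[OF \<omega>] meas in auto)
  also have "\<dots> \<le> (\<integral>\<^sup>+a. ennreal (indicator {0..b} a * \<eta> (level T a \<omega>)) \<partial>lborel)"
  proof (rule nn_integral_mono)
    fix a
    show "ennreal (\<eta> (max 0 (Xl (hit a \<omega>) \<omega>))) * indicator {0<..A s \<omega>} a
        \<le> ennreal (indicator {0..b} a * \<eta> (level T a \<omega>))"
    proof (cases "a \<in> {0<..A s \<omega>}")
      case True
      then have "hit a \<omega> \<le> s" using inverse[OF s(1) order_refl] by simp
      then have "level T a \<omega> = Xl (hit a \<omega>) \<omega>" unfolding level_def using s by simp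
      then show ?thesis using True AB(1) Xl_nonneg[OF \<omega>] by (simp add: max_absorb2)
    qed simp
  qed
  also have "\<dots> = ennreal (LINT a:{0..b}|lborel. \<eta> (level T a \<omega>))"
    using \<eta>_level_set_integrable[OF \<omega>, of b] \<eta>_level_bounds[OF \<omega>]
    unfolding set_integrable_def set_lebesgue_integral_def by (subst nn_integral_eq_integral) auto
  finally have le: "ennreal (X s \<omega> - M s \<omega> - H s \<omega>) \<le> ennreal (LINT a:{0..b}|lborel. \<eta> (level T a \<omega>))" .
  \<comment> \<open>Removing \<open>ennreal\<close> requires a nonnegative right-hand side; the
    left-hand side may be negative.\<close>
  have "0 \<le> (LINT a:{0..b}|lborel. \<eta> (level T a \<omega>))"
    unfolding set_lebesgue_integral_def using \<eta>_level_bounds[OF \<omega>] by (intro integral_nonneg_AE) auto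
  with le show ?thesis by simp
qed

lemma stopped_value_nonneg: "\<omega> \<in> space P \<Longrightarrow> 0 < b \<Longrightarrow> 0 \<le> stopped_value T b \<omega>"
  unfolding value_before_def
  using X_nonneg opt_time_nonneg[OF T] left_limit_ge[OF X(3), of \<omega> "hit b \<omega>" 0] hit_pos by auto

lemma stopped_value_measurable:
  assumes "0 < b"
  shows "stopped_value T b \<in> borel_measurable P"
proof -
  note meas = adapted_measurable[OF X(1)]
  note [measurable] = opt_time_measurable[OF T] hit_at_measurable
    cadlag_at_time_measurable[OF meas X(3) opt_time_measurable[OF T] opt_time_nonneg[OF T]]
    left_limit_at_time_measurable[OF meas X(3) hit_at_measurable hit_pos[OF _ assms]]
  show ?thesis unfolding value_before_def by measurable
qed

text \<open>This closes the loop: the quantity bounded by the integral inequality dominates the one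
  inside the integral. If \<open>hit b \<le> T\<close>, both are the left limit of \<open>X\<close>;
  otherwise \<open>level\<close> is 0.\<close>

lemma level_le_stopped_value: "\<omega> \<in> space P \<Longrightarrow> 0 < b \<Longrightarrow> level T b \<omega> \<le> stopped_value T b \<omega>"
  using stopped_value_nonneg[of \<omega> b] hit_pos[of \<omega> b]
  unfolding level_def value_before_def Xl_def by auto

lemma \<eta>_level_product_integrable:
  assumes [measurable]: "C \<in> sets P"
  shows "integrable (lborel \<Otimes>\<^sub>M P) (\<lambda>(a, \<omega>). indicator {0..b} a * (indicator C \<omega> * \<eta> (level T a \<omega>)))"
proof -
  note [measurable] = \<eta>_level_measurable[OF opt_time_measurable[OF T]]
  show ?thesis
  proof (rule Bochner_Integration.integrable_bound)
    have "emeasure (lborel \<Otimes>\<^sub>M P) ({0..b} \<times> space P) < \<infinity>"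
      by (simp add: emeasure_pair_measure_Times emeasure_lborel_Icc_eq emeasure_space_1)
    then show "integrable (lborel \<Otimes>\<^sub>M P) (\<lambda>p. indicator ({0..b} \<times> space P) p * \<eta> u)"
      using integrable_real_indicator[of "{0..b} \<times> space P" "lborel \<Otimes>\<^sub>M P"] by simp
    have "(\<lambda>p. \<eta> (level T (fst p) (snd p))) \<in> borel_measurable (lborel \<Otimes>\<^sub>M P)"
      using \<eta>_level_measurable[OF opt_time_measurable[OF T]]
      by (simp add: case_prod_beta cong: measurable_cong_sets)
    then show "(\<lambda>(a, \<omega>). indicator {0..b} a * (indicator C \<omega> * \<eta> (level T a \<omega>))) \<in> borel_measurable (lborel \<Otimes>\<^sub>M P)"
      unfolding case_prod_beta by measurable
    have "norm (case p of (a, \<omega>) \<Rightarrow> indicator {0..b} a * (indicator C \<omega> * \<eta> (level T a \<omega>)))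
        \<le> norm (indicator ({0..b} \<times> space P) p * \<eta> u)" if "p \<in> space (lborel \<Otimes>\<^sub>M P)" for p
      using that \<eta>_level_bounds nonneg[of u] u by (auto simp: space_pair_measure indicator_def)
    then show "AE p in lborel \<Otimes>\<^sub>M P. norm (case p of (a, \<omega>) \<Rightarrow> indicator {0..b} a * (indicator C \<omega> * \<eta> (level T a \<omega>)))
        \<le> norm (indicator ({0..b} \<times> space P) p * \<eta> u)" by (rule AE_I2)
  qed
qed

lemma \<eta>_level_Fubini:
  assumes C: "C \<in> sets P"
  shows "(\<integral>\<omega>\<in>C. (LINT a:{0..b}|lborel. \<eta> (level T a \<omega>)) \<partial>P) = (LINT a:{0..b}|lborel. (\<integral>\<omega>\<in>C. \<eta> (level T a \<omega>) \<partial>P))"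
    and "integrable P (\<lambda>\<omega>. indicator C \<omega> * (LINT a:{0..b}|lborel. \<eta> (level T a \<omega>)))"
proof -
  interpret pair_sigma_finite lborel P ..
  note int = \<eta>_level_product_integrable[OF C, of b]
  have swap: "indicator C \<omega> * (LINT a:{0..b}|lborel. \<eta> (level T a \<omega>))
      = (LINT a|lborel. indicator {0..b} a * (indicator C \<omega> * \<eta> (level T a \<omega>)))" for \<omega>
    unfolding set_lebesgue_integral_def
    by (subst integral_mult_right_zero[symmetric]) (simp add: mult.left_commute)
  show "integrable P (\<lambda>\<omega>. indicator C \<omega> * (LINT a:{0..b}|lborel. \<eta> (level T a \<omega>)))"
    unfolding swap using integrable_snd[OF int] .
  have "(\<integral>\<omega>\<in>C. (LINT a:{0..b}|lborel. \<eta> (level T a \<omega>)) \<partial>P)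
      = (\<integral>\<omega>. (LINT a|lborel. indicator {0..b} a * (indicator C \<omega> * \<eta> (level T a \<omega>))) \<partial>P)"
    unfolding set_lebesgue_integral_def[of P] real_scaleR_def swap ..
  also have "\<dots> = (LINT a|lborel. \<integral>\<omega>. indicator {0..b} a * (indicator C \<omega> * \<eta> (level T a \<omega>)) \<partial>P)"
    using int by (rule Fubini_integral)
  also have "\<dots> = (LINT a:{0..b}|lborel. (\<integral>\<omega>\<in>C. \<eta> (level T a \<omega>) \<partial>P))"
    unfolding set_lebesgue_integral_def by simp
  finally show "(\<integral>\<omega>\<in>C. (LINT a:{0..b}|lborel. \<eta> (level T a \<omega>)) \<partial>P)
      = (LINT a:{0..b}|lborel. (\<integral>\<omega>\<in>C. \<eta> (level T a \<omega>) \<partial>P))" .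
qed

context
  fixes N :: "real \<Rightarrow> 'a \<Rightarrow> real" and C :: "'a set" and h :: "'a \<Rightarrow> real"
  assumes N: "martingale_process P F N" "cadlag_process P N"
    and N_0: "\<And>\<omega>. \<omega> \<in> space P \<Longrightarrow> N 0 \<omega> = 0"
    and N_eq: "\<And>\<omega> s. \<omega> \<in> space P \<Longrightarrow> 0 \<le> s \<Longrightarrow> s \<le> T \<omega> \<Longrightarrow> N s \<omega> = M s \<omega>"
    and C: "C \<in> sets (F 0)"
    and h: "integrable P h"
    and H_le: "\<And>\<omega> s. \<omega> \<in> C \<Longrightarrow> 0 \<le> s \<Longrightarrow> s \<le> t \<Longrightarrow> B s \<omega> < w \<Longrightarrow> H s \<omega> \<le> h \<omega>"
begin

lemma C_event: "C \<in> sets P"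
  using sets_F_subset[OF order_refl C] .

text \<open>The pathwise bound, at \<open>T\<close> or in the limit just before
  \<open>hit b\<close>, is integrated over \<open>C\<close>. The martingale part has integral 0
  because \<open>hit b\<close> is the capped debut of a predictable set and \<open>N\<close> starts
  at 0; \<open>N\<close> stands for the localised \<open>M\<close>, and \<open>h\<close> for a bound
  on \<open>H\<close> while \<open>B\<close> is below \<open>w\<close>.\<close>

lemma stopped_value_integral:
  assumes "0 < b"
  shows "integrable P (\<lambda>\<omega>. indicator C \<omega> * stopped_value T b \<omega>)"
    and "(\<integral>\<omega>\<in>C. stopped_value T b \<omega> \<partial>P)
      \<le> (LINT a:{0..b}|lborel. (\<integral>\<omega>\<in>C. \<eta> (level T a \<omega>) \<partial>P)) + (\<integral>\<omega>\<in>C. h \<omega> \<partial>P)"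
proof -
  note [measurable] = C_event
  define J where "J \<omega> = (LINT a:{0..b}|lborel. \<eta> (level T a \<omega>))" for \<omega>
  define Z where "Z = value_before N T (hit b)"
  have samp: "sampled (N (t + 1)) Z"
    unfolding Z_def
  proof (rule sampled_before_predictable_debut[OF N T T_le t hit_at_measurable hit_pos[OF _ \<open>0 < b\<close>]
        hit_le_horizon hit_region_predictable])
    show "(hit b \<omega>, \<omega>) \<in> {(s, \<omega>). 0 \<le> s \<and> \<omega> \<in> space P \<and> (b \<le> A s \<omega> \<or> w \<le> B s \<omega>)}"
      if "\<omega> \<in> space P" "hit b \<omega> < t + 1" for \<omega>
      using that hit_nonneg hit_le_iff[of \<omega> "hit b \<omega>" b] by auto
    show "hit b \<omega> \<le> s" if "(s, \<omega>) \<in> {(s, \<omega>). 0 \<le> s \<and> \<omega> \<in> space P \<and> (b \<le> A s \<omega> \<or> w \<le> B s \<omega>)}" for \<omega> s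
      using that by (auto intro: hit_le)
  qed
  have intN: "integrable P (N s)" if "0 \<le> s" for s using N(1) that unfolding martingale_process_def by blast
  have intZ: "integrable P Z" using t by (intro sampled_integrable[OF samp intN]) simp
  have "(\<integral>\<omega>\<in>C. Z \<omega> \<partial>P) = (\<integral>\<omega>\<in>C. N (t + 1) \<omega> \<partial>P)" using samp C unfolding sampled_def by blast
  also have "\<dots> = (\<integral>\<omega>\<in>C. N 0 \<omega> \<partial>P)" using t by (intro martingale_set_integral[OF N(1) _ _ C, symmetric]) auto
  also have "\<dots> = (\<integral>\<omega>. 0 \<partial>P)"
    unfolding set_lebesgue_integral_def by (intro Bochner_Integration.integral_cong) (auto simp: N_0)
  finally have Z0: "(\<integral>\<omega>\<in>C. Z \<omega> \<partial>P) = 0" by simp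
  have bound: "AE \<omega> in P. indicator C \<omega> * stopped_value T b \<omega> \<le> indicator C \<omega> * J \<omega> + indicator C \<omega> * Z \<omega> + indicator C \<omega> * h \<omega>"
    using AE_path_inequality AE_space
  proof eventually_elim
    case (elim \<omega>)
    then have \<omega>: "\<omega> \<in> space P" by simp
    show ?case
    proof (cases "\<omega> \<in> C")
      case True
      have le: "X s \<omega> \<le> J \<omega> + N s \<omega> + h \<omega>" if s: "0 \<le> s" "s \<le> T \<omega>" "s < hit b \<omega>" for s
      proof -
        have "s \<le> t" using s T_le[OF \<omega>] by simp
        then have "B s \<omega> < w" using hit_le_iff[OF \<omega>, of s b] s by auto
        then have "H s \<omega> \<le> h \<omega>" using H_le True s(1) \<open>s \<le> t\<close> by blast
        moreover have "X s \<omega> \<le> J \<omega> + M s \<omega> + H s \<omega>"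
          unfolding J_def using \<omega> elim(1) s by (rule path_bound)
        ultimately show ?thesis using N_eq[OF \<omega> s(1,2)] by simp
      qed
      have "stopped_value T b \<omega> \<le> J \<omega> + Z \<omega> + h \<omega>"
      proof (cases "T \<omega> < hit b \<omega>")
        case True
        then show ?thesis
          unfolding Z_def value_before_def using le[of "T \<omega>"] opt_time_nonneg[OF T \<omega>] by simp
      next
        case False
        have pos: "0 < hit b \<omega>" using \<omega> \<open>0 < b\<close> by (rule hit_pos)
        have left: "(\<lambda>n. Y (grid_down n (hit b \<omega>)) \<omega>) \<longlonglongrightarrow> left_limit Y (hit b \<omega>) \<omega>" if "cadlag_process P Y" for Y
          using LIMSEQ_from_left[OF cadlag_tendsto_left[OF that \<omega> pos] grid_down_bounds(1)[OF pos] grid_down_LIMSEQ[OF pos]] .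
        have "left_limit X (hit b \<omega>) \<omega> \<le> J \<omega> + left_limit N (hit b \<omega>) \<omega> + h \<omega>"
        proof (rule LIMSEQ_le[OF left[OF X(3)]])
          show "(\<lambda>n. J \<omega> + N (grid_down n (hit b \<omega>)) \<omega> + h \<omega>) \<longlonglongrightarrow> J \<omega> + left_limit N (hit b \<omega>) \<omega> + h \<omega>"
            by (intro tendsto_add tendsto_const left N)
          have "X (grid_down n (hit b \<omega>)) \<omega> \<le> J \<omega> + N (grid_down n (hit b \<omega>)) \<omega> + h \<omega>" for n
            by (rule le) (use grid_down_bounds[OF pos, of n] False in linarith)+
          then show "\<exists>n0. \<forall>n\<ge>n0. X (grid_down n (hit b \<omega>)) \<omega> \<le> J \<omega> + N (grid_down n (hit b \<omega>)) \<omega> + h \<omega>" by blast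
        qed
        then show ?thesis using False unfolding Z_def value_before_def by simp
      qed
      then show ?thesis using True by simp
    qed simp
  qed
  have int: "integrable P (\<lambda>\<omega>. indicator C \<omega> * J \<omega>)" "integrable P (\<lambda>\<omega>. indicator C \<omega> * Z \<omega>)"
    "integrable P (\<lambda>\<omega>. indicator C \<omega> * h \<omega>)"
    unfolding J_def using \<eta>_level_Fubini(2)[OF C_event]
      integrable_mult_indicator[OF C_event intZ] integrable_mult_indicator[OF C_event h] by simp_all
  then have int_sum: "integrable P (\<lambda>\<omega>. indicator C \<omega> * J \<omega> + indicator C \<omega> * Z \<omega> + indicator C \<omega> * h \<omega>)"
    by (intro Bochner_Integration.integrable_add)
  show int_Y: "integrable P (\<lambda>\<omega>. indicator C \<omega> * stopped_value T b \<omega>)"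
  proof (rule Bochner_Integration.integrable_bound[OF int_sum])
    note [measurable] = stopped_value_measurable[OF \<open>0 < b\<close>]
    show "(\<lambda>\<omega>. indicator C \<omega> * stopped_value T b \<omega>) \<in> borel_measurable P" by measurable
    show "AE \<omega> in P. norm (indicator C \<omega> * stopped_value T b \<omega>)
        \<le> norm (indicator C \<omega> * J \<omega> + indicator C \<omega> * Z \<omega> + indicator C \<omega> * h \<omega>)"
      using bound AE_space
    proof eventually_elim
      case (elim \<omega>)
      have "0 \<le> indicator C \<omega> * stopped_value T b \<omega>" using stopped_value_nonneg[OF elim(2) \<open>0 < b\<close>] by simp
      with elim(1) show ?case by (simp only: real_norm_def)
    qed
  qed
  have "(\<integral>\<omega>\<in>C. stopped_value T b \<omega> \<partial>P) \<le> (\<integral>\<omega>. indicator C \<omega> * J \<omega> + indicator C \<omega> * Z \<omega> + indicator C \<omega> * h \<omega> \<partial>P)"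
    unfolding set_lebesgue_integral_def real_scaleR_def using int_Y int_sum bound by (rule integral_mono_AE)
  also have "\<dots> = (\<integral>\<omega>\<in>C. J \<omega> \<partial>P) + (\<integral>\<omega>\<in>C. Z \<omega> \<partial>P) + (\<integral>\<omega>\<in>C. h \<omega> \<partial>P)"
    unfolding set_lebesgue_integral_def real_scaleR_def using int by simp
  finally show "(\<integral>\<omega>\<in>C. stopped_value T b \<omega> \<partial>P)
      \<le> (LINT a:{0..b}|lborel. (\<integral>\<omega>\<in>C. \<eta> (level T a \<omega>) \<partial>P)) + (\<integral>\<omega>\<in>C. h \<omega> \<partial>P)"
    unfolding Z0 J_def \<eta>_level_Fubini(1)[OF C_event] by simp
qed

text \<open>The tangent of the concave function \<open>\<eta>\<close> at the current bound plays the role of Jensen's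
  inequality under \<open>P\<close> conditioned on \<open>C\<close>.\<close>

lemma stopped_value_integral_less:
  assumes p: "0 < prob C" and r: "0 < r" "(\<integral>\<omega>\<in>C. h \<omega> \<partial>P) \<le> r * prob C"
    and "0 < b" and y: "0 < y" "G r + ereal b < G y"
  shows "(\<integral>\<omega>\<in>C. stopped_value T b \<omega> \<partial>P) \<le> y * prob C"
proof -
  note [measurable] = C_event
  let ?p = "prob C"
  define v where "v a = (\<integral>\<omega>\<in>C. \<eta> (level T a \<omega>) \<partial>P) / ?p" for a
  define V where "V a = r + (LINT x:{0..a}|lborel. v x)" for a
  have int_C: "integrable P (\<lambda>\<omega>. indicator C \<omega> * f \<omega>)"
    if [measurable]: "f \<in> borel_measurable P" and "\<And>\<omega>. \<omega> \<in> space P \<Longrightarrow> 0 \<le> f \<omega> \<and> f \<omega> \<le> K" for f and K :: real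
  proof (rule integrable_const_bound[where B=K])
    have "norm (indicator C \<omega> * f \<omega>) \<le> K" if "\<omega> \<in> space P" for \<omega>
      using \<open>\<And>\<omega>. \<omega> \<in> space P \<Longrightarrow> 0 \<le> f \<omega> \<and> f \<omega> \<le> K\<close>[OF that] by (auto simp: indicator_def)
    then show "AE \<omega> in P. norm (indicator C \<omega> * f \<omega>) \<le> K" by (rule AE_I2)
  qed measurable
  have int_ind: "integrable P (indicator C :: 'a \<Rightarrow> real)"
    by (intro integrable_real_indicator) (auto simp: emeasure_eq_measure)
  have int_const: "(\<integral>\<omega>. indicator C \<omega> * k \<partial>P) = ?p * k" for k :: real by simp
  have int_\<eta>: "integrable P (\<lambda>\<omega>. indicator C \<omega> * \<eta> (level T a \<omega>))" for a
    using \<eta>_level_at \<eta>_level_bounds by (rule int_C)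
  have v_meas: "v \<in> borel_measurable borel"
  proof -
    note [measurable] = \<eta>_level_measurable[OF opt_time_measurable[OF T]]
    have "(\<lambda>p. \<eta> (level T (fst p) (snd p))) \<in> borel_measurable (borel \<Otimes>\<^sub>M P)"
      using \<eta>_level_measurable[OF opt_time_measurable[OF T]] by (simp add: case_prod_beta)
    then have "(\<lambda>(a, \<omega>). indicator C \<omega> * \<eta> (level T a \<omega>)) \<in> borel_measurable (borel \<Otimes>\<^sub>M P)"
      unfolding case_prod_beta by measurable
    then show ?thesis
      unfolding v_def set_lebesgue_integral_def real_scaleR_def
      by (intro borel_measurable_divide borel_measurable_lebesgue_integral) auto
  qed
  have v_nonneg: "0 \<le> v a" for a
    unfolding v_def set_lebesgue_integral_def using \<eta>_level_bounds
    by (intro divide_nonneg_nonneg integral_nonneg_AE AE_I2) auto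
  have v_le: "v a \<le> \<eta> u" for a
  proof -
    have "(\<integral>\<omega>. indicator C \<omega> * \<eta> (level T a \<omega>) \<partial>P) \<le> (\<integral>\<omega>. indicator C \<omega> * \<eta> u \<partial>P)"
      using \<eta>_level_bounds by (intro integral_mono int_\<eta> int_C[of _ "\<eta> u"]) (auto intro!: mult_left_mono nonneg less_imp_le[OF u])
    then show ?thesis unfolding v_def set_lebesgue_integral_def int_const real_scaleR_def
      using p by (simp add: field_simps)
  qed
  have V_ge: "r \<le> V a" for a
    unfolding V_def set_lebesgue_integral_def using v_nonneg by (simp add: integral_nonneg_AE)
  have Y_le: "(\<integral>\<omega>\<in>C. stopped_value T a \<omega> \<partial>P) \<le> ?p * V a" if "0 < a" for a
  proof -
    have "(LINT x:{0..a}|lborel. (\<integral>\<omega>\<in>C. \<eta> (level T x \<omega>) \<partial>P)) = ?p * (LINT x:{0..a}|lborel. v x)"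
      unfolding v_def set_lebesgue_integral_def[of lborel] using p by simp
    then show ?thesis using stopped_value_integral(2)[OF that] r(2) unfolding V_def
      by (simp add: algebra_simps)
  qed
  have v_le_\<eta>V: "v a \<le> \<eta> (V a)" if "0 \<le> a" for a
  proof -
    have "0 < V a" using V_ge[of a] r by simp
    \<comment> \<open>The tangent is taken at \<open>V a\<close>, which already bounds the mean of
      \<open>level T a\<close> over \<open>C\<close>. As the slope \<open>q\<close> is nonnegative,
      inserting that bound into the affine majorant leaves \<open>\<eta> (V a)\<close>.\<close>
    then obtain q where q: "0 \<le> q" "\<And>x. 0 \<le> x \<Longrightarrow> \<eta> x \<le> \<eta> (V a) + q * (x - V a)"
      using tangent by blast
    have int_l: "integrable P (\<lambda>\<omega>. indicator C \<omega> * level T a \<omega>)"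
      using level_nonneg level_le[where T=T, OF _ T_first] by (intro int_C[OF level_at, of _ u]) auto
    have "(\<integral>\<omega>. indicator C \<omega> * level T a \<omega> \<partial>P) \<le> ?p * V a"
    \<comment> \<open>\<open>Y_le\<close> requires a positive level. At \<open>a = 0\<close> the
      hitting time is 0, where \<open>Xl\<close> has its placeholder value 0.\<close>
    proof (cases "a = 0")
      case True
      have "level T a \<omega> = 0" if "\<omega> \<in> space P" for \<omega>
      proof -
        have "hit a \<omega> \<le> 0" using True hit_le[of 0 a \<omega>] A_0[OF that] by simp
        then have "hit a \<omega> = 0" using hit_nonneg[of a \<omega>] by simp
        then show ?thesis unfolding level_def Xl_def by simp
      qed
      then have "(\<integral>\<omega>. indicator C \<omega> * level T a \<omega> \<partial>P) = (\<integral>\<omega>. 0 \<partial>P)"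
        by (intro Bochner_Integration.integral_cong) auto
      then show ?thesis using p \<open>0 < V a\<close> by simp
    next
      case False
      then have "0 < a" using that by simp
      have "(\<integral>\<omega>. indicator C \<omega> * level T a \<omega> \<partial>P) \<le> (\<integral>\<omega>. indicator C \<omega> * stopped_value T a \<omega> \<partial>P)"
        using level_le_stopped_value \<open>0 < a\<close>
        by (intro integral_mono int_l stopped_value_integral(1)) (auto intro!: mult_left_mono)
      also have "\<dots> \<le> ?p * V a" using Y_le[OF \<open>0 < a\<close>] unfolding set_lebesgue_integral_def by simp
      finally show ?thesis .
    qed
    moreover have "(\<integral>\<omega>. indicator C \<omega> * \<eta> (level T a \<omega>) \<partial>P)
        \<le> (\<integral>\<omega>. indicator C \<omega> * (\<eta> (V a) - q * V a) + q * (indicator C \<omega> * level T a \<omega>) \<partial>P)"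
    proof (rule integral_mono)
      show "integrable P (\<lambda>\<omega>. indicator C \<omega> * (\<eta> (V a) - q * V a) + q * (indicator C \<omega> * level T a \<omega>))"
        using int_l int_ind by (intro Bochner_Integration.integrable_add integrable_mult_right) auto
      show "indicator C \<omega> * \<eta> (level T a \<omega>)
          \<le> indicator C \<omega> * (\<eta> (V a) - q * V a) + q * (indicator C \<omega> * level T a \<omega>)" if "\<omega> \<in> space P" for \<omega>
        using q(2)[OF level_nonneg[OF that], of T a] by (auto simp: indicator_def algebra_simps)
    qed (rule int_\<eta>)
    moreover have "(\<integral>\<omega>. indicator C \<omega> * (\<eta> (V a) - q * V a) + q * (indicator C \<omega> * level T a \<omega>) \<partial>P)
        = ?p * (\<eta> (V a) - q * V a) + q * (\<integral>\<omega>. indicator C \<omega> * level T a \<omega> \<partial>P)"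
    proof -
      have "integrable P (\<lambda>\<omega>. indicator C \<omega> * (\<eta> (V a) - q * V a))" using int_ind by auto
      moreover have "integrable P (\<lambda>\<omega>. q * (indicator C \<omega> * level T a \<omega>))" using int_l by (rule integrable_mult_right)
      ultimately show ?thesis
        by (subst Bochner_Integration.integral_add) (auto simp only: int_const integral_mult_right_zero)
    qed
    ultimately have "(\<integral>\<omega>. indicator C \<omega> * \<eta> (level T a \<omega>) \<partial>P) \<le> ?p * (\<eta> (V a) - q * V a) + q * (?p * V a)"
      using q(1) by (smt (verit) mult_left_mono)
    then have "(\<integral>\<omega>. indicator C \<omega> * \<eta> (level T a \<omega>) \<partial>P) \<le> ?p * \<eta> (V a)" by (simp add: algebra_simps)
    then show ?thesis
      unfolding v_def set_lebesgue_integral_def real_scaleR_def using p by (simp add: field_simps)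
  qed
  have "G (V b) \<le> G r + ereal b"
    unfolding V_def using r(1) \<open>0 < b\<close> v_meas v_nonneg v_le
    by (rule bihari_bound) (use v_le_\<eta>V in \<open>simp add: V_def\<close>)
  then have "G (V b) < G y" using y(2) by (rule le_less_trans)
  then have "V b \<le> y" using G_strict_mono[of y "V b"] y(1) by (meson less_imp_le not_le order.asym)
  then have "?p * V b \<le> ?p * y" using p by (intro mult_left_mono) auto
  then show ?thesis using Y_le[OF \<open>0 < b\<close>] by (simp add: mult.commute)
qed

end

end

end

section \<open>The tail estimate\<close>

context stochastic_bihari
begin

section \<open>From the stopped mean to probabilities\<close>

text \<open>Markov's inequality for the stopped value: if the supremum exceeds \<open>u\<close>
  while \<open>A\<close> and \<open>B\<close> stay below their levels up to \<open>t\<close>, the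
  first passage precedes \<open>hit b\<close> and the stopped value is at least \<open>u\<close>.
  This is exact once the localising time is beyond \<open>t\<close>; the events \<open>E' k\<close>
  record that and exhaust \<open>E\<close> almost surely.\<close>

lemma exceedance_bound:
  assumes C: "C \<in> sets (F 0)" and h: "integrable P h"
    and H_le: "\<And>\<omega> s. \<omega> \<in> C \<Longrightarrow> 0 \<le> s \<Longrightarrow> s \<le> t \<Longrightarrow> B s \<omega> < w \<Longrightarrow> H s \<omega> \<le> h \<omega>"
    and r: "0 < r" "(\<integral>\<omega>\<in>C. h \<omega> \<partial>P) \<le> r * prob C"
    and "0 < b" and y: "0 < y" "G r + ereal b < G y"
  shows "u * prob (C \<inter> {\<omega>\<in>space P. u < running_sup X t \<omega> \<and> A t \<omega> < b \<and> B t \<omega> < w}) \<le> y * prob C"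
proof (cases "prob C = 0")
  case True
  have "prob (C \<inter> {\<omega>\<in>space P. u < running_sup X t \<omega> \<and> A t \<omega> < b \<and> B t \<omega> < w}) \<le> prob C"
    using sets_F_subset[OF order_refl C] by (intro finite_measure_mono) auto
  then show ?thesis using True u by (simp add: mult_nonneg_nonpos)
next
  case False
  then have p: "0 < prob C" by (simp add: zero_less_measure_iff)
  have CP[measurable]: "C \<in> sets P" using sets_F_subset[OF order_refl C] .
  obtain \<tau> where \<tau>: "\<And>k::nat. ext_stopping_time P F (\<tau> k)"
    and \<tau>_lim: "AE \<omega> in P. incseq (\<lambda>k. \<tau> k \<omega>) \<and> (\<lambda>k. \<tau> k \<omega>) \<longlonglongrightarrow> \<infinity>"
    and N: "\<And>k. martingale_process P F (stopped_process (\<tau> k) (\<lambda>s \<omega>. M s \<omega> - M 0 \<omega>))"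
    using M(1) unfolding local_martingale_def by blast
  define \<rho> where "\<rho> k \<omega> = real_of_ereal (min (ereal t) (\<tau> k \<omega>))" for k \<omega>
  define T where "T k \<omega> = min (first_above X u (t + 1) \<omega>) (\<rho> k \<omega>)" for k \<omega>
  have \<tau>_nonneg: "0 \<le> \<tau> k \<omega>" if "\<omega> \<in> space P" for k \<omega>
    using \<tau> that unfolding ext_stopping_time_def by blast
  have \<rho>_eq: "ereal (\<rho> k \<omega>) = min (ereal t) (\<tau> k \<omega>)" if "\<omega> \<in> space P" for k \<omega>
    unfolding \<rho>_def using \<tau>_nonneg[OF that, of k] t by (cases "\<tau> k \<omega>") (auto simp: min_def)
  have \<rho>: "opt_time (\<rho> k)" for k unfolding \<rho>_def[abs_def] using \<tau> t by (rule opt_time_ext_stopping_time)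
  have T: "opt_time (T k)" for k
    unfolding T_def[abs_def] using t by (intro opt_time_min opt_time_first_above X \<rho>) simp
  have T_le: "T k \<omega> \<le> t" if "\<omega> \<in> space P" for k \<omega>
  proof -
    have "ereal (\<rho> k \<omega>) \<le> ereal t" unfolding \<rho>_eq[OF that] by simp
    then show ?thesis unfolding T_def by simp
  qed
  have T_first: "T k \<omega> \<le> first_above X u (t + 1) \<omega>" for k \<omega> unfolding T_def by simp
  have "cadlag_process P (\<lambda>s \<omega>. M s \<omega> - M 0 \<omega>)"
    using M(2) M_0 unfolding cadlag_process_def by simp
  then have N_cadlag: "cadlag_process P (stopped_process (\<tau> k) (\<lambda>s \<omega>. M s \<omega> - M 0 \<omega>))" for k
    using \<tau>_nonneg by (rule cadlag_stopped)
  have N_0: "stopped_process (\<tau> k) (\<lambda>s \<omega>. M s \<omega> - M 0 \<omega>) 0 \<omega> = 0" if "\<omega> \<in> space P" for k \<omega>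
    using \<tau>_nonneg[OF that, of k] unfolding stopped_process_def by (simp add: min_absorb1 zero_ereal_def[symmetric])
  have N_eq: "stopped_process (\<tau> k) (\<lambda>s \<omega>. M s \<omega> - M 0 \<omega>) s \<omega> = M s \<omega>"
    if "\<omega> \<in> space P" "0 \<le> s" "s \<le> T k \<omega>" for k \<omega> s
  proof -
    have "ereal s \<le> ereal (\<rho> k \<omega>)" using that unfolding T_def by simp
    then have "ereal s \<le> \<tau> k \<omega>" unfolding \<rho>_eq[OF that(1)] by simp
    then show ?thesis unfolding stopped_process_def using M_0[OF that(1)] by (simp add: min_absorb1)
  qed
  define E where "E = C \<inter> {\<omega>\<in>space P. u < running_sup X t \<omega> \<and> A t \<omega> < b \<and> B t \<omega> < w}"
  define E' where "E' k = E \<inter> {\<omega>\<in>space P. \<rho> k \<omega> = t}" for k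
  have E[measurable]: "E \<in> sets P"
  proof -
    have [measurable]: "A t \<in> borel_measurable P" "B t \<in> borel_measurable P"
      using A(1) B(1) t by (auto intro: predictable_measurable)
    have "{\<omega>\<in>space P. A t \<omega> < b} \<in> sets P" "{\<omega>\<in>space P. B t \<omega> < w} \<in> sets P" by measurable
    then have "C \<inter> {\<omega>\<in>space P. u < running_sup X t \<omega>} \<inter> {\<omega>\<in>space P. A t \<omega> < b} \<inter> {\<omega>\<in>space P. B t \<omega> < w} \<in> sets P"
      using running_sup_measurable[OF X(1,3) t, of u] CP by blast
    moreover have "E = C \<inter> {\<omega>\<in>space P. u < running_sup X t \<omega>} \<inter> {\<omega>\<in>space P. A t \<omega> < b} \<inter> {\<omega>\<in>space P. B t \<omega> < w}"
      unfolding E_def by auto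
    ultimately show ?thesis by simp
  qed
  have E'[measurable]: "E' k \<in> sets P" for k
  proof -
    have [measurable]: "\<rho> k \<in> borel_measurable P" by (rule opt_time_measurable[OF \<rho>])
    show ?thesis unfolding E'_def by measurable
  qed
  have "u * prob (E' k) \<le> y * prob C" for k
  proof -
    have int: "integrable P (\<lambda>\<omega>. indicator C \<omega> * stopped_value (T k) b \<omega>)"
      by (rule stopped_value_integral(1)[OF T T_le T_first N N_cadlag N_0 N_eq C h H_le \<open>0 < b\<close>])
    have "u * prob (E' k) = (\<integral>\<omega>. u * indicator (E' k) \<omega> \<partial>P)"
      by simp
    also have "\<dots> \<le> (\<integral>\<omega>. indicator C \<omega> * stopped_value (T k) b \<omega> \<partial>P)"
    proof (rule integral_mono[OF _ int])
      show "integrable P (\<lambda>\<omega>. u * indicator (E' k) \<omega>)"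
        by (intro integrable_mult_right integrable_real_indicator) (auto simp: emeasure_eq_measure)
      fix \<omega> assume \<omega>: "\<omega> \<in> space P"
      show "u * indicator (E' k) \<omega> \<le> indicator C \<omega> * stopped_value (T k) b \<omega>"
      proof (cases "\<omega> \<in> E' k")
        case True
        then have *: "\<omega> \<in> C" "u < running_sup X t \<omega>" "A t \<omega> < b" "B t \<omega> < w" "\<rho> k \<omega> = t"
          unfolding E'_def E_def by auto
        obtain s where s: "0 \<le> s" "s \<le> t" "u < X s \<omega>"
          using *(2) running_sup_greater_iff[OF X(3) \<omega> t] by auto
        \<comment> \<open>The passage may happen exactly at \<open>t\<close>; the cap
          \<open>t + 1\<close> leaves the strict room that \<open>at_first_above\<close>
          demands.\<close>
        have "s < t + 1" using s by simp
        note first = at_first_above[OF X(3) \<omega> s(1) this s(3)]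
        have "T k \<omega> = first_above X u (t + 1) \<omega>" unfolding T_def using *(5) first(1) s(2) by simp
        moreover have "t < hit b \<omega>" using hit_le_iff[OF \<omega> t, of b] *(3,4) by auto
        ultimately have "stopped_value (T k) b \<omega> = X (first_above X u (t + 1) \<omega>) \<omega>"
          unfolding value_before_def using T_le[OF \<omega>, of k] by simp
        then show ?thesis using first(2) True *(1) by simp
      next
        case False
        then show ?thesis using stopped_value_nonneg[OF T T_le T_first \<omega> \<open>0 < b\<close>] by simp
      qed
    qed
    also have "\<dots> \<le> y * prob C"
      using stopped_value_integral_less[OF T T_le T_first N N_cadlag N_0 N_eq C h H_le p r \<open>0 < b\<close> y]
      unfolding set_lebesgue_integral_def by simp
    finally show ?thesis .
  qed
  moreover have "(\<lambda>k. u * prob (E' k)) \<longlonglongrightarrow> u * prob E"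
  proof (rule tendsto_mult_left)
    have "(\<lambda>k. \<integral>\<omega>. indicat_real (E' k) \<omega> \<partial>P) \<longlonglongrightarrow> (\<integral>\<omega>. indicat_real E \<omega> \<partial>P)"
    proof (rule integral_dominated_convergence[where w="\<lambda>_. 1"])
      show "AE \<omega> in P. (\<lambda>k. indicator (E' k) \<omega> :: real) \<longlonglongrightarrow> indicator E \<omega>"
        using \<tau>_lim AE_space
      proof eventually_elim
        case (elim \<omega>)
        then have "\<forall>\<^sub>F k in sequentially. ereal t < \<tau> k \<omega>" by (intro order_tendstoD(1)[where y="\<infinity>"]) auto
        then have "\<forall>\<^sub>F k in sequentially. indicator (E' k) \<omega> = (indicator E \<omega> :: real)"
        proof eventually_elim
          case (elim k)
          then have "ereal (\<rho> k \<omega>) = ereal t" using \<rho>_eq \<open>\<omega> \<in> space P\<close> by (simp add: min_absorb1)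
          then show ?case using \<open>\<omega> \<in> space P\<close> unfolding E'_def by (simp add: indicator_def)
        qed
        then show ?case by (rule tendsto_eventually)
      qed
    qed (auto simp: indicator_def)
    then show "(\<lambda>k. prob (E' k)) \<longlonglongrightarrow> prob E" by simp
  qed
  ultimately show ?thesis unfolding E_def[symmetric] by (intro LIMSEQ_le_const2) auto
qed

end

context usual_filtered_prob_space
begin

text \<open>Permits a modification of \<open>H\<close> on an event of \<open>F 0\<close> without
  losing predictability.\<close>

lemma all_times_predictable:
  assumes "Q \<in> sets (F 0)"
  shows "{0..} \<times> Q \<in> sets (predictable_sigma P F)"
proof -
  have "{0} \<times> Q \<in> sets (predictable_sigma P F)"
    unfolding sets_predictable_sigma using assms by (intro sigma_sets.Basic) blast
  moreover have "{0<..real n} \<times> Q \<in> sets (predictable_sigma P F)" for n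
    unfolding sets_predictable_sigma using assms by (intro sigma_sets.Basic UnI2 CollectI exI[of _ 0] exI[of _ "real n"] exI[of _ Q]) auto
  ultimately have "{0} \<times> Q \<union> (\<Union>n. {0<..real n} \<times> Q) \<in> sets (predictable_sigma P F)" by auto
  moreover have "{0} \<times> Q \<union> (\<Union>n. {0<..real n} \<times> Q) = {0..} \<times> Q"
    using real_arch_simple by fastforce
  ultimately show ?thesis by simp
qed

lemma cond_probability_set_integral:
  assumes S: "{\<omega>\<in>space P. Q \<omega>} \<in> sets P" and C: "C \<in> sets (F 0)"
  shows "(\<integral>\<omega>\<in>C. cond_probability P (F 0) Q \<omega> \<partial>P) = prob (C \<inter> {\<omega>\<in>space P. Q \<omega>})"
    and "integrable P (cond_probability P (F 0) Q)"
proof -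
  interpret sigma_finite_subalgebra P "F 0" by (rule sigma_finite_subalgebra_F) simp
  have int: "integrable P (indicat_real {\<omega>\<in>space P. Q \<omega>})"
    using S by (intro integrable_real_indicator) (auto simp: emeasure_eq_measure)
  then show "integrable P (cond_probability P (F 0) Q)" unfolding cond_probability_def by (rule real_cond_exp_int)
  have CP: "C \<in> sets P" using sets_F_subset[OF order_refl C] .
  have "(\<integral>\<omega>\<in>C. cond_probability P (F 0) Q \<omega> \<partial>P) = (\<integral>\<omega>\<in>C. indicat_real {\<omega>\<in>space P. Q \<omega>} \<omega> \<partial>P)"
    unfolding cond_probability_def using real_cond_exp_intA[OF int C] by simp
  also have "\<dots> = (\<integral>\<omega>. indicat_real (C \<inter> {\<omega>\<in>space P. Q \<omega>}) \<omega> \<partial>P)"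
    unfolding set_lebesgue_integral_def by (simp add: indicator_inter_arith)
  also have "\<dots> = prob (C \<inter> {\<omega>\<in>space P. Q \<omega>})" using S CP by simp
  finally show "(\<integral>\<omega>\<in>C. cond_probability P (F 0) Q \<omega> \<partial>P) = prob (C \<inter> {\<omega>\<in>space P. Q \<omega>})" .
qed

text \<open>Estimates on the events \<open>C\<close> of \<open>F 0\<close> where \<open>h \<le> r\<close> localise to an almost sure estimate, because
  the bound is right-continuous in \<open>h\<close> and \<open>R\<close>.\<close>

lemma AE_le_bihari_bound:
  assumes "bihari_function \<eta> c" and "0 < u" "0 < R"
    and g: "g \<in> borel_measurable (F 0)" "integrable P g"
    and h: "h \<in> borel_measurable (F 0)" "AE \<omega> in P. 0 \<le> h \<omega>"
    and le: "\<And>C r b y. C \<in> sets (F 0) \<Longrightarrow> (\<And>\<omega>. \<omega> \<in> C \<Longrightarrow> h \<omega> \<le> r) \<Longrightarrow> 0 < r \<Longrightarrow> R < b \<Longrightarrow> 0 < y \<Longrightarrow>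
        bihari_G \<eta> c r + ereal b < bihari_G \<eta> c y \<Longrightarrow> u * (\<integral>\<omega>\<in>C. g \<omega> \<partial>P) \<le> y * prob C"
  shows "AE \<omega> in P. g \<omega> \<le> bihari_G_inv \<eta> c (bihari_G \<eta> c (h \<omega>) + ereal R) / u"
proof -
  interpret bihari_function \<eta> c by fact
  \<comment> \<open>A pair \<open>(q, r)\<close> is admissible if the estimate with some
    \<open>b\<close> above \<open>R\<close> applies to events where \<open>h \<le> r\<close> and
    yields the bound \<open>q\<close>. Rational pairs suffice, so countably many null sets have to
    be combined.\<close>
  define I where "I = {(q, r). q \<in> \<rat> \<and> r \<in> \<rat> \<and> 0 < r \<and> 0 < q \<and> (\<exists>b>R. G r + ereal b < G (q * u))}"
  define bad where "bad p = {\<omega>\<in>space P. fst p < g \<omega> \<and> h \<omega> \<le> snd p}" for p :: "real \<times> real"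
  have "countable (\<rat> \<times> (\<rat> :: real set))" by (intro countable_SIGMA countable_rat)
  then have I: "countable I" by (rule countable_subset[rotated]) (auto simp: I_def)
  have "AE \<omega> in P. \<omega> \<notin> bad p" if "p \<in> I" for p
  proof -
    obtain q r b where p: "p = (q, r)" "0 < r" "0 < q" "R < b" "G r + ereal b < G (q * u)"
      using \<open>p \<in> I\<close> unfolding I_def by auto
    have badF: "bad p \<in> sets (F 0)"
    proof -
      note [measurable] = g(1) h(1)
      have "{\<omega>\<in>space (F 0). fst p < g \<omega> \<and> h \<omega> \<le> snd p} \<in> sets (F 0)" by measurable
      then show ?thesis unfolding bad_def using space_F[of 0] by simp
    qed
    then have [measurable]: "bad p \<in> sets P" by (rule sets_F_subset[OF order_refl])
    \<comment> \<open>With \<open>y = q * u\<close> the mean of \<open>g\<close> on the bad event is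
      at most \<open>q\<close>, although \<open>g\<close> exceeds \<open>q\<close> throughout; so
      the event is null.\<close>
    have "u * (\<integral>\<omega>\<in>bad p. g \<omega> \<partial>P) \<le> (q * u) * prob (bad p)"
      using p \<open>0 < u\<close> by (intro le[OF badF _ p(2,4) _ p(5)]) (auto simp: bad_def)
    then have int_le: "(\<integral>\<omega>\<in>bad p. g \<omega> \<partial>P) \<le> q * prob (bad p)" using \<open>0 < u\<close> by (simp add: field_simps)
    have int: "integrable P (\<lambda>\<omega>. indicator (bad p) \<omega> * (g \<omega> - q))"
      using g(2) by (intro integrable_mult_indicator[where 'b=real, simplified]) auto
    have nonneg: "0 \<le> indicator (bad p) \<omega> * (g \<omega> - q)" for \<omega>
      using p by (auto simp: bad_def indicator_def)
    have "(\<integral>\<omega>. indicator (bad p) \<omega> * (g \<omega> - q) \<partial>P) = (\<integral>\<omega>\<in>bad p. g \<omega> \<partial>P) - q * prob (bad p)"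
    proof -
      have "integrable P (\<lambda>\<omega>. indicator (bad p) \<omega> * g \<omega>)"
        using g(2) by (intro integrable_mult_indicator[where 'b=real, simplified]) auto
      moreover have "integrable P (\<lambda>\<omega>. indicator (bad p) \<omega> * q)"
        by (intro integrable_mult_indicator[where 'b=real, simplified]) auto
      ultimately show ?thesis
        unfolding set_lebesgue_integral_def right_diff_distrib
        by (subst Bochner_Integration.integral_diff) (simp_all add: mult.commute[of q])
    qed
    moreover have "0 \<le> (\<integral>\<omega>. indicator (bad p) \<omega> * (g \<omega> - q) \<partial>P)"
      using nonneg by (intro integral_nonneg_AE AE_I2)
    ultimately have "(\<integral>\<omega>. indicator (bad p) \<omega> * (g \<omega> - q) \<partial>P) = 0" using int_le by linarith
    then have "AE \<omega> in P. indicator (bad p) \<omega> * (g \<omega> - q) = 0"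
      using integral_nonneg_eq_0_iff_AE[OF int] nonneg by auto
    then show ?thesis by eventually_elim (use p in \<open>auto simp: bad_def indicator_def\<close>)
  qed
  then have "AE \<omega> in P. \<forall>p\<in>I. \<omega> \<notin> bad p" using I by (simp add: AE_ball_countable)
  then show ?thesis
    using h(2) AE_space
  proof eventually_elim
    case (elim \<omega>)
    show ?case
    proof (rule ccontr)
      assume "\<not> ?case"
      then obtain q where q: "q \<in> \<rat>" "bihari_G_inv \<eta> c (G (h \<omega>) + ereal R) / u < q" "q < g \<omega>"
        using Rats_dense_in_real by (metis not_le)
      then have less: "bihari_G_inv \<eta> c (G (h \<omega>) + ereal R) < q * u" using \<open>0 < u\<close> by (simp add: field_simps)
      from less_G_inv_room[OF elim(2) \<open>0 < R\<close> less]
      obtain r b where r: "h \<omega> < r" "R < b" "G r + ereal b < G (q * u)" and "0 < q * u" by blast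
      \<comment> \<open>The room above \<open>h \<omega>\<close> admits a rational
        \<open>r'\<close>, positive because \<open>h \<omega>\<close> is nonnegative; lowering
        \<open>r\<close> to \<open>r'\<close> keeps the pair admissible.\<close>
      obtain r' where r': "r' \<in> \<rat>" "h \<omega> < r'" "r' < r" using Rats_dense_in_real[OF r(1)] by blast
      have "0 < r'" using r' elim(2) by simp
      have "G r' + ereal b \<le> G r + ereal b"
        using G_strict_mono[of r' r] r' \<open>0 < r'\<close> by (intro add_right_mono) auto
      then have "(q, r') \<in> I"
        using q r r' \<open>0 < r'\<close> \<open>0 < q * u\<close> \<open>0 < u\<close> unfolding I_def
        by (auto simp: zero_less_mult_iff intro: le_less_trans)
      moreover have "\<omega> \<in> bad (q, r')" unfolding bad_def using elim q r' by simp
      ultimately show False using elim(1) by blast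
    qed
  qed
qed

end

lemma (in usual_filtered_prob_space) set_integral_le_cond_bound:
  assumes h: "integrable P h" and C: "C \<in> sets (F 0)"
    and le: "\<And>\<omega>. \<omega> \<in> C \<Longrightarrow> real_cond_exp P (F 0) h \<omega> \<le> r"
  shows "(\<integral>\<omega>\<in>C. h \<omega> \<partial>P) \<le> r * prob C"
proof -
  interpret F0: sigma_finite_subalgebra P "F 0" by (rule sigma_finite_subalgebra_F) simp
  have CP: "C \<in> sets P" using sets_F_subset[OF order_refl C] .
  have "(\<integral>\<omega>\<in>C. h \<omega> \<partial>P) = (\<integral>\<omega>\<in>C. real_cond_exp P (F 0) h \<omega> \<partial>P)" by (rule F0.real_cond_exp_intA[OF h C])
  also have "\<dots> \<le> (\<integral>\<omega>\<in>C. r \<partial>P)"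
  proof (rule set_integral_mono)
    show "set_integrable P C (real_cond_exp P (F 0) h)" "set_integrable P C (\<lambda>_. r)"
      unfolding set_integrable_def using F0.real_cond_exp_int(1)[OF h] CP
      by (intro integrable_mult_indicator; simp)+
  qed (rule le)
  also have "\<dots> = r * prob C" unfolding set_lebesgue_integral_def using CP by simp
  finally show ?thesis .
qed

text \<open>The common form of the two bounds. \<open>S\<close> collects the paths on which control
  by \<open>h\<close> is given up: those outside \<open>Q\<close> and those where \<open>B\<close>
  reaches \<open>w\<close> by time \<open>t\<close>. On the remaining paths of \<open>C\<close>
  either \<open>A t > R\<close>, or \<open>A t < b\<close> and \<open>exceedance_bound\<close>
  applies to the part of \<open>C\<close> in \<open>Q\<close>.\<close>

lemma (in stochastic_bihari) tail_estimate:
  assumes "0 < R" and Q: "Q \<in> sets (F 0)" and S: "{\<omega>\<in>space P. S \<omega>} \<in> sets P"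
    and escape: "\<And>\<omega>. \<omega> \<in> space P \<Longrightarrow> \<omega> \<notin> Q \<or> w \<le> B t \<omega> \<Longrightarrow> S \<omega>"
    and h: "integrable P h" "\<And>\<omega>. \<omega> \<in> space P \<Longrightarrow> 0 \<le> h \<omega>"
    and H_le: "\<And>\<omega> s. \<omega> \<in> Q \<Longrightarrow> 0 \<le> s \<Longrightarrow> s \<le> t \<Longrightarrow> B s \<omega> < w \<Longrightarrow> H s \<omega> \<le> h \<omega>"
  shows "AE \<omega> in P. cond_probability P (F 0) (\<lambda>\<omega>. running_sup X t \<omega> > u) \<omega>
     \<le> bihari_G_inv \<eta> c (G (real_cond_exp P (F 0) h \<omega>) + ereal R) / u
       + cond_probability P (F 0) S \<omega> + cond_probability P (F 0) (\<lambda>\<omega>. A t \<omega> > R) \<omega>"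
proof -
  interpret F0: sigma_finite_subalgebra P "F 0" by (rule sigma_finite_subalgebra_F) simp
  have [measurable]: "A t \<in> borel_measurable P" "B t \<in> borel_measurable P"
    using A(1) B(1) t by (auto intro: predictable_measurable)
  have A_meas: "{\<omega>\<in>space P. A t \<omega> > R} \<in> sets P" by measurable
  have X_meas: "{\<omega>\<in>space P. running_sup X t \<omega> > u} \<in> sets P"
    using X(1,3) t by (rule running_sup_measurable)
  let ?X = "cond_probability P (F 0) (\<lambda>\<omega>. running_sup X t \<omega> > u)" and ?S = "cond_probability P (F 0) S"
    and ?A = "cond_probability P (F 0) (\<lambda>\<omega>. A t \<omega> > R)"
  have int: "integrable P ?X" "integrable P ?S" "integrable P ?A"
    by (intro cond_probability_set_integral(2)[OF _ Q] X_meas S A_meas)+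
  have "AE \<omega> in P. ?X \<omega> - ?S \<omega> - ?A \<omega> \<le> bihari_G_inv \<eta> c (G (real_cond_exp P (F 0) h \<omega>) + ereal R) / u"
  proof (rule AE_le_bihari_bound[OF bihari_function_axioms u \<open>0 < R\<close>])
    show "(\<lambda>\<omega>. ?X \<omega> - ?S \<omega> - ?A \<omega>) \<in> borel_measurable (F 0)"
      unfolding cond_probability_def by (intro borel_measurable_diff borel_measurable_cond_exp)
    show int_diff: "integrable P (\<lambda>\<omega>. ?X \<omega> - ?S \<omega> - ?A \<omega>)"
      by (intro Bochner_Integration.integrable_diff int)
    show "AE \<omega> in P. 0 \<le> real_cond_exp P (F 0) h \<omega>"
      using h by (intro F0.real_cond_exp_pos AE_I2) auto
    fix C r b y
    assume C: "C \<in> sets (F 0)" and r: "\<And>\<omega>. \<omega> \<in> C \<Longrightarrow> real_cond_exp P (F 0) h \<omega> \<le> r" "0 < r"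
      and b: "R < b" and y: "0 < y" "G r + ereal b < G y"
    have CQ: "C \<inter> Q \<in> sets (F 0)" using C Q by blast
    have CP: "C \<in> sets P" "C \<inter> Q \<in> sets P" using sets_F_subset[OF order_refl] C CQ by auto
    define E where "E = C \<inter> Q \<inter> {\<omega>\<in>space P. u < running_sup X t \<omega> \<and> A t \<omega> < b \<and> B t \<omega> < w}"
    have E: "u * prob E \<le> y * prob (C \<inter> Q)"
      unfolding E_def
    proof (rule exceedance_bound[OF CQ h(1)])
      show "(\<integral>\<omega>\<in>C \<inter> Q. h \<omega> \<partial>P) \<le> r * prob (C \<inter> Q)"
        using r(1) by (intro set_integral_le_cond_bound[OF h(1) CQ]) auto
    qed (use H_le r b \<open>0 < R\<close> y in auto)
    have E_meas: "E \<in> sets P"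
    proof -
      have "{\<omega>\<in>space P. A t \<omega> < b} \<in> sets P" "{\<omega>\<in>space P. B t \<omega> < w} \<in> sets P" by measurable
      then have "(C \<inter> Q) \<inter> {\<omega>\<in>space P. running_sup X t \<omega> > u} \<inter> {\<omega>\<in>space P. A t \<omega> < b} \<inter> {\<omega>\<in>space P. B t \<omega> < w} \<in> sets P"
        using CP X_meas by blast
      moreover have "E = (C \<inter> Q) \<inter> {\<omega>\<in>space P. running_sup X t \<omega> > u} \<inter> {\<omega>\<in>space P. A t \<omega> < b} \<inter> {\<omega>\<in>space P. B t \<omega> < w}"
        unfolding E_def by auto
      ultimately show ?thesis by simp
    qed
    let ?CX = "C \<inter> {\<omega>\<in>space P. running_sup X t \<omega> > u}" and ?CS = "C \<inter> {\<omega>\<in>space P. S \<omega>}"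
      and ?CA = "C \<inter> {\<omega>\<in>space P. A t \<omega> > R}"
    have "?CX \<subseteq> E \<union> ?CS \<union> ?CA"
    proof
      fix \<omega> assume "\<omega> \<in> ?CX"
      moreover from this have "\<omega> \<in> Q \<and> B t \<omega> < w \<or> S \<omega>" using escape[of \<omega>] by force
      ultimately show "\<omega> \<in> E \<union> ?CS \<union> ?CA"
        using b unfolding E_def by (cases "A t \<omega> > R") auto
    qed
    then have "prob ?CX \<le> prob (E \<union> ?CS \<union> ?CA)"
      using E_meas CP S A_meas by (intro finite_measure_mono) auto
    also have "\<dots> \<le> prob E + prob ?CS + prob ?CA"
      using E_meas CP S A_meas measure_Un_le[of "E \<union> ?CS" P ?CA] measure_Un_le[of E P ?CS] by auto
    finally have "prob ?CX - prob ?CS - prob ?CA \<le> prob E" by simp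
    moreover have "(\<integral>\<omega>\<in>C. ?X \<omega> - ?S \<omega> - ?A \<omega> \<partial>P) = prob ?CX - prob ?CS - prob ?CA"
    proof -
      have "set_integrable P C f" if "integrable P f" for f :: "'a \<Rightarrow> real"
        unfolding set_integrable_def using CP(1) that by (rule integrable_mult_indicator)
      then have "(\<integral>\<omega>\<in>C. ?X \<omega> - ?S \<omega> - ?A \<omega> \<partial>P) = (\<integral>\<omega>\<in>C. ?X \<omega> \<partial>P) - (\<integral>\<omega>\<in>C. ?S \<omega> \<partial>P) - (\<integral>\<omega>\<in>C. ?A \<omega> \<partial>P)"
        using int by (simp add: set_integral_diff)
      then show ?thesis
        unfolding cond_probability_set_integral(1)[OF X_meas C] cond_probability_set_integral(1)[OF S C]
          cond_probability_set_integral(1)[OF A_meas C] .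
    qed
    ultimately have "(\<integral>\<omega>\<in>C. ?X \<omega> - ?S \<omega> - ?A \<omega> \<partial>P) \<le> prob E" by simp
    then have "u * (\<integral>\<omega>\<in>C. ?X \<omega> - ?S \<omega> - ?A \<omega> \<partial>P) \<le> u * prob E"
      using u by (intro mult_left_mono) auto
    also have "\<dots> \<le> y * prob (C \<inter> Q)" by (rule E)
    also have "\<dots> \<le> y * prob C"
      using y CP by (intro mult_left_mono finite_measure_mono) auto
    finally show "u * (\<integral>\<omega>\<in>C. ?X \<omega> - ?S \<omega> - ?A \<omega> \<partial>P) \<le> y * prob C" .
  qed (rule borel_measurable_cond_exp)
  then show ?thesis by eventually_elim simp
qed

theorem corollary3p9:
  fixes P :: "'a measure" and F :: "real \<Rightarrow> 'a measure"
    and X A H M :: "real \<Rightarrow> 'a \<Rightarrow> real"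
    and \<eta> :: "real \<Rightarrow> real" and c :: real
  assumes "usual_filtered_prob_space P F"
    and "adapted_process F X" and "nonneg_process P X" and "cadlag_process P X"
    and "predictable_process P F A" and "nondecreasing_process P A" and "cadlag_process P A"
    and "\<forall>\<omega>\<in>space P. A 0 \<omega> = 0"
    and "adapted_process F H" and "nonneg_process P H" and "nondecreasing_process P H"
    and "cadlag_process P H"
    and "local_martingale P F M" and "cadlag_process P M"
    and "\<forall>\<omega>\<in>space P. M 0 \<omega> = 0"
    and "continuous_on {0..} \<eta>" and "mono_on {0..} \<eta>" and "concave_on {0..} \<eta>"
    and "\<forall>x\<ge>0. 0 \<le> \<eta> x" and "\<forall>x>0. 0 < \<eta> x"
    and "0 < c"
    and "\<forall>t\<ge>0. AE \<omega> in P.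
           X t \<omega> \<le> stieltjes_integral (\<lambda>s \<omega>. \<eta> (left_limit X s \<omega>)) A t \<omega> + M t \<omega> + H t \<omega>"
  shows "\<forall>t R w u. 0 \<le> t \<longrightarrow> 0 < R \<longrightarrow> 0 < w \<longrightarrow> 0 < u \<longrightarrow>
      (predictable_process P F H \<longrightarrow>
        (AE \<omega> in P. cond_probability P (F 0) (\<lambda>\<omega>. running_sup X t \<omega> > u) \<omega>
           \<le> bihari_G_inv \<eta> c
                (bihari_G \<eta> c (real_cond_exp P (F 0) (\<lambda>\<omega>. min (H t \<omega>) w) \<omega>) + ereal R) / u
             + cond_probability P (F 0) (\<lambda>\<omega>. H t \<omega> \<ge> w) \<omega>
             + cond_probability P (F 0) (\<lambda>\<omega>. A t \<omega> > R) \<omega>)) \<and>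
      (integrable P (H t) \<longrightarrow>
        (AE \<omega> in P. cond_probability P (F 0) (\<lambda>\<omega>. running_sup X t \<omega> > u) \<omega>
           \<le> bihari_G_inv \<eta> c
                (bihari_G \<eta> c (real_cond_exp P (F 0) (H t) \<omega>) + ereal R) / u
             + cond_probability P (F 0) (\<lambda>\<omega>. A t \<omega> > R) \<omega>))"
proof (intro allI impI conjI)
  fix t R w u :: real
  assume t: "0 \<le> t" and R: "0 < R" and w: "0 < w" and u: "0 < u"
  interpret usual_filtered_prob_space P F by fact
  interpret bihari_function \<eta> c using assms by unfold_locales auto
  have H_mono: "H x \<omega> \<le> H y \<omega>" if "\<omega> \<in> space P" "0 \<le> x" "x \<le> y" for x y \<omega>
    using assms(11) that mono_onD[of "{0..}" "\<lambda>s. H s \<omega>" x y] unfolding nondecreasing_process_def by simp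
  have H_nonneg: "0 \<le> H s \<omega>" if "\<omega> \<in> space P" "0 \<le> s" for s \<omega>
    using assms(10) that unfolding nonneg_process_def by blast
  have H_meas[measurable]: "H t \<in> borel_measurable P" using assms(9) t by (rule adapted_measurable)
  show "AE \<omega> in P. cond_probability P (F 0) (\<lambda>\<omega>. running_sup X t \<omega> > u) \<omega>
       \<le> bihari_G_inv \<eta> c (G (real_cond_exp P (F 0) (\<lambda>\<omega>. min (H t \<omega>) w) \<omega>) + ereal R) / u
         + cond_probability P (F 0) (\<lambda>\<omega>. H t \<omega> \<ge> w) \<omega>
         + cond_probability P (F 0) (\<lambda>\<omega>. A t \<omega> > R) \<omega>"
    if H_pred: "predictable_process P F H"
  proof -
    \<comment> \<open>Setting the path to 0 where \<open>H\<close> starts at or above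
      \<open>w\<close> gives \<open>B 0 < w\<close> everywhere, as \<open>hit_pos\<close> requires.
      The paths affected lie outside \<open>Q\<close> and, by monotonicity, in the event
      \<open>H t \<ge> w\<close>.\<close>
    define B where "B s \<omega> = (if H 0 \<omega> < w then H s \<omega> else 0)" for s \<omega>
    define Q where "Q = {\<omega>\<in>space P. H 0 \<omega> < w}"
    have Q: "Q \<in> sets (F 0)"
    proof -
      have [measurable]: "H 0 \<in> borel_measurable (F 0)" using assms(9) unfolding adapted_process_def by simp
      have "{\<omega>\<in>space (F 0). H 0 \<omega> < w} \<in> sets (F 0)" by measurable
      then show ?thesis unfolding Q_def using space_F[of 0] by simp
    qed
    interpret stochastic_bihari P F \<eta> c X A H B M t u w
    proof unfold_locales
      show "predictable_process P F B"
      proof -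
        have [measurable]: "(\<lambda>p. H (fst p) (snd p)) \<in> borel_measurable (predictable_sigma P F)"
          using H_pred unfolding predictable_process_def case_prod_beta .
        have "{p \<in> space (predictable_sigma P F). H 0 (snd p) < w} = {0..} \<times> Q"
          unfolding space_predictable_sigma Q_def by auto
        then have "{p \<in> space (predictable_sigma P F). H 0 (snd p) < w} \<in> sets (predictable_sigma P F)"
          using all_times_predictable[OF Q] by simp
        then show ?thesis
          unfolding predictable_process_def B_def case_prod_beta by (intro measurable_If) auto
      qed
      show "nondecreasing_process P B"
        using H_mono unfolding nondecreasing_process_def B_def by (auto intro!: mono_onI)
      show "cadlag_process P B"
        unfolding cadlag_process_def
      proof
        fix \<omega> assume "\<omega> \<in> space P"
        then show "(\<forall>t\<ge>0. continuous (at_right t) (\<lambda>s. B s \<omega>)) \<and>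
            (\<forall>t>0. \<exists>l. ((\<lambda>s. B s \<omega>) \<longlongrightarrow> l) (at_left t))"
          using assms(12) unfolding cadlag_process_def B_def by (cases "H 0 \<omega> < w") auto
      qed
      show "B 0 \<omega> < w" for \<omega> unfolding B_def using w by simp
    qed (use assms t u in auto)
    show ?thesis
    proof (rule tail_estimate[OF R Q])
      show "{\<omega>\<in>space P. H t \<omega> \<ge> w} \<in> sets P" by measurable
      show "integrable P (\<lambda>\<omega>. min (H t \<omega>) w)"
        using H_nonneg t w by (intro integrable_const_bound[where B=w] AE_I2) auto
      show "0 \<le> min (H t \<omega>) w" if "\<omega> \<in> space P" for \<omega> using H_nonneg[OF that t] w by simp
      show "w \<le> H t \<omega>" if "\<omega> \<in> space P" "\<omega> \<notin> Q \<or> w \<le> B t \<omega>" for \<omega>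
        using that H_mono[OF that(1) order_refl t] w unfolding Q_def B_def by (auto split: if_splits)
      \<comment> \<open>On \<open>Q\<close> the process \<open>B\<close> is \<open>H\<close>, so
        \<open>B s < w\<close> bounds \<open>H s\<close> by \<open>w\<close>, and monotonicity
        bounds it by \<open>H t\<close>.\<close>
      show "H s \<omega> \<le> min (H t \<omega>) w" if "\<omega> \<in> Q" "0 \<le> s" "s \<le> t" "B s \<omega> < w" for \<omega> s
        using that H_mono[of \<omega> s t] unfolding B_def Q_def by auto
    qed
  qed
  show "AE \<omega> in P. cond_probability P (F 0) (\<lambda>\<omega>. running_sup X t \<omega> > u) \<omega>
       \<le> bihari_G_inv \<eta> c (G (real_cond_exp P (F 0) (H t) \<omega>) + ereal R) / u
         + cond_probability P (F 0) (\<lambda>\<omega>. A t \<omega> > R) \<omega>"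
    if int: "integrable P (H t)"
  proof -
    \<comment> \<open>The zero process never reaches the level 1, so \<open>hit\<close> depends on
      \<open>A\<close> alone and the escape event is empty; \<open>H t\<close> itself dominates
      \<open>H\<close> up to \<open>t\<close>.\<close>
    interpret stochastic_bihari P F \<eta> c X A H "\<lambda>_ _. 0" M t u 1
    proof unfold_locales
      show "predictable_process P F (\<lambda>_ _. 0)" unfolding predictable_process_def by simp
      show "nondecreasing_process P (\<lambda>_ _. 0)" unfolding nondecreasing_process_def by (simp add: mono_on_def)
      show "cadlag_process P (\<lambda>_ _. 0)" unfolding cadlag_process_def by auto
    qed (use assms t u in auto)
    have Q: "space P \<in> sets (F 0)" using sets.top[of "F 0"] space_F[of 0] by simp
    have "AE \<omega> in P. cond_probability P (F 0) (\<lambda>\<omega>. running_sup X t \<omega> > u) \<omega>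
       \<le> bihari_G_inv \<eta> c (G (real_cond_exp P (F 0) (H t) \<omega>) + ereal R) / u
         + cond_probability P (F 0) (\<lambda>_. False) \<omega> + cond_probability P (F 0) (\<lambda>\<omega>. A t \<omega> > R) \<omega>"
      using H_nonneg H_mono t by (intro tail_estimate[OF R Q]) (auto simp: int)
    moreover have "AE \<omega> in P. cond_probability P (F 0) (\<lambda>_. False) \<omega> = 0"
    proof -
      have "indicat_real {\<omega>\<in>space P. False} = (\<lambda>_. 0)" by auto
      then show ?thesis
        unfolding cond_probability_def
        using sigma_finite_subalgebra.real_cond_exp_F_meas[OF sigma_finite_subalgebra_F, of 0 "\<lambda>_. 0"] by simp
    qed
    ultimately show ?thesis by eventually_elim simp
  qed
qed

end
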